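(* Let $U(t,t_0)$ ($t,t_0>0$) be the classical evolution of the field of the linearly polarised Gowdy $T^3$ model, and let $J_0$ be the reference complex structure, both as defined in the context. Let $J$ be any compatible complex structure on the phase space $\mathcal P$ which is invariant under all $S^1$-translations, i.e. $T_\alpha^{-1}JT_\alpha=J$ for all $\alpha\in S^1$. If the dynamics is unitarily implementable in the Fock representation defined by $J$, i.e. $U(t,t_0)$ is unitarily implementable with respect to $J$ for all $t,t_0>0$, then the Fock representation defined by $J$ is unitarily equivalent to the Fock representation defined by $J_0$.
   Context: Phase space (zero mode removed). $\mathcal P$ is the real vector space of pairs $(\xi,P)$ of smooth real functions on $S^1=\mathbb R/2\pi\mathbb Z$ with zero mean, with symplectic form $\Omega((\xi_1,P_1),(\xi_2,P_2))=\oint(\xi_2P_1-\xi_1P_2)\,d\theta$. Write $\xi=\sum_{n\ne0}\xi_n e^{in\theta}/\sqrt{2\pi}$, $P=\sum_{n\neq 0} P^n e^{in\theta}/\sqrt{2\pi}$ and, for $m\in\mathbb N=\{1,2,\dots\}$, $b_m=(m\xi_m+iP^m)/\sqrt{2m}$, $b_{-m}^*=(m\xi_m-iP^m)/\sqrt{2m}$ ($*$ is complex conjugation; $b_m^*$, $b_{-m}$ are the conjugates). Put $B_m=(b_m,b_{-m}^*,b_{-m},b_m^* )^T$. A real-linear map $A$ of $\mathcal P$ is block diagonal with $4\times4$ blocks $A_m$ if it acts by $B_m\mapsto A_mB_m$ for all $m$. Translations: $T_\alpha$ acts by $b_m\mapsto e^{im\alpha}b_m$, $b_{-m}^*\mapsto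 e^{im\alpha}b_{-m}^*$, $b_{-m}\mapsto e^{-im\alpha}b_{-m}$, $b_m^*\mapsto e^{-im\alpha}b_m^*$. Complex structures: a compatible complex structure is a real-linear map $J:\mathcal P\to\mathcal P$ with $J^2=-\mathbf 1$, which is symplectic and such that $\Omega(J\cdot,\cdot)$ is positive definite. It gives the inner product $\langle\cdot,\cdot\rangle_J=\{\Omega(J\cdot,\cdot)-i\Omega(\cdot,\cdot)\}/2$; the completion of $\mathcal P$ is the one-particle Hilbert space of the Fock representation defined by $J$. A real-linear map of $\mathcal P$ is Hilbert-Schmidt with respect to $\langle\cdot,\cdot\rangle_J$ if it extends to a Hilbert-Schmidt (real-linear) operator on this completion. The reference structure $J_0$ is block diagonal with $(J_0)_m=\mathrm{diag}(i,-i,i,-i)$. Unitarity criteria (standard, taken as definitions): a symplectic transformation $A$ is unitarily implementable with respect to $J$ iff its antilinear part $(A+JAJ)/2$ is Hilbert-Schmidt with respect to $\langle\cdot,\cdot\rangle_J$; the Fock representations defined by $J$ and $J_0$ are unitarily equivalent iff $J-J_0$ is Hilbert-Schmidt with respect to $\langle\cdot,\cdot\rangle_{J_0}$. Gowdy dynamics: $U(t,t_0)$ is the evolution from time $t_0$ to time $t$ of the equations $\dot\xi=P$, $\dot P=\xi''-\xi/(4t^2)$ on $\mathcal P$. Explicitly it is block diagonal, with blocks $$U_m(t,t_0)=\begin{pmatrix}\mathcal U_m&0\\0&\mathcal U_m\end{pmatrix},\quad \mathcal U_m=\begin{pmatrix}\alpha_m(t,t_0)&\beta_m(t,t_0)\\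 \beta_m^*(t,t_0)&\alpha_m^*(t,t_0)\end{pmatrix},$$ $\alpha_m(t,t_0)=c(mt)c^*(mt_0)-d(mt)d^*(mt_0)$, $\beta_m(t,t_0)=d(mt)c(mt_0)-c(mt)d(mt_0)$, where $c(x)=\sqrt{\pi x/8}\,[(1+\frac{i}{2x})H_0(x)-iH_1(x)]$, $d(x)=\sqrt{\pi x/8}\,[(1+\frac{i}{2x})H_0^*(x)-iH_1^*(x)]$, and $H_0,H_1$ are the zeroth and first order Hankel functions of the second kind. *)

theory Defs
  imports "HOL-Analysis.Analysis"
begin

text \<open>Functions on the circle are represented by \<open>2 * pi\<close>-periodic functions on the real line.\<close>

definition smooth :: "(real \<Rightarrow> real) \<Rightarrow> bool" where
  "smooth f \<longleftrightarrow> (\<forall>k x. (deriv ^^ k) f field_differentiable at x)"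

lemma smooth_deriv: "smooth f \<Longrightarrow> smooth (deriv f)"
  unfolding smooth_def by (metis funpow_Suc_right comp_apply)

lemma smooth_imp_continuous: "smooth f \<Longrightarrow> continuous_on S f"
  unfolding smooth_def
  by (metis continuous_at_imp_continuous_on field_differentiable_imp_continuous_at funpow_0)

lemma smooth_imp_integrable: "smooth f \<Longrightarrow> f integrable_on {a..b}"
  by (intro integrable_continuous_real smooth_imp_continuous)

lemma funpow_deriv_add:
  assumes "smooth f" "smooth g"
  shows "(deriv ^^ k) (\<lambda>x. f x + g x) = (\<lambda>x. (deriv ^^ k) f x + (deriv ^^ k) g x)"
proof (induction k)
  case (Suc k)
  then show ?case using assms by (auto simp: smooth_def)
qed simp

lemma funpow_deriv_cmult:
  assumes "smooth f"
  shows "(deriv ^^ k) (\<lambda>x. c * f x) = (\<lambda>x. c * (deriv ^^ k) f x)"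
proof (induction k)
  case (Suc k)
  then show ?case using assms by (auto simp: smooth_def)
qed simp

lemma smooth_add: "smooth f \<Longrightarrow> smooth g \<Longrightarrow> smooth (\<lambda>x. f x + g x)"
  using funpow_deriv_add[of f g]
  by (auto simp: smooth_def intro: field_differentiable_add)

lemma smooth_cmult: "smooth f \<Longrightarrow> smooth (\<lambda>x. c * f x)"
  using funpow_deriv_cmult[of f]
  by (auto simp: smooth_def intro: field_differentiable_mult)

lemma smooth_zero: "smooth (\<lambda>_. 0)"
proof -
  have "(deriv ^^ k) (\<lambda>_::real. 0::real) = (\<lambda>_. 0)" for k
    by (induction k) auto
  then show ?thesis by (simp add: smooth_def)
qed

typedef zero_mean_fun =
  "{f :: real \<Rightarrow> real. smooth f \<and> (\<forall>\<theta>. f (\<theta> + 2 * pi) = f \<theta>) \<and> integral {0..2 * pi} f = 0}"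
  morphisms apply_fun Abs_zero_mean_fun
  by (rule exI[of _ "\<lambda>_. 0"]) (simp add: smooth_zero)

setup_lifting type_definition_zero_mean_fun

instantiation zero_mean_fun :: real_vector
begin

lift_definition zero_zero_mean_fun :: zero_mean_fun is "\<lambda>_. 0"
  by (simp add: smooth_zero)

lift_definition plus_zero_mean_fun :: "zero_mean_fun \<Rightarrow> zero_mean_fun \<Rightarrow> zero_mean_fun"
  is "\<lambda>f g \<theta>. f \<theta> + g \<theta>"
  by (simp add: smooth_add integral_add smooth_imp_integrable)

lift_definition scaleR_zero_mean_fun :: "real \<Rightarrow> zero_mean_fun \<Rightarrow> zero_mean_fun"
  is "\<lambda>c f \<theta>. c * f \<theta>"
  by (simp add: smooth_cmult)

lift_definition uminus_zero_mean_fun :: "zero_mean_fun \<Rightarrow> zero_mean_fun"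
  is "\<lambda>f \<theta>. - f \<theta>"
  using smooth_cmult[where c = "-1"] by simp

lift_definition minus_zero_mean_fun :: "zero_mean_fun \<Rightarrow> zero_mean_fun \<Rightarrow> zero_mean_fun"
  is "\<lambda>f g \<theta>. f \<theta> - g \<theta>"
  using smooth_add[OF _ smooth_cmult[where c = "-1"]]
  by (simp add: integral_diff smooth_imp_integrable)

instance
  by standard (transfer; simp add: fun_eq_iff algebra_simps)+

end

type_synonym phase = "zero_mean_fun \<times> zero_mean_fun"

definition Omega :: "phase \<Rightarrow> phase \<Rightarrow> real" where
  "Omega x y = integral {0..2 * pi}
     (\<lambda>\<theta>. apply_fun (fst y) \<theta> * apply_fun (snd x) \<theta> - apply_fun (fst x) \<theta> * apply_fun (snd y) \<theta>)"

definition fourier_coeff :: "zero_mean_fun \<Rightarrow> int \<Rightarrow> complex" where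
  "fourier_coeff f n = integral {0..2 * pi}
     (\<lambda>\<theta>. complex_of_real (apply_fun f \<theta>) * cis (- of_int n * \<theta>)) / of_real (sqrt (2 * pi))"

definition mode_b :: "nat \<Rightarrow> phase \<Rightarrow> complex" where
  "mode_b m x = (of_nat m * fourier_coeff (fst x) (int m) + \<i> * fourier_coeff (snd x) (int m))
                  / of_real (sqrt (2 * real m))"

text \<open>\<open>mode_b_neg_star m\<close> is the variable written \<open>b\<^sub>-\<^sub>m\<close> with a star.\<close>

definition mode_b_neg_star :: "nat \<Rightarrow> phase \<Rightarrow> complex" where
  "mode_b_neg_star m x =
     (of_nat m * fourier_coeff (fst x) (int m) - \<i> * fourier_coeff (snd x) (int m))
       / of_real (sqrt (2 * real m))"

definition modes :: "nat \<Rightarrow> phase \<Rightarrow> complex ^ 4" where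
  "modes m x = vector [mode_b m x, mode_b_neg_star m x, cnj (mode_b_neg_star m x), cnj (mode_b m x)]"

definition block_diagonal :: "(phase \<Rightarrow> phase) \<Rightarrow> (nat \<Rightarrow> complex ^ 4 ^ 4) \<Rightarrow> bool" where
  "block_diagonal A M \<longleftrightarrow> linear A \<and> (\<forall>m\<ge>1. \<forall>x. modes m (A x) = M m *v modes m x)"

definition diag4 :: "complex \<Rightarrow> complex \<Rightarrow> complex \<Rightarrow> complex \<Rightarrow> complex ^ 4 ^ 4" where
  "diag4 p q r s = vector [vector [p, 0, 0, 0], vector [0, q, 0, 0],
                           vector [0, 0, r, 0], vector [0, 0, 0, s]]"

definition translation_block :: "real \<Rightarrow> nat \<Rightarrow> complex ^ 4 ^ 4" where
  "translation_block \<alpha> m =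
     diag4 (cis (real m * \<alpha>)) (cis (real m * \<alpha>)) (cis (- real m * \<alpha>)) (cis (- real m * \<alpha>))"

definition reference_block :: "nat \<Rightarrow> complex ^ 4 ^ 4" where
  "reference_block m = diag4 \<i> (- \<i>) \<i> (- \<i>)"

definition symplectic :: "(phase \<Rightarrow> phase) \<Rightarrow> bool" where
  "symplectic A \<longleftrightarrow> linear A \<and> (\<forall>x y. Omega (A x) (A y) = Omega x y)"

definition compatible_complex_structure :: "(phase \<Rightarrow> phase) \<Rightarrow> bool" where
  "compatible_complex_structure J \<longleftrightarrow>
     linear J \<and> (\<forall>x. J (J x) = - x) \<and> symplectic J \<and> (\<forall>x. x \<noteq> 0 \<longrightarrow> Omega (J x) x > 0)"

definition inner_J :: "(phase \<Rightarrow> phase) \<Rightarrow> phase \<Rightarrow> phase \<Rightarrow> complex" where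
  "inner_J J x y = (of_real (Omega (J x) y) - \<i> * of_real (Omega x y)) / 2"

text \<open>
  A completion of the phase space with respect to \<open>inner_J J\<close>: an isometric linear map onto a
  dense subspace of a Hilbert space.  Only the underlying real Hilbert space is recorded (its real
  inner product is the real part of the complex one); this is all that is needed to speak about
  real-linear Hilbert-Schmidt operators.
\<close>

definition is_completion ::
  "(phase \<Rightarrow> phase) \<Rightarrow> (phase \<Rightarrow> 'h::{real_inner,complete_space}) \<Rightarrow> bool" where
  "is_completion J \<iota> \<longleftrightarrow>
     linear \<iota> \<and> (\<forall>x y. \<iota> x \<bullet> \<iota> y = Re (inner_J J x y)) \<and> closure (range \<iota>) = UNIV"

definition orthonormal_basis :: "'h::{real_inner,complete_space} set \<Rightarrow> bool" where
  "orthonormal_basis E \<longleftrightarrow>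
     pairwise orthogonal E \<and> (\<forall>e\<in>E. norm e = 1) \<and> closure (span E) = UNIV"

definition hilbert_schmidt :: "('h::{real_inner,complete_space} \<Rightarrow> 'h) \<Rightarrow> bool" where
  "hilbert_schmidt S \<longleftrightarrow>
     bounded_linear S \<and> (\<exists>E. orthonormal_basis E \<and> (\<lambda>e. (norm (S e))\<^sup>2) summable_on E)"

definition extends_to_hilbert_schmidt ::
  "(phase \<Rightarrow> 'h::{real_inner,complete_space}) \<Rightarrow> (phase \<Rightarrow> phase) \<Rightarrow> bool" where
  "extends_to_hilbert_schmidt \<iota> A \<longleftrightarrow> (\<exists>S. hilbert_schmidt S \<and> (\<forall>x. S (\<iota> x) = \<iota> (A x)))"

definition antilinear_part :: "(phase \<Rightarrow> phase) \<Rightarrow> (phase \<Rightarrow> phase) \<Rightarrow> phase \<Rightarrow> phase" where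
  "antilinear_part J A x = (1 / 2) *\<^sub>R (A x + J (A (J x)))"

text \<open>In the next two definitions \<open>\<iota>\<close> is a completion for \<open>J\<close>, and \<open>\<iota>0\<close> one for \<open>J0\<close>.\<close>

definition unitarily_implementable ::
  "(phase \<Rightarrow> phase) \<Rightarrow> (phase \<Rightarrow> 'h::{real_inner,complete_space}) \<Rightarrow> (phase \<Rightarrow> phase) \<Rightarrow> bool" where
  "unitarily_implementable J \<iota> A \<longleftrightarrow> extends_to_hilbert_schmidt \<iota> (antilinear_part J A)"

definition fock_equivalent ::
  "(phase \<Rightarrow> phase) \<Rightarrow> (phase \<Rightarrow> phase) \<Rightarrow> (phase \<Rightarrow> 'h::{real_inner,complete_space}) \<Rightarrow> bool" where
  "fock_equivalent J J0 \<iota>0 \<longleftrightarrow> extends_to_hilbert_schmidt \<iota>0 (\<lambda>x. J x - J0 x)"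

text \<open>Bessel functions of integer order at positive real argument, by their power series
  (for the second kind: DLMF 10.8.1).\<close>

definition bessel_J :: "nat \<Rightarrow> real \<Rightarrow> real" where
  "bessel_J n x = (\<Sum>k. (-1) ^ k / (fact k * fact (n + k)) * (x / 2) ^ (2 * k + n))"

definition bessel_Y :: "nat \<Rightarrow> real \<Rightarrow> real" where
  "bessel_Y n x =
     2 / pi * ln (x / 2) * bessel_J n x
     - 1 / pi * (\<Sum>k<n. fact (n - k - 1) / fact k * (x / 2) powi (2 * int k - int n))
     - 1 / pi * (\<Sum>k. (-1) ^ k * (Digamma (real k + 1) + Digamma (real (n + k) + 1))
                       / (fact k * fact (n + k)) * (x / 2) ^ (2 * k + n))"

definition hankel2 :: "nat \<Rightarrow> real \<Rightarrow> complex" where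
  "hankel2 n x = of_real (bessel_J n x) - \<i> * of_real (bessel_Y n x)"

text \<open>
  Up to a constant factor, \<open>gowdy_c (m * t)\<close> and \<open>gowdy_d (m * t)\<close> are the values of the variable
  \<open>mode_b m\<close> for the mode solutions \<open>\<xi> = sqrt t * H\<^sub>0 (m * t)\<close> and its complex conjugate of the system
  \<open>\<xi>' = P\<close>, \<open>P' = - (m\<^sup>2 + 1 / (4 * t\<^sup>2)) * \<xi>\<close>; normalised by \<open>|c|\<^sup>2 - |d|\<^sup>2 = 1\<close>.
\<close>

definition gowdy_c :: "real \<Rightarrow> complex" where
  "gowdy_c x = of_real (sqrt (pi * x / 8)) *
     ((1 + \<i> / of_real (2 * x)) * hankel2 0 x - \<i> * hankel2 1 x)"

definition gowdy_d :: "real \<Rightarrow> complex" where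
  "gowdy_d x = of_real (sqrt (pi * x / 8)) *
     ((1 + \<i> / of_real (2 * x)) * cnj (hankel2 0 x) - \<i> * cnj (hankel2 1 x))"

definition gowdy_alpha :: "nat \<Rightarrow> real \<Rightarrow> real \<Rightarrow> complex" where
  "gowdy_alpha m t t0 =
     gowdy_c (m * t) * cnj (gowdy_c (m * t0)) - gowdy_d (m * t) * cnj (gowdy_d (m * t0))"

definition gowdy_beta :: "nat \<Rightarrow> real \<Rightarrow> real \<Rightarrow> complex" where
  "gowdy_beta m t t0 =
     gowdy_d (m * t) * gowdy_c (m * t0) - gowdy_c (m * t) * gowdy_d (m * t0)"

definition gowdy_block :: "real \<Rightarrow> real \<Rightarrow> nat \<Rightarrow> complex ^ 4 ^ 4" where
  "gowdy_block t t0 m = (let a = gowdy_alpha m t t0; b = gowdy_beta m t t0 in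
     vector [vector [a, b, 0, 0],
             vector [cnj b, cnj a, 0, 0],
             vector [0, 0, a, b],
             vector [0, 0, cnj b, cnj a]])"

end

theory Submission
  imports Defs "HOL-Library.Periodic_Fun"
begin

text \<open>
  Translation invariance and compatibility force \<open>J\<close> to act on the pair formed by the \<open>b\<close> and \<open>b\<close>-star
  variables of mode \<open>m\<close> by the matrix with rows \<open>(i a, q)\<close> and \<open>(cnj q, - i a)\<close>, where
  \<open>a\<^sup>2 = 1 + |q|\<^sup>2\<close> and \<open>a > 0\<close>; equivalence with \<open>J0\<close> means that \<open>|q|\<^sup>2\<close> is summable over \<open>m\<close>.
  With \<open>s = - i cnj q / (1 + a)\<close>, the coefficient of the antilinear part of the evolution
  between the eigenvectors \<open>(1, s)\<close> and \<open>(cnj s, 1)\<close> of \<open>J\<close> is, up to a factor at least 1 in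
  modulus, \<open>2 i s Im \<alpha> + s\<^sup>2 \<beta> - cnj \<beta>\<close>. The Gowdy equation gives \<open>\<beta> = O(1/m)\<close> and
  \<open>Im \<alpha> = - sin (m (t - t0)) + O(1/m)\<close>, so implementability makes \<open>|s|\<^sup>2 sin\<^sup>2 (m \<tau>)\<close> summable for
  every \<open>\<tau>\<close>. By Baire's theorem the sums are bounded on some interval, and integrating over it
  shows that \<open>|s|\<^sup>2\<close>, and therefore \<open>|q|\<^sup>2\<close>, is summable.
\<close>

section \<open>Bessel functions of order 0 and 1\<close>

text \<open>The obstacle is the lack of an a priori bound: \<open>J\<close> is not known to be
  continuous for the norm of \<open>J0\<close>, and q may grow with m. Invariance is therefore
  exploited only on vectors with a single mode, and the passage to the whole phase space uses the
  skewness of \<open>J\<close> for \<open>Omega\<close>, which supplies a formal adjoint that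
  preserves each mode. The working unknown is s, since (1 + a) |s|^2 = a - 1 gives |s| < 1 whatever
  q is. The factor mentioned above is 1 / (1 - |s|^2), from normalising the eigenvectors; being at
  least 1 it may be dropped from a lower bound. Only after s has been shown to tend to 0 is a
  bounded, and |q| = (1 + a) |s| carries summability over to q. The asymptotics rest on c and the
  conjugate of d being multiples of u + i u' and u - i u' for one solution u of u'' = - (1 + 1 / (4
  x^2)) u. Without their phases exp (- i x) and exp (i x) they have derivatives O(1/x^2), so their
  amplitudes at m t and m t0 differ by O(1/m); for equal amplitudes \<beta> would vanish and
  \<alpha> would be exp (- i m (t - t0)). Fourier analysis serves to make finite mode sums dense in
  the completion for \<open>J0\<close>.\<close>

lemma summable_power_series_exp_bound:
  fixes c :: "nat \<Rightarrow> real" and z :: real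
  assumes "\<And>k. \<bar>c k\<bar> \<le> C * 2 ^ k / fact k"
  shows "summable (\<lambda>k. c k * z ^ k)"
proof (rule summable_comparison_test')
  show "summable (\<lambda>k. C * (inverse (fact k) * (2 * \<bar>z\<bar>) ^ k))"
    by (intro summable_mult summable_exp)
  show "norm (c k * z ^ k) \<le> C * (inverse (fact k) * (2 * \<bar>z\<bar>) ^ k)" for k
    using mult_right_mono[OF assms[of k], of "\<bar>z\<bar> ^ k"]
    by (simp add: abs_mult power_abs power_mult_distrib field_simps)
qed

text \<open>The recursion adds at most 1 per step, and doubling a bound that is at least 1 absorbs
  this. The resulting powers of 2 are harmless next to the factorials.\<close>

lemma abs_Digamma_nat_le: "\<bar>Digamma (real k + 1)\<bar> \<le> (\<bar>euler_mascheroni\<bar> + 1) * 2 ^ k"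
proof (induction k)
  case 0 show ?case by simp
next
  case (Suc k)
  have "Digamma (real (Suc k) + 1) = Digamma (real k + 1) + 1 / (real k + 1)"
    using Digamma_plus1[of "real k + 1"] by (simp add: add_ac)
  then have "\<bar>Digamma (real (Suc k) + 1)\<bar> \<le> \<bar>Digamma (real k + 1)\<bar> + \<bar>1 / (real k + 1)\<bar>"
    by (metis abs_triangle_ineq)
  moreover have "\<bar>1 / (real k + 1)\<bar> \<le> 1" by simp
  moreover have "1 \<le> (\<bar>euler_mascheroni\<bar> + 1) * (2::real) ^ k"
    by (metis abs_ge_zero le_add_same_cancel2 mult_mono one_le_power one_le_numeral mult_1 zero_le_one add_nonneg_nonneg)
  ultimately have "\<bar>Digamma (real (Suc k) + 1)\<bar> \<le> 2 * ((\<bar>euler_mascheroni\<bar> + 1) * 2 ^ k)"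
    using Suc.IH unfolding mult_2 by (meson add_mono order_trans)
  then show ?case by (simp add: mult.left_commute)
qed

text \<open>In the variable z = x^2 / 4 the Bessel series become power series that converge
  everywhere. \<open>j0\<close> and \<open>j1\<close> carry J of order 0 and 1, while
  \<open>y0\<close> and \<open>y1\<close> are the parts of Y of order 0 and 1 free of logarithm and
  pole.\<close>

definition j0_coeff :: "nat \<Rightarrow> real" where
  "j0_coeff k = (-1) ^ k / (fact k * fact k)"
definition j1_coeff :: "nat \<Rightarrow> real" where
  "j1_coeff k = (-1) ^ k / (fact k * fact (Suc k))"
definition y0_coeff :: "nat \<Rightarrow> real" where
  "y0_coeff k = (-1) ^ k * (2 * Digamma (real k + 1)) / (fact k * fact k)"
definition y1_coeff :: "nat \<Rightarrow> real" where
  "y1_coeff k = (-1) ^ k * (Digamma (real k + 1) + Digamma (real k + 2)) / (fact k * fact (Suc k))"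

definition j0 :: "real \<Rightarrow> real" where "j0 z = (\<Sum>k. j0_coeff k * z ^ k)"
definition j1 :: "real \<Rightarrow> real" where "j1 z = (\<Sum>k. j1_coeff k * z ^ k)"
definition y0 :: "real \<Rightarrow> real" where "y0 z = (\<Sum>k. y0_coeff k * z ^ k)"
definition y1 :: "real \<Rightarrow> real" where "y1 z = (\<Sum>k. y1_coeff k * z ^ k)"

lemma inverse_fact_bounds:
  "1 / (fact k * fact k) \<le> 1 / (fact k :: real)" "1 / (fact k * fact (Suc k)) \<le> 1 / (fact k :: real)"
  using fact_ge_1[of k, where 'a=real] fact_ge_1[of "Suc k", where 'a=real]
  by (auto simp: field_simps simp del: fact_Suc)

lemma Digamma_nat_Suc: "Digamma (real k + 2) = Digamma (real k + 1) + 1 / (real k + 1)"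
  using Digamma_plus1[of "real k + 1"] by (simp add: add_ac)

lemma summable_j0: "summable (\<lambda>k. j0_coeff k * z ^ k)"
proof (rule summable_power_series_exp_bound[where C = 1])
  fix k
  have "1 / (fact k * fact k) \<le> 1 / (fact k :: real)" by (rule inverse_fact_bounds)
  also have "\<dots> \<le> 1 * 2 ^ k / fact k" by (simp add: field_simps)
  finally show "\<bar>j0_coeff k\<bar> \<le> 1 * 2 ^ k / fact k" by (simp add: j0_coeff_def abs_mult power_abs)
qed

lemma summable_j1: "summable (\<lambda>k. j1_coeff k * z ^ k)"
proof (rule summable_power_series_exp_bound[where C = 1])
  fix k
  have "1 / (fact k * fact (Suc k)) \<le> 1 / (fact k :: real)" by (rule inverse_fact_bounds)
  also have "\<dots> \<le> 1 * 2 ^ k / fact k" by (simp add: field_simps)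
  finally show "\<bar>j1_coeff k\<bar> \<le> 1 * 2 ^ k / fact k"
    by (simp add: j1_coeff_def abs_mult power_abs del: fact_Suc)
qed

lemma summable_y0: "summable (\<lambda>k. y0_coeff k * z ^ k)"
proof (rule summable_power_series_exp_bound[where C = "2 * (\<bar>euler_mascheroni\<bar> + 1)"])
  fix k
  have "\<bar>y0_coeff k\<bar> = 2 * \<bar>Digamma (real k + 1)\<bar> * (1 / (fact k * fact k))"
    by (simp add: y0_coeff_def abs_mult power_abs)
  also have "\<dots> \<le> 2 * ((\<bar>euler_mascheroni\<bar> + 1) * 2 ^ k) * (1 / fact k)"
    by (intro mult_mono inverse_fact_bounds abs_Digamma_nat_le) auto
  finally show "\<bar>y0_coeff k\<bar> \<le> 2 * (\<bar>euler_mascheroni\<bar> + 1) * 2 ^ k / fact k"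
    by (simp only: mult.assoc times_divide_eq_right mult_1_right)
qed

lemma summable_y1: "summable (\<lambda>k. y1_coeff k * z ^ k)"
proof (rule summable_power_series_exp_bound[where C = "3 * (\<bar>euler_mascheroni\<bar> + 1)"])
  fix k
  have "\<bar>Digamma (real k + 2)\<bar> \<le> (\<bar>euler_mascheroni\<bar> + 1) * 2 ^ Suc k"
    using abs_Digamma_nat_le[of "Suc k"] by (simp add: add_ac)
  then have D: "\<bar>Digamma (real k + 1) + Digamma (real k + 2)\<bar> \<le> 3 * ((\<bar>euler_mascheroni\<bar> + 1) * 2 ^ k)"
    using abs_Digamma_nat_le[of k] by simp
  have "\<bar>y1_coeff k\<bar> = \<bar>Digamma (real k + 1) + Digamma (real k + 2)\<bar> * (1 / (fact k * fact (Suc k)))"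
    by (simp add: y1_coeff_def abs_mult power_abs del: fact_Suc)
  also have "\<dots> \<le> 3 * ((\<bar>euler_mascheroni\<bar> + 1) * 2 ^ k) * (1 / fact k)"
    by (intro mult_mono inverse_fact_bounds D) auto
  finally show "\<bar>y1_coeff k\<bar> \<le> 3 * (\<bar>euler_mascheroni\<bar> + 1) * 2 ^ k / fact k"
    by (simp only: mult.assoc times_divide_eq_right mult_1_right)
qed

lemma DERIV_j0: "(j0 has_real_derivative - j1 z) (at z)"
proof -
  have "diffs j0_coeff = (\<lambda>k. - j1_coeff k)"
    by (auto simp: diffs_def j0_coeff_def j1_coeff_def field_simps simp del: of_nat_Suc)
  then have "(\<lambda>k. diffs j0_coeff k * z ^ k) = (\<lambda>k. - (j1_coeff k * z ^ k))" by simp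
  then have "(\<Sum>k. diffs j0_coeff k * z ^ k) = - j1 z"
    using suminf_minus[OF summable_j1[of z]] unfolding j1_def by simp
  then show ?thesis
    using termdiffs_strong_converges_everywhere[of j0_coeff z, OF summable_j0]
    by (simp add: j0_def[abs_def])
qed

text \<open>The series form of (x J1)' = x J0; the auxiliary \<open>c\<close> holds the coefficients
  of z j1(z), shifted by one.\<close>

lemma DERIV_j1: "((\<lambda>z. z * j1 z) has_real_derivative j0 z) (at z)"
proof -
  define c where "c k = (case k of 0 \<Rightarrow> 0 | Suc n \<Rightarrow> j1_coeff n)" for k
  have shift: "(\<lambda>k. c (Suc k) * w ^ Suc k) = (\<lambda>k. w * (j1_coeff k * w ^ k))" for w
    by (auto simp: c_def)
  have sc: "summable (\<lambda>k. c k * w ^ k)" for w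
    by (subst summable_Suc_iff[symmetric]) (simp only: shift, intro summable_mult summable_j1)
  have "(\<Sum>k. c k * w ^ k) = w * j1 w" for w
    using suminf_split_head[OF sc, of w] unfolding shift
    by (simp add: suminf_mult[OF summable_j1] j1_def c_def)
  moreover have "diffs c = j0_coeff"
    by (auto simp: diffs_def c_def j0_coeff_def j1_coeff_def field_simps simp del: of_nat_Suc)
  ultimately show ?thesis
    using termdiffs_strong_converges_everywhere[OF sc, of z] by (simp add: j0_def)
qed

text \<open>The two Digamma values in \<open>y1_coeff\<close> differ by 1 / (k + 1), which produces
  the extra \<open>j1\<close>. In the derivative of Y1 that term cancels what comes from
  differentiating the logarithm.\<close>

lemma DERIV_y1: "((\<lambda>z. z * y1 z) has_real_derivative y0 z + j1 z) (at z)"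
proof -
  define c where "c k = (case k of 0 \<Rightarrow> 0 | Suc n \<Rightarrow> y1_coeff n)" for k
  have shift: "(\<lambda>k. c (Suc k) * w ^ Suc k) = (\<lambda>k. w * (y1_coeff k * w ^ k))" for w
    by (auto simp: c_def)
  have sc: "summable (\<lambda>k. c k * w ^ k)" for w
    by (subst summable_Suc_iff[symmetric]) (simp only: shift, intro summable_mult summable_y1)
  have "(\<Sum>k. c k * w ^ k) = w * y1 w" for w
    using suminf_split_head[OF sc, of w] unfolding shift
    by (simp add: suminf_mult[OF summable_y1] y1_def c_def)
  moreover have "diffs c k = y0_coeff k + j1_coeff k" for k
  proof -
    have D: "Digamma (real k + 2) = Digamma (real k + 1) + 1 / real (Suc k)"
      using Digamma_nat_Suc[of k] by (simp add: add_ac)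
    show ?thesis
      unfolding diffs_def c_def j1_coeff_def y0_coeff_def y1_coeff_def D
      by (simp add: D field_simps del: of_nat_Suc)
  qed
  then have "(\<Sum>k. diffs c k * z ^ k) = y0 z + j1 z"
    by (simp add: distrib_right suminf_add[OF summable_y0 summable_j1] y0_def j1_def)
  ultimately show ?thesis
    using termdiffs_strong_converges_everywhere[OF sc, of z] by simp
qed

text \<open>The term (1 - j0 z) / z again stems from the Digamma recursion. In the derivative of Y0
  it joins J0 / x from the logarithm, and together they leave the polar term of Y1.\<close>

lemma DERIV_y0:
  assumes "z \<noteq> 0"
  shows "(y0 has_real_derivative - y1 z - (1 - j0 z) / z) (at z)"
proof -
  have s: "summable (\<lambda>k. - j0_coeff (Suc k) * z ^ k)"
  proof -
    have "summable (\<lambda>k. (- 1 / z) * (j0_coeff (Suc k) * z ^ Suc k))"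
      by (intro summable_mult) (use summable_j0[of z] summable_Suc_iff[of "\<lambda>k. j0_coeff k * z ^ k"] in simp)
    then show ?thesis using assms by simp
  qed
  have "j0 z = j0_coeff 0 + (\<Sum>k. j0_coeff (Suc k) * z ^ Suc k)"
    using suminf_split_head[OF summable_j0, of z] by (simp add: j0_def)
  also have "(\<Sum>k. j0_coeff (Suc k) * z ^ Suc k) = (\<Sum>k. (- z) * (- j0_coeff (Suc k) * z ^ k))"
    by (simp add: mult_ac)
  also have "\<dots> = - z * (\<Sum>k. - j0_coeff (Suc k) * z ^ k)"
    by (rule suminf_mult[OF s])
  finally have t: "(\<Sum>k. - j0_coeff (Suc k) * z ^ k) = (1 - j0 z) / z"
    using assms by (simp add: field_simps j0_coeff_def)
  have c: "diffs y0_coeff k = - y1_coeff k - (- j0_coeff (Suc k))" for k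
  proof -
    have D: "Digamma (real (Suc k) + 1) = Digamma (real k + 1) + 1 / real (Suc k)"
      "Digamma (real k + 2) = Digamma (real k + 1) + 1 / real (Suc k)"
      using Digamma_nat_Suc[of k] by (simp_all add: add_ac)
    show ?thesis
      unfolding diffs_def j0_coeff_def y0_coeff_def y1_coeff_def D
      by (simp add: field_simps del: of_nat_Suc)
  qed
  have "(\<Sum>k. diffs y0_coeff k * z ^ k) = - y1 z - (1 - j0 z) / z"
    unfolding c left_diff_distrib t[symmetric] y1_def
    using suminf_diff[OF summable_minus[OF summable_y1] s, of z] suminf_minus[OF summable_y1, of z]
    by (simp add: mult_minus_left)
  then show ?thesis
    using termdiffs_strong_converges_everywhere[of y0_coeff z, OF summable_y0]
    by (simp add: y0_def[abs_def])
qed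

section \<open>From the series back to the Bessel functions: their first-order differential
  relations\<close>

lemma bessel_J_0: "bessel_J 0 x = j0 (x\<^sup>2 / 4)"
  by (simp add: bessel_J_def j0_def j0_coeff_def power_mult power_divide)

lemma half_power_odd: "(x / 2) ^ (2 * k + 1) = x / 2 * (x\<^sup>2 / 4) ^ k" for x :: real
proof -
  have "((x / 2) ^ 2) ^ k = (x\<^sup>2 / 4) ^ k" by (simp add: power_divide)
  then show ?thesis by (metis power_add power_mult power_one_right mult.commute)
qed

lemma bessel_J_1: "bessel_J 1 x = x / 2 * j1 (x\<^sup>2 / 4)"
proof -
  have "bessel_J 1 x = (\<Sum>k. x / 2 * (j1_coeff k * (x\<^sup>2 / 4) ^ k))"
    unfolding bessel_J_def half_power_odd by (simp add: j1_coeff_def mult_ac)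
  then show ?thesis by (simp only: suminf_mult[OF summable_j1] j1_def)
qed

lemma bessel_Y_0: "bessel_Y 0 x = 2 / pi * ln (x / 2) * j0 (x\<^sup>2 / 4) - 1 / pi * y0 (x\<^sup>2 / 4)"
  unfolding bessel_Y_def bessel_J_0
  by (simp add: y0_def y0_coeff_def power_mult power_divide)

lemma bessel_Y_1:
  "bessel_Y 1 x = 2 / pi * ln (x / 2) * (x / 2 * j1 (x\<^sup>2 / 4)) - 2 / (pi * x) - 1 / pi * (x / 2 * y1 (x\<^sup>2 / 4))"
proof -
  have "(\<Sum>k. (-1) ^ k * (Digamma (real k + 1) + Digamma (real (1 + k) + 1)) / (fact k * fact (1 + k)) * (x / 2) ^ (2 * k + 1))
      = (\<Sum>k. x / 2 * (y1_coeff k * (x\<^sup>2 / 4) ^ k))"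
    unfolding half_power_odd by (simp add: y1_coeff_def mult_ac add_ac)
  also have "\<dots> = x / 2 * y1 (x\<^sup>2 / 4)"
    by (simp only: suminf_mult[OF summable_y1] y1_def)
  finally have S: "(\<Sum>k. (-1) ^ k * (Digamma (real k + 1) + Digamma (real (1 + k) + 1)) / (fact k * fact (1 + k)) * (x / 2) ^ (2 * k + 1))
      = x / 2 * y1 (x\<^sup>2 / 4)" .
  have F: "(\<Sum>k<1. fact (1 - k - 1) / fact k * (x / 2) powi (2 * int k - int 1)) = 2 / x"
    by (simp add: power_int_minus)
  show ?thesis
    unfolding bessel_Y_def bessel_J_1 S F by simp
qed

lemma DERIV_bessel_J_0: "(bessel_J 0 has_real_derivative - bessel_J 1 x) (at x)"
proof -
  have "((\<lambda>x. j0 (x\<^sup>2 / 4)) has_real_derivative - j1 (x\<^sup>2 / 4) * (2 * x / 4)) (at x)"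
    by (rule DERIV_chain2[OF DERIV_j0]) (auto intro!: derivative_eq_intros)
  moreover have "bessel_J 0 = (\<lambda>x. j0 (x\<^sup>2 / 4))" by (simp add: fun_eq_iff bessel_J_0)
  moreover have "- j1 (x\<^sup>2 / 4) * (2 * x / 4) = - bessel_J 1 x"
    by (simp add: bessel_J_1 del: One_nat_def)
  ultimately show ?thesis by simp
qed

lemma DERIV_bessel_J_1:
  assumes "x > 0"
  shows "(bessel_J 1 has_real_derivative bessel_J 0 x - bessel_J 1 x / x) (at x)"
proof -
  \<comment> \<open>\<open>DERIV_j1\<close> concerns z j1(z), so J1 is written as 2 / x times this
    product at z = x^2 / 4.\<close>
  have D1: "((\<lambda>x. x\<^sup>2 / 4 * j1 (x\<^sup>2 / 4)) has_real_derivative j0 (x\<^sup>2 / 4) * (2 * x / 4)) (at x)"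
    by (rule DERIV_chain2[OF DERIV_j1]) (auto intro!: derivative_eq_intros)
  have DR: "((\<lambda>x. 2 / x) has_real_derivative - 2 / x\<^sup>2) (at x)"
    using assms by (auto intro!: derivative_eq_intros simp: power2_eq_square)
  have D: "((\<lambda>x. 2 / x * (x\<^sup>2 / 4 * j1 (x\<^sup>2 / 4))) has_real_derivative
      (- 2 / x\<^sup>2) * (x\<^sup>2 / 4 * j1 (x\<^sup>2 / 4)) + j0 (x\<^sup>2 / 4) * (2 * x / 4) * (2 / x)) (at x)"
    by (rule DERIV_mult[OF DR D1])
  have "(- 2 / x\<^sup>2) * (x\<^sup>2 / 4 * j1 (x\<^sup>2 / 4)) + j0 (x\<^sup>2 / 4) * (2 * x / 4) * (2 / x)
      = bessel_J 0 x - bessel_J 1 x / x"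
    using assms unfolding bessel_J_0 bessel_J_1 by (simp add: field_simps)
  with D have D': "((\<lambda>x. 2 / x * (x\<^sup>2 / 4 * j1 (x\<^sup>2 / 4))) has_real_derivative
      bessel_J 0 x - bessel_J 1 x / x) (at x)" by simp
  have Y: "2 / y * (y\<^sup>2 / 4 * j1 (y\<^sup>2 / 4)) = bessel_J 1 y" if "y \<in> {0<..}" for y
    using that unfolding bessel_J_1 by (simp add: power2_eq_square)
  show ?thesis
    by (rule has_field_derivative_transform_within_open[OF D', of "{0<..}"])
      (use assms Y in auto)
qed

lemma DERIV_bessel_Y_0:
  assumes "x > 0"
  shows "(bessel_Y 0 has_real_derivative - bessel_Y 1 x) (at x)"
proof -
  have D0: "((\<lambda>x. y0 (x\<^sup>2 / 4)) has_real_derivative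
      (- y1 (x\<^sup>2 / 4) - (1 - j0 (x\<^sup>2 / 4)) / (x\<^sup>2 / 4)) * (2 * x / 4)) (at x)"
    by (rule DERIV_chain2[OF DERIV_y0]) (use assms in \<open>auto intro!: derivative_eq_intros\<close>)
  have DJ: "((\<lambda>x. j0 (x\<^sup>2 / 4)) has_real_derivative - j1 (x\<^sup>2 / 4) * (2 * x / 4)) (at x)"
    by (rule DERIV_chain2[OF DERIV_j0]) (auto intro!: derivative_eq_intros)
  have DL: "((\<lambda>x. ln (x / 2)) has_real_derivative 1 / x) (at x)"
    using assms by (auto intro!: derivative_eq_intros)
  have "bessel_Y 0 = (\<lambda>x. 2 / pi * (ln (x / 2) * j0 (x\<^sup>2 / 4)) - 1 / pi * y0 (x\<^sup>2 / 4))"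
    by (simp add: fun_eq_iff bessel_Y_0)
  moreover have "2 / pi * (1 / x * j0 (x\<^sup>2 / 4) + - j1 (x\<^sup>2 / 4) * (2 * x / 4) * ln (x / 2)) -
     1 / pi * ((- y1 (x\<^sup>2 / 4) - (1 - j0 (x\<^sup>2 / 4)) / (x\<^sup>2 / 4)) * (2 * x / 4)) = - bessel_Y 1 x"
    unfolding bessel_Y_1 using assms by (simp add: field_simps power2_eq_square)
  ultimately show ?thesis
    using DERIV_diff[OF DERIV_cmult[OF DERIV_mult[OF DL DJ], of "2 / pi"] DERIV_cmult[OF D0, of "1 / pi"]]
    by simp
qed

lemma DERIV_bessel_Y_1:
  assumes "x > 0"
  shows "(bessel_Y 1 has_real_derivative bessel_Y 0 x - bessel_Y 1 x / x) (at x)"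
proof -
  have D1: "((\<lambda>x. x\<^sup>2 / 4 * y1 (x\<^sup>2 / 4)) has_real_derivative
      (y0 (x\<^sup>2 / 4) + j1 (x\<^sup>2 / 4)) * (2 * x / 4)) (at x)"
    by (rule DERIV_chain2[OF DERIV_y1]) (auto intro!: derivative_eq_intros)
  have DL: "((\<lambda>x. ln (x / 2)) has_real_derivative 1 / x) (at x)"
    using assms by (auto intro!: derivative_eq_intros)
  have DR: "((\<lambda>x. 2 / x) has_real_derivative - 2 / x\<^sup>2) (at x)"
    using assms by (auto intro!: derivative_eq_intros simp: power2_eq_square)
  have D: "((\<lambda>x. 2 / pi * (ln (x / 2) * bessel_J 1 x) - (1 / pi * (2 / x) + 1 / pi * (2 / x * (x\<^sup>2 / 4 * y1 (x\<^sup>2 / 4)))))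
     has_real_derivative 2 / pi * (1 / x * bessel_J 1 x + (bessel_J 0 x - bessel_J 1 x / x) * ln (x / 2))
      - (1 / pi * (- 2 / x\<^sup>2) + 1 / pi * (- 2 / x\<^sup>2 * (x\<^sup>2 / 4 * y1 (x\<^sup>2 / 4))
          + (y0 (x\<^sup>2 / 4) + j1 (x\<^sup>2 / 4)) * (2 * x / 4) * (2 / x)))) (at x)"
    by (intro DERIV_diff DERIV_add DERIV_cmult DERIV_mult DL DR D1 DERIV_bessel_J_1 assms)
  have E: "2 / pi * (1 / x * bessel_J 1 x + (bessel_J 0 x - bessel_J 1 x / x) * ln (x / 2))
      - (1 / pi * (- 2 / x\<^sup>2) + 1 / pi * (- 2 / x\<^sup>2 * (x\<^sup>2 / 4 * y1 (x\<^sup>2 / 4))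
          + (y0 (x\<^sup>2 / 4) + j1 (x\<^sup>2 / 4)) * (2 * x / 4) * (2 / x)))
      = bessel_Y 0 x - bessel_Y 1 x / x"
    unfolding bessel_Y_0 bessel_Y_1 bessel_J_0 bessel_J_1
    using assms by (simp add: field_simps power2_eq_square)
  have Y: "2 / pi * (ln (y / 2) * bessel_J 1 y) - (1 / pi * (2 / y) + 1 / pi * (2 / y * (y\<^sup>2 / 4 * y1 (y\<^sup>2 / 4))))
      = bessel_Y 1 y" if "y \<in> {0<..}" for y
  proof -
    have e: "2 / y * (y\<^sup>2 / 4 * y1 (y\<^sup>2 / 4)) = y / 2 * y1 (y\<^sup>2 / 4)"
      using that by (simp add: power2_eq_square)
    show ?thesis unfolding e bessel_Y_1 bessel_J_1 by (simp add: mult_ac)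
  qed
  show ?thesis
    by (rule has_field_derivative_transform_within_open[OF D[unfolded E], of "{0<..}"])
      (use assms Y in auto)
qed

section \<open>Asymptotics of the Gowdy evolution\<close>

text \<open>The differential relations make the left side constant on the positive axis, so its
  value can be read off as a limit at 0.\<close>

lemma bessel_wronskian:
  assumes "x > 0"
  shows "x * (bessel_J 1 x * bessel_Y 0 x - bessel_J 0 x * bessel_Y 1 x) = 2 / pi"
proof -
  define W where "W x = x * (bessel_J 1 x * bessel_Y 0 x - bessel_J 0 x * bessel_Y 1 x)" for x
  \<comment> \<open>\<open>V\<close> is \<open>W\<close> after the logarithms of Y0 and Y1 have
    cancelled. Unlike \<open>W\<close> it is visibly continuous at 0, and its value there comes from
    the pole of Y1.\<close>
  define V where "V x = 2 / pi * j0 (x\<^sup>2 / 4) + x * x / (2 * pi) * (j0 (x\<^sup>2 / 4) * y1 (x\<^sup>2 / 4))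
      - x * x / (2 * pi) * (j1 (x\<^sup>2 / 4) * y0 (x\<^sup>2 / 4))" for x
  have WV: "W x = V x" if "x > 0" for x
    unfolding W_def V_def bessel_Y_0 bessel_Y_1 bessel_J_0 bessel_J_1
    using that by (simp add: field_simps)
  have DW: "(W has_real_derivative 0) (at x)" if "x > 0" for x
  proof -
    have "((\<lambda>x. x * (bessel_J 1 x * bessel_Y 0 x - bessel_J 0 x * bessel_Y 1 x)) has_real_derivative
       1 * (bessel_J 1 x * bessel_Y 0 x - bessel_J 0 x * bessel_Y 1 x) +
       ((bessel_J 0 x - bessel_J 1 x / x) * bessel_Y 0 x + (- bessel_Y 1 x) * bessel_J 1 x
         - (- bessel_J 1 x * bessel_Y 1 x + (bessel_Y 0 x - bessel_Y 1 x / x) * bessel_J 0 x)) * x) (at x)"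
      by (intro DERIV_mult DERIV_diff DERIV_ident DERIV_bessel_J_0 DERIV_bessel_J_1 DERIV_bessel_Y_0
          DERIV_bessel_Y_1 that)
    moreover have "1 * (bessel_J 1 x * bessel_Y 0 x - bessel_J 0 x * bessel_Y 1 x) +
       ((bessel_J 0 x - bessel_J 1 x / x) * bessel_Y 0 x + (- bessel_Y 1 x) * bessel_J 1 x
         - (- bessel_J 1 x * bessel_Y 1 x + (bessel_Y 0 x - bessel_Y 1 x / x) * bessel_J 0 x)) * x = 0"
      using that by (simp add: field_simps)
    ultimately show ?thesis unfolding W_def[abs_def] by simp
  qed
  have const: "W y = W x" if "y > 0" for y
  proof -
    have "\<exists>c. \<forall>z\<in>{0<..}. W z = c"
      by (rule has_field_derivative_zero_constant) (auto intro: has_field_derivative_at_within DW)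
    then show ?thesis using that assms by auto
  qed
  have "isCont j0 0" using DERIV_isCont DERIV_j0 by blast
  have cont: "isCont y1 0" "isCont y0 0" "isCont j1 0"
    unfolding y1_def[abs_def] y0_def[abs_def] j1_def[abs_def]
    by (intro isCont_powser_converges_everywhere summable_y1 summable_y0 summable_j1)+
  have iso: "isCont (\<lambda>x. f (x\<^sup>2 / 4)) 0" if "isCont f 0" for f :: "real \<Rightarrow> real"
    by (rule isCont_o2[where g = f]) (use that in auto)
  have "isCont V 0"
    unfolding V_def[abs_def] by (intro continuous_intros iso cont \<open>isCont j0 0\<close>) auto
  moreover have "j0 0 = 1" using powser_zero[of j0_coeff] by (simp add: j0_def j0_coeff_def)
  then have "V 0 = 2 / pi" by (simp add: V_def)
  ultimately have "(V \<longlongrightarrow> 2 / pi) (at_right 0)"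
    using filterlim_at_split isCont_def by metis
  moreover have "eventually (\<lambda>y. V y = W x) (at_right 0)"
    using eventually_at_right_less by eventually_elim (use WV const in metis)
  then have "(V \<longlongrightarrow> W x) (at_right 0)"
    by (simp add: tendsto_eventually)
  ultimately show ?thesis
    using tendsto_unique[of "at_right (0::real)"] unfolding W_def by force
qed

section \<open>The mode equation in the variable x = m t\<close>

definition gowdy_sol :: "real \<Rightarrow> complex" where
  "gowdy_sol x = of_real (sqrt x) * hankel2 0 x"

definition gowdy_sol' :: "real \<Rightarrow> complex" where
  "gowdy_sol' x = of_real (1 / (2 * sqrt x)) * hankel2 0 x - of_real (sqrt x) * hankel2 1 x"

lemma hankel2_has_vector_derivative:
  assumes "x > 0"
  shows "(hankel2 0 has_vector_derivative - hankel2 1 x) (at x)"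
    and "(hankel2 1 has_vector_derivative hankel2 0 x - hankel2 1 x / of_real x) (at x)"
proof -
  have "((\<lambda>x. of_real (bessel_J 0 x) - \<i> * of_real (bessel_Y 0 x)) has_vector_derivative
     of_real (- bessel_J 1 x) - \<i> * of_real (- bessel_Y 1 x)) (at x)"
    by (intro has_vector_derivative_diff has_vector_derivative_mult_right has_vector_derivative_of_real
        DERIV_bessel_J_0 DERIV_bessel_Y_0 assms)
  then show "(hankel2 0 has_vector_derivative - hankel2 1 x) (at x)"
    unfolding hankel2_def[abs_def] by simp
  have "((\<lambda>x. of_real (bessel_J 1 x) - \<i> * of_real (bessel_Y 1 x)) has_vector_derivative
     of_real (bessel_J 0 x - bessel_J 1 x / x) - \<i> * of_real (bessel_Y 0 x - bessel_Y 1 x / x)) (at x)"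
    by (intro has_vector_derivative_diff has_vector_derivative_mult_right has_vector_derivative_of_real
        DERIV_bessel_J_1 DERIV_bessel_Y_1 assms)
  then show "(hankel2 1 has_vector_derivative hankel2 0 x - hankel2 1 x / of_real x) (at x)"
    unfolding hankel2_def[abs_def] by (simp add: algebra_simps diff_divide_distrib)
qed

text \<open>Rescaling time by m removes m from the mode equation. One solution on the positive axis
  therefore serves all modes, and large m becomes large x.\<close>

lemma gowdy_sol_has_vector_derivative:
  assumes "x > 0"
  shows "(gowdy_sol has_vector_derivative gowdy_sol' x) (at x)"
    and "(gowdy_sol' has_vector_derivative - of_real (1 + 1 / (4 * x\<^sup>2)) * gowdy_sol x) (at x)"
proof -
  have Ds: "(sqrt has_real_derivative 1 / (2 * sqrt x)) (at x)"
    using assms by (auto intro!: derivative_eq_intros simp: field_simps)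
  have Di: "((\<lambda>x. 1 / (2 * sqrt x)) has_real_derivative - 1 / (4 * x * sqrt x)) (at x)"
    using assms by (auto intro!: derivative_eq_intros simp: field_simps power2_eq_square)
  have "((\<lambda>x. of_real (sqrt x) * hankel2 0 x) has_vector_derivative
     of_real (sqrt x) * - hankel2 1 x + of_real (1 / (2 * sqrt x)) * hankel2 0 x) (at x)"
    by (intro has_vector_derivative_mult has_vector_derivative_of_real Ds hankel2_has_vector_derivative assms)
  then show "(gowdy_sol has_vector_derivative gowdy_sol' x) (at x)"
    unfolding gowdy_sol_def[abs_def] gowdy_sol'_def by (simp add: algebra_simps)
  have D: "(gowdy_sol' has_vector_derivative
     (of_real (1 / (2 * sqrt x)) * - hankel2 1 x + of_real (- 1 / (4 * x * sqrt x)) * hankel2 0 x)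
     - (of_real (sqrt x) * (hankel2 0 x - hankel2 1 x / of_real x) + of_real (1 / (2 * sqrt x)) * hankel2 1 x)) (at x)"
    unfolding gowdy_sol'_def[abs_def]
    by (intro has_vector_derivative_mult has_vector_derivative_diff has_vector_derivative_of_real
        Ds Di hankel2_has_vector_derivative assms)
  have s: "1 / sqrt x = sqrt x / x" using assms by (simp add: real_div_sqrt field_simps)
  have e1: "1 / (2 * sqrt x) = sqrt x / (2 * x)" using s by (simp add: field_simps)
  have e2: "- 1 / (4 * x * sqrt x) = - (1 / (4 * x\<^sup>2)) * sqrt x"
    using assms by (simp add: field_simps power2_eq_square)
  have "(of_real (1 / (2 * sqrt x)) * - hankel2 1 x + of_real (- 1 / (4 * x * sqrt x)) * hankel2 0 x)
     - (of_real (sqrt x) * (hankel2 0 x - hankel2 1 x / of_real x) + of_real (1 / (2 * sqrt x)) * hankel2 1 x)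
     = - of_real (1 + 1 / (4 * x\<^sup>2)) * gowdy_sol x"
    unfolding e1 e2 gowdy_sol_def using assms by (simp add: field_simps)
  with D show "(gowdy_sol' has_vector_derivative - of_real (1 + 1 / (4 * x\<^sup>2)) * gowdy_sol x) (at x)"
    by simp
qed

lemma gowdy_c_sol:
  assumes "x > 0"
  shows "gowdy_c x = of_real (sqrt (pi / 8)) * (gowdy_sol x + \<i> * gowdy_sol' x)"
proof -
  have s: "sqrt (pi * x / 8) = sqrt (pi / 8) * sqrt x" by (simp add: real_sqrt_mult real_sqrt_divide)
  have e1: "1 / (2 * sqrt x) = sqrt x / (2 * x)" using assms by (simp add: real_div_sqrt field_simps)
  show ?thesis
    unfolding gowdy_c_def gowdy_sol_def gowdy_sol'_def s e1 using assms by (simp add: field_simps)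
qed

text \<open>\<open>gowdy_d\<close> itself contains conjugated Hankel functions; its conjugate is
  built from the same solution as \<open>gowdy_c\<close>, so the two obey a closed complex-linear
  system.\<close>

lemma cnj_gowdy_d_sol:
  assumes "x > 0"
  shows "cnj (gowdy_d x) = of_real (sqrt (pi / 8)) * (gowdy_sol x - \<i> * gowdy_sol' x)"
proof -
  have s: "sqrt (pi * x / 8) = sqrt (pi / 8) * sqrt x" by (simp add: real_sqrt_mult real_sqrt_divide)
  have e1: "1 / (2 * sqrt x) = sqrt x / (2 * x)" using assms by (simp add: real_div_sqrt field_simps)
  show ?thesis
    unfolding gowdy_d_def gowdy_sol_def gowdy_sol'_def s e1 using assms by (simp add: field_simps)
qed

text \<open>The free oscillator gives - i c. The potential 1 / (4 x^2) acts on the solution itself,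
  which is proportional to half the sum of c and the conjugate of d; hence the coefficient 1 / (8
  x^2).\<close>

lemma gowdy_c_has_vector_derivative:
  assumes "x > 0"
  shows "(gowdy_c has_vector_derivative - \<i> * gowdy_c x - \<i> / of_real (8 * x\<^sup>2) * (gowdy_c x + cnj (gowdy_d x))) (at x)"
proof -
  let ?r = "complex_of_real (sqrt (pi / 8))"
  have D: "((\<lambda>x. ?r * (gowdy_sol x + \<i> * gowdy_sol' x)) has_vector_derivative
     ?r * (gowdy_sol' x + \<i> * (- of_real (1 + 1 / (4 * x\<^sup>2)) * gowdy_sol x))) (at x)"
    by (intro has_vector_derivative_mult_right has_vector_derivative_add gowdy_sol_has_vector_derivative assms)
  have "?r * (gowdy_sol' x + \<i> * (- of_real (1 + 1 / (4 * x\<^sup>2)) * gowdy_sol x))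
     = - \<i> * gowdy_c x - \<i> / of_real (8 * x\<^sup>2) * (gowdy_c x + cnj (gowdy_d x))"
    unfolding gowdy_c_sol[OF assms] cnj_gowdy_d_sol[OF assms] using assms by (simp add: field_simps)
  with D show ?thesis
    using has_vector_derivative_transform_within_open[of _ _ x "{0<..}" gowdy_c] assms gowdy_c_sol by auto
qed

lemma cnj_gowdy_d_has_vector_derivative:
  assumes "x > 0"
  shows "((\<lambda>x. cnj (gowdy_d x)) has_vector_derivative
    \<i> * cnj (gowdy_d x) + \<i> / of_real (8 * x\<^sup>2) * (gowdy_c x + cnj (gowdy_d x))) (at x)"
proof -
  let ?r = "complex_of_real (sqrt (pi / 8))"
  have D: "((\<lambda>x. ?r * (gowdy_sol x - \<i> * gowdy_sol' x)) has_vector_derivative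
     ?r * (gowdy_sol' x - \<i> * (- of_real (1 + 1 / (4 * x\<^sup>2)) * gowdy_sol x))) (at x)"
    by (intro has_vector_derivative_mult_right has_vector_derivative_diff gowdy_sol_has_vector_derivative assms)
  have "?r * (gowdy_sol' x - \<i> * (- of_real (1 + 1 / (4 * x\<^sup>2)) * gowdy_sol x))
     = \<i> * cnj (gowdy_d x) + \<i> / of_real (8 * x\<^sup>2) * (gowdy_c x + cnj (gowdy_d x))"
    unfolding gowdy_c_sol[OF assms] cnj_gowdy_d_sol[OF assms] using assms by (simp add: field_simps)
  with D show ?thesis
    using has_vector_derivative_transform_within_open[of _ _ x "{0<..}" "\<lambda>x. cnj (gowdy_d x)"]
      assms cnj_gowdy_d_sol by auto
qed

lemma gowdy_normalised:
  assumes "x > 0"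
  shows "gowdy_c x * cnj (gowdy_c x) - gowdy_d x * cnj (gowdy_d x) = 1"
proof -
  \<comment> \<open>Only the real part of \<open>A\<close> survives: the difference of squares
    contains it through \<open>A + cnj A\<close>, multiplied by a Wronskian of the Hankel
    functions.\<close>
  define A where "A = (1 + \<i> / of_real (2 * x))"
  have "Re A = 1" by (simp add: A_def)
  define H K where "H = hankel2 0 x" and "K = hankel2 1 x"
  have "gowdy_c x * cnj (gowdy_c x) - gowdy_d x * cnj (gowdy_d x)
    = of_real (pi * x / 8) * ((A * H - \<i> * K) * cnj (A * H - \<i> * K) - (A * cnj H - \<i> * cnj K) * cnj (A * cnj H - \<i> * cnj K))"
  proof -
    have "of_real (sqrt (pi * x / 8)) * of_real (sqrt (pi * x / 8)) = complex_of_real (pi * x / 8)"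
      using assms by (simp flip: of_real_mult)
    moreover have "s * P * cnj (s * P) - s * Q * cnj (s * Q) = s * s * (P * cnj P - Q * cnj Q)"
      if "cnj s = s" for s P Q :: complex using that by (simp add: algebra_simps)
    ultimately show ?thesis unfolding gowdy_c_def gowdy_d_def H_def K_def A_def
      by (metis complex_cnj_complex_of_real)
  qed
  also have "(A * H - \<i> * K) * cnj (A * H - \<i> * K) - (A * cnj H - \<i> * cnj K) * cnj (A * cnj H - \<i> * cnj K)
     = \<i> * (A + cnj A) * (H * cnj K - cnj H * K)"
    by (simp add: algebra_simps)
  also have "A + cnj A = 2" using \<open>Re A = 1\<close> complex_add_cnj[of A] by simp
  also have "H * cnj K - cnj H * K = 2 * \<i> * of_real (bessel_J 0 x * bessel_Y 1 x - bessel_J 1 x * bessel_Y 0 x)"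
    unfolding H_def K_def hankel2_def by (simp add: algebra_simps)
  also have "of_real (pi * x / 8) * (\<i> * 2 * (2 * \<i> * of_real (bessel_J 0 x * bessel_Y 1 x - bessel_J 1 x * bessel_Y 0 x)))
    = complex_of_real (pi / 2 * (x * (bessel_J 1 x * bessel_Y 0 x - bessel_J 0 x * bessel_Y 1 x)))"
    by (simp add: field_simps)
  also have "\<dots> = 1" unfolding bessel_wronskian[OF assms] by simp
  finally show ?thesis .
qed

lemma has_vector_derivative_cis: "(cis has_vector_derivative \<i> * cis x) (at x)"
  unfolding has_vector_derivative_complex_iff
  by (auto intro!: derivative_eq_intros)

lemma has_vector_derivative_cis_minus: "((\<lambda>x. cis (- x)) has_vector_derivative - \<i> * cis (- x)) (at x)"
  unfolding has_vector_derivative_complex_iff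
  by (auto intro!: derivative_eq_intros)

text \<open>After removal of the free phases the amplitudes have derivatives bounded by a multiple
  of 1/x^2 times their size. A Gronwall estimate bounds them on the half-line, and integrating the
  derivative bounds their variation.\<close>

lemma gowdy_amplitude_bounds:
  fixes x0 :: real assumes "x0 > 0"
  obtains C where "C > 0"
    "\<And>x. x \<ge> x0 \<Longrightarrow> norm (gowdy_c x) \<le> C" "\<And>x. x \<ge> x0 \<Longrightarrow> norm (gowdy_d x) \<le> C"
    "\<And>x y. x \<ge> x0 \<Longrightarrow> y \<ge> x0 \<Longrightarrow>
       norm (cis x * gowdy_c x - cis y * gowdy_c y) \<le> C * (1 / x + 1 / y)"
    "\<And>x y. x \<ge> x0 \<Longrightarrow> y \<ge> x0 \<Longrightarrow>
       norm (cis (- x) * cnj (gowdy_d x) - cis (- y) * cnj (gowdy_d y)) \<le> C * (1 / x + 1 / y)"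
proof -
  \<comment> \<open>\<open>E\<close> and \<open>F\<close> would be constant without the potential;
    the phases that remain in their equations have modulus 1 and do not affect the
    estimates.\<close>
  define E where "E x = cis x * gowdy_c x" for x
  define F where "F x = cis (- x) * cnj (gowdy_d x)" for x
  have DE: "(E has_vector_derivative - \<i> / of_real (8 * x\<^sup>2) * (E x + cis (2 * x) * F x)) (at x)" if "x > 0" for x
  proof -
    have "(E has_vector_derivative cis x * (- \<i> * gowdy_c x - \<i> / of_real (8 * x\<^sup>2) * (gowdy_c x + cnj (gowdy_d x)))
        + \<i> * cis x * gowdy_c x) (at x)"
      unfolding E_def[abs_def]
      by (intro has_vector_derivative_mult gowdy_c_has_vector_derivative that)
        (rule has_vector_derivative_cis)
    moreover have "cis (2 * x) * F x = cis x * cnj (gowdy_d x)"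
      by (simp add: F_def cis_mult flip: mult.assoc)
    then have "cis x * (- \<i> * gowdy_c x - \<i> / of_real (8 * x\<^sup>2) * (gowdy_c x + cnj (gowdy_d x)))
        + \<i> * cis x * gowdy_c x = - \<i> / of_real (8 * x\<^sup>2) * (E x + cis (2 * x) * F x)"
      unfolding E_def by (simp add: algebra_simps)
    ultimately show ?thesis by metis
  qed
  have DF: "(F has_vector_derivative \<i> / of_real (8 * x\<^sup>2) * (F x + cis (- (2 * x)) * E x)) (at x)" if "x > 0" for x
  proof -
    have "(F has_vector_derivative cis (- x) * (\<i> * cnj (gowdy_d x) + \<i> / of_real (8 * x\<^sup>2) * (gowdy_c x + cnj (gowdy_d x)))
        + - \<i> * cis (- x) * cnj (gowdy_d x)) (at x)"
      unfolding F_def[abs_def]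
      by (intro has_vector_derivative_mult cnj_gowdy_d_has_vector_derivative that)
        (rule has_vector_derivative_cis_minus)
    moreover have "cis (- (2 * x)) * E x = cis (- x) * gowdy_c x"
      by (simp add: E_def cis_mult flip: mult.assoc)
    then have "cis (- x) * (\<i> * cnj (gowdy_d x) + \<i> / of_real (8 * x\<^sup>2) * (gowdy_c x + cnj (gowdy_d x)))
        + - \<i> * cis (- x) * cnj (gowdy_d x) = \<i> / of_real (8 * x\<^sup>2) * (F x + cis (- (2 * x)) * E x)"
      unfolding F_def by (simp add: algebra_simps)
    ultimately show ?thesis by metis
  qed
  define R where "R x = (norm (E x))\<^sup>2 + (norm (F x))\<^sup>2" for x
  define R' where "R' x = 2 * (E x \<bullet> (- \<i> / of_real (8 * x\<^sup>2) * (E x + cis (2 * x) * F x)))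
     + 2 * (F x \<bullet> (\<i> / of_real (8 * x\<^sup>2) * (F x + cis (- (2 * x)) * E x)))" for x
  have DR: "(R has_real_derivative R' x) (at x)" if "x > 0" for x
    unfolding R_def[abs_def] R'_def power2_norm_eq_inner has_real_derivative_iff_has_vector_derivative
    using DE[OF that] DF[OF that]
    by (auto intro!: derivative_eq_intros simp: inner_commute has_vector_derivative_def algebra_simps)
  have bnd: "norm (E x) + norm (F x) \<ge> norm (E x + cis (2 * x) * F x)"
    "norm (E x) + norm (F x) \<ge> norm (F x + cis (- (2 * x)) * E x)" for x
    using norm_triangle_ineq[of "E x" "cis (2 * x) * F x"] norm_triangle_ineq[of "F x" "cis (- (2 * x)) * E x"]
    by (auto simp: norm_mult)
  have R'_le: "R' x \<le> R x / (2 * x\<^sup>2)" if "x > 0" for x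
  proof -
    have "E x \<bullet> (- \<i> / of_real (8 * x\<^sup>2) * (E x + cis (2 * x) * F x)) \<le> norm (E x) * ((norm (E x) + norm (F x)) / (8 * x\<^sup>2))"
      by (rule order_trans[OF norm_cauchy_schwarz])
        (auto intro!: mult_left_mono divide_right_mono bnd simp: norm_mult norm_divide norm_power)
    moreover have "F x \<bullet> (\<i> / of_real (8 * x\<^sup>2) * (F x + cis (- (2 * x)) * E x)) \<le> norm (F x) * ((norm (E x) + norm (F x)) / (8 * x\<^sup>2))"
      by (rule order_trans[OF norm_cauchy_schwarz])
        (auto intro!: mult_left_mono divide_right_mono bnd simp: norm_mult norm_divide norm_power)
    ultimately have "R' x \<le> 2 * (norm (E x) * ((norm (E x) + norm (F x)) / (8 * x\<^sup>2))) + 2 * (norm (F x) * ((norm (E x) + norm (F x)) / (8 * x\<^sup>2)))"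
      unfolding R'_def by linarith
    also have "\<dots> = (norm (E x) + norm (F x))\<^sup>2 / (4 * x\<^sup>2)"
      using that by (simp add: field_simps power2_eq_square)
    also have "\<dots> \<le> 2 * R x / (4 * x\<^sup>2)"
      using sum_squares_bound[of "norm (E x)" "norm (F x)"]
      by (intro divide_right_mono) (auto simp: R_def power2_sum)
    finally show ?thesis by simp
  qed
  \<comment> \<open>From R' <= R / (2 x^2) it follows that R(x) exp (1 / (2 x)) is nonincreasing;
    \<open>B\<close> is the resulting bound on sqrt (R x).\<close>
  define B where "B = sqrt (R x0 * exp (1 / (2 * x0)))"
  have R0: "R x \<ge> 0" for x by (simp add: R_def)
  have R_le: "R x \<le> R x0 * exp (1 / (2 * x0))" if "x \<ge> x0" for x
  proof -
    have "R x * exp (1 / (2 * x)) \<le> R x0 * exp (1 / (2 * x0))"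
    proof (rule DERIV_nonpos_imp_nonincreasing[OF that])
      fix y assume "x0 \<le> y" "y \<le> x"
      with assms have y: "y > 0" by simp
      have "((\<lambda>x. R x * exp (1 / (2 * x))) has_real_derivative
          R' y * exp (1 / (2 * y)) + exp (1 / (2 * y)) * (- 1 / (2 * y\<^sup>2)) * R y) (at y)"
        using y by (auto intro!: derivative_eq_intros DR simp: power2_eq_square)
      moreover have "R' y * exp (1 / (2 * y)) + exp (1 / (2 * y)) * (- 1 / (2 * y\<^sup>2)) * R y
          = (R' y - R y / (2 * y\<^sup>2)) * exp (1 / (2 * y))"
        by (simp add: algebra_simps)
      moreover have "\<dots> \<le> 0" using R'_le[OF y] by (simp add: mult_le_0_iff)
      ultimately show "\<exists>z. ((\<lambda>x. R x * exp (1 / (2 * x))) has_real_derivative z) (at y) \<and> z \<le> 0" by metis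
    qed
    moreover have "R x * 1 \<le> R x * exp (1 / (2 * x))"
      using that assms R0 by (intro mult_left_mono) auto
    ultimately show ?thesis by simp
  qed
  have nE: "norm (E x) \<le> B" "norm (F x) \<le> B" if "x \<ge> x0" for x
  proof -
    have "(norm (E x))\<^sup>2 \<le> R x" "(norm (F x))\<^sup>2 \<le> R x" by (simp_all add: R_def)
    then show "norm (E x) \<le> B" "norm (F x) \<le> B"
      unfolding B_def using R_le[OF that] by (meson order_trans real_le_rsqrt)+
  qed
  have "B \<ge> 0" unfolding B_def using R0 by simp
  \<comment> \<open>Adding 1 only makes the constant strictly positive.\<close>
  define C where "C = B + 1"
  have C: "C > 0" "B \<le> C" using \<open>B \<ge> 0\<close> by (auto simp: C_def)
  have diff: "norm (G x - G y) \<le> C * (1 / x + 1 / y)"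
    if G: "\<And>z. z > 0 \<Longrightarrow> (G has_vector_derivative G' z) (at z)"
      and G': "\<And>z. z \<ge> x0 \<Longrightarrow> norm (G' z) \<le> B / z\<^sup>2" and xy: "x \<ge> x0" "y \<ge> x0"
    for G G' :: "real \<Rightarrow> complex" and x y
  proof -
    \<comment> \<open>Integrating B / z^2 gives the difference of B / a and B / b. The statement in
      terms of 1 / x + 1 / y is weaker but symmetric, so x and y may come in either order.\<close>
    have *: "norm (G b - G a) \<le> B / a - B / b" if "x0 \<le> a" "a < b" for a b
    proof -
      have "norm (G b - G a) \<le> (- B / b) - (- B / a)"
      proof (rule differentiable_bound_general[OF \<open>a < b\<close>, where f' = G' and \<phi>' = "\<lambda>z. B / z\<^sup>2"])
        show "continuous_on {a..b} G"
          using that assms by (intro continuous_at_imp_continuous_on ballI)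
            (auto intro: has_vector_derivative_continuous[OF G])
        show "continuous_on {a..b} (\<lambda>z. - B / z)"
          using that assms by (intro continuous_intros) auto
        show "(G has_vector_derivative G' z) (at z)" if "a < z" for z
          using that \<open>x0 \<le> a\<close> assms by (intro G) auto
        show "((\<lambda>z. - B / z) has_vector_derivative B / z\<^sup>2) (at z)" if "a < z" for z
          unfolding has_real_derivative_iff_has_vector_derivative[symmetric]
          using that \<open>x0 \<le> a\<close> assms by (auto intro!: derivative_eq_intros simp: power2_eq_square)
        show "norm (G' z) \<le> B / z\<^sup>2" if "a < z" for z
          using that \<open>x0 \<le> a\<close> by (intro G') auto
      qed
      then show ?thesis by simp
    qed
    have pos: "0 \<le> B / x" "0 \<le> B / y" "B / x \<le> C / x" "B / y \<le> C / y"
      using xy assms C \<open>B \<ge> 0\<close> by (auto intro: divide_right_mono)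
    have "norm (G x - G y) \<le> B / x + B / y"
      using *[of x y] *[of y x] pos xy by (cases x y rule: linorder_cases) (auto simp: norm_minus_commute)
    also have "\<dots> \<le> C * (1 / x + 1 / y)" using pos by (simp add: distrib_left)
    finally show ?thesis .
  qed
  have q: "norm (s * w) \<le> B / z\<^sup>2"
    if "norm w \<le> norm (E z) + norm (F z)" "norm s = 1 / (8 * z\<^sup>2)" "z \<ge> x0" for s w :: complex and z
  proof -
    have "norm w \<le> 2 * B" using that(1) nE[OF that(3)] by linarith
    then have "norm (s * w) \<le> 1 / (8 * z\<^sup>2) * (2 * B)"
      unfolding norm_mult that(2) by (intro mult_left_mono) auto
    also have "\<dots> = (1 / 4) * (B / z\<^sup>2)" by simp
    also have "\<dots> \<le> 1 * (B / z\<^sup>2)" using \<open>B \<ge> 0\<close> by (intro mult_right_mono) simp_all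
    also have "\<dots> = B / z\<^sup>2" by simp
    finally show ?thesis .
  qed
  show ?thesis
  proof (rule that[OF \<open>C > 0\<close>])
    show "norm (gowdy_c x) \<le> C" "norm (gowdy_d x) \<le> C" if "x \<ge> x0" for x
      using nE[OF that] C by (auto simp: E_def F_def norm_mult)
    show "norm (cis x * gowdy_c x - cis y * gowdy_c y) \<le> C * (1 / x + 1 / y)" if "x \<ge> x0" "y \<ge> x0" for x y
      unfolding E_def[symmetric]
      by (rule diff[OF DE q[OF bnd(1)] that]) (simp_all add: norm_divide norm_mult norm_power)
    show "norm (cis (- x) * cnj (gowdy_d x) - cis (- y) * cnj (gowdy_d y)) \<le> C * (1 / x + 1 / y)"
      if "x \<ge> x0" "y \<ge> x0" for x y
      unfolding F_def[symmetric]
      by (rule diff[OF DF q[OF bnd(2)] that]) (simp_all add: norm_divide norm_mult norm_power)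
  qed
qed

text \<open>Both coefficients are bilinear in the values at m t and m t0. Expanded around equal
  amplitudes, every error term contains one amplitude difference, of order 1/m, and one bounded
  factor.\<close>

lemma gowdy_alpha_beta_asymptotics:
  fixes t t0 :: real
  assumes "t > 0" "t0 > 0"
  obtains C where "\<And>m::nat. m \<ge> 1 \<Longrightarrow> norm (gowdy_beta m t t0) \<le> C / m"
    "\<And>m::nat. m \<ge> 1 \<Longrightarrow> \<bar>Im (gowdy_alpha m t t0) + sin (m * (t - t0))\<bar> \<le> C / m"
proof -
  \<comment> \<open>As m >= 1, both m t and m t0 stay above \<open>x0\<close>, so one constant
    serves all modes.\<close>
  define x0 where "x0 = min t t0"
  have x0: "x0 > 0" using assms by (simp add: x0_def)
  from gowdy_amplitude_bounds[OF x0] obtain B where B: "B > 0"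
    "\<And>x. x \<ge> x0 \<Longrightarrow> norm (gowdy_c x) \<le> B" "\<And>x. x \<ge> x0 \<Longrightarrow> norm (gowdy_d x) \<le> B"
    and Bc: "\<And>x y. x \<ge> x0 \<Longrightarrow> y \<ge> x0 \<Longrightarrow>
       norm (cis x * gowdy_c x - cis y * gowdy_c y) \<le> B * (1 / x + 1 / y)"
    and Bd: "\<And>x y. x \<ge> x0 \<Longrightarrow> y \<ge> x0 \<Longrightarrow>
       norm (cis (- x) * cnj (gowdy_d x) - cis (- y) * cnj (gowdy_d y)) \<le> B * (1 / x + 1 / y)" by metis
  define C where "C = 2 * B * (B * (1 / t + 1 / t0))"
  have main: "norm (gowdy_beta m t t0) \<le> C / m \<and>
      norm (gowdy_alpha m t t0 - cis (- (m * (t - t0)))) \<le> C / m" if "m \<ge> 1" for m :: nat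
  proof -
    define x y where "x = m * t" and "y = m * t0"
    have "1 * t \<le> m * t" "1 * t0 \<le> m * t0" using that assms by (intro mult_right_mono; simp)+
    then have xy: "x \<ge> x0" "y \<ge> x0" by (auto simp: x_def y_def x0_def)
    define p where "p = cis x * gowdy_c x - cis y * gowdy_c y"
    define q where "q = cis (- x) * cnj (gowdy_d x) - cis (- y) * cnj (gowdy_d y)"
    have r: "1 / x + 1 / y = (1 / t + 1 / t0) / m" by (simp add: x_def y_def add_divide_distrib mult.commute)
    have p: "norm p \<le> B * (1 / t + 1 / t0) / m" and q: "norm q \<le> B * (1 / t + 1 / t0) / m"
      using Bc[OF xy] Bd[OF xy] unfolding p_def q_def r by simp_all
    have cq: "cnj q = cis x * gowdy_d x - cis y * gowdy_d y" by (simp add: q_def cis_cnj)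
    have C: "C / m = B * (1 / t + 1 / t0) / m * B + B * (1 / t + 1 / t0) / m * B"
      by (simp add: C_def mult.commute)
    have n: "norm (a * u - b * v) \<le> C / m"
      if "norm a = norm p \<or> norm a = norm q" "norm b = norm p \<or> norm b = norm q" "norm u \<le> B" "norm v \<le> B" for a b u v :: complex
    proof -
      have pos: "0 \<le> norm u" "0 \<le> norm v" "0 \<le> B * (1 / t + 1 / t0) / m"
        using \<open>B > 0\<close> assms by simp_all
      have "norm (a * u) \<le> B * (1 / t + 1 / t0) / m * B" "norm (b * v) \<le> B * (1 / t + 1 / t0) / m * B"
        unfolding norm_mult by (intro mult_mono; use that p q pos in argo)+
      then show ?thesis
        unfolding C by (rule order_trans[OF norm_triangle_ineq4 add_mono])
    qed
    \<comment> \<open>In \<open>p\<close> and \<open>cnj q\<close> the contributions taken at y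
      cancel by antisymmetry, so \<open>beta\<close> consists of error terms only.\<close>
    have beta: "gowdy_beta m t t0 = cis (- x) * (cnj q * gowdy_c y - p * gowdy_d y)"
    proof -
      have "cis (- x) * (cnj q * gowdy_c y - p * gowdy_d y)
        = (cis (- x) * cis x) * (gowdy_d x * gowdy_c y - gowdy_c x * gowdy_d y)"
        unfolding cq p_def by (simp only: algebra_simps)
      then show ?thesis unfolding gowdy_beta_def x_def[symmetric] y_def[symmetric] by (simp add: cis_mult)
    qed
    \<comment> \<open>Here the contributions at y combine to |c|^2 - |d|^2 = 1 and leave the pure
      phase on the left.\<close>
    have alpha: "gowdy_alpha m t t0 - cis (- (x - y)) = cis (- x) * (p * cnj (gowdy_c y) - cnj q * cnj (gowdy_d y))"
    proof -
      have "cis (- x) * (p * cnj (gowdy_c y) - cnj q * cnj (gowdy_d y))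
        = (cis (- x) * cis x) * (gowdy_c x * cnj (gowdy_c y) - gowdy_d x * cnj (gowdy_d y))
          - (cis (- x) * cis y) * (gowdy_c y * cnj (gowdy_c y) - gowdy_d y * cnj (gowdy_d y))"
        unfolding p_def cq by (simp only: algebra_simps)
      then show ?thesis using gowdy_normalised[of y] xy x0
        unfolding gowdy_alpha_def x_def[symmetric] y_def[symmetric] by (simp add: cis_mult)
    qed
    have "norm (gowdy_beta m t t0) \<le> C / m"
      unfolding beta norm_mult norm_cis mult_1 by (rule n) (use B xy in auto)
    moreover have "norm (gowdy_alpha m t t0 - cis (- (x - y))) \<le> C / m"
      unfolding alpha norm_mult norm_cis mult_1 by (rule n) (use B xy in auto)
    moreover have "x - y = m * (t - t0)" by (simp add: x_def y_def right_diff_distrib)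
    ultimately show ?thesis by simp
  qed
  show ?thesis
  proof (rule that[of C])
    fix m :: nat assume m: "m \<ge> 1"
    show "norm (gowdy_beta m t t0) \<le> C / m" using main[OF m] by simp
    have "\<bar>Im (gowdy_alpha m t t0 - cis (- (m * (t - t0))))\<bar> \<le> norm (gowdy_alpha m t t0 - cis (- (m * (t - t0))))"
      by (rule abs_Im_le_cmod)
    with main[OF m] show "\<bar>Im (gowdy_alpha m t t0) + sin (m * (t - t0))\<bar> \<le> C / m" by simp
  qed
qed

section \<open>Series weighted by squared sines\<close>

text \<open>If no member had an interior point, the complements would be open and dense, and by
  Baire their intersection would be dense; but it is empty.\<close>

lemma closed_cover_contains_interval:
  fixes E :: "nat \<Rightarrow> real set"
  assumes "\<And>n. closed (E n)" "(\<Union>n. E n) = UNIV"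
  obtains n a b where "a < b" "{a..b} \<subseteq> E n"
proof -
  have "\<exists>n. interior (E n) \<noteq> {}"
  proof (rule ccontr)
    assume "\<not> ?thesis"
    then have "UNIV \<subseteq> closure (\<Inter>(range (\<lambda>n. - E n)))"
      using assms(1) by (intro Baire) (auto simp: open_closed closure_complement)
    moreover have "\<Inter>(range (\<lambda>n. - E n)) = {}" using assms(2) by auto
    ultimately show False by simp
  qed
  then obtain n x where "x \<in> interior (E n)" by auto
  then obtain e where "e > 0" "cball x e \<subseteq> E n" by (auto simp: mem_interior_cball)
  then show ?thesis using that[of "x - e" "x + e" n] by (auto simp: cball_eq_atLeastAtMost)
qed

lemma has_integral_sin_square:
  fixes c d m :: real
  assumes "c \<le> d" "m > 0"
  shows "((\<lambda>x. (sin (m * x))\<^sup>2) has_integral ((d - c) / 2 - (sin (2 * m * d) - sin (2 * m * c)) / (4 * m))) {c..d}"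
proof -
  have "((\<lambda>x. (sin (m * x))\<^sup>2) has_integral
      ((d / 2 - sin (2 * m * d) / (4 * m)) - (c / 2 - sin (2 * m * c) / (4 * m)))) {c..d}"
  proof (rule fundamental_theorem_of_calculus[OF assms(1)])
    fix x
    have "((\<lambda>x. x / 2 - sin (2 * m * x) / (4 * m)) has_real_derivative 1 / 2 - cos (2 * m * x) / 2) (at x)"
      using assms(2) by (auto intro!: derivative_eq_intros simp: field_simps)
    moreover have "1 / 2 - cos (2 * m * x) / 2 = (sin (m * x))\<^sup>2"
      using cos_double_sin[of "m * x"] by (simp add: mult.assoc field_simps)
    ultimately show "((\<lambda>x. x / 2 - sin (2 * m * x) / (4 * m)) has_vector_derivative (sin (m * x))\<^sup>2) (at x within {c..d})"
      unfolding has_real_derivative_iff_has_vector_derivative[symmetric]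
      by (metis has_field_derivative_at_within)
  qed
  then show ?thesis by (simp add: diff_divide_distrib algebra_simps)
qed

lemma summable_if_summable_sin_square:
  fixes w :: "nat \<Rightarrow> real"
  assumes nonneg: "\<And>m. w m \<ge> 0"
    and sum: "\<And>\<tau>. summable (\<lambda>m. w m * (sin (real m * \<tau>))\<^sup>2)"
  shows "summable w"
proof -
  \<comment> \<open>Bounding all partial sums, rather than the value of the series, exhibits
    \<open>E n\<close> as an intersection of closed sets, since each partial sum is
    continuous.\<close>
  define E where "E n = {\<tau>. \<forall>M. (\<Sum>m<M. w m * (sin (real m * \<tau>))\<^sup>2) \<le> real n}" for n :: nat
  have "closed (E n)" for n
  proof -
    have "E n = (\<Inter>M. {\<tau>. (\<Sum>m<M. w m * (sin (real m * \<tau>))\<^sup>2) \<le> real n})" by (auto simp: E_def)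
    then show ?thesis by (auto intro!: closed_Collect_le continuous_intros)
  qed
  moreover have "(\<Union>n. E n) = UNIV"
  proof -
    have "\<exists>n. \<tau> \<in> E n" for \<tau>
    proof -
      obtain n :: nat where "suminf (\<lambda>m. w m * (sin (real m * \<tau>))\<^sup>2) \<le> n" using real_arch_simple by blast
      moreover have "(\<Sum>m<M. w m * (sin (real m * \<tau>))\<^sup>2) \<le> suminf (\<lambda>m. w m * (sin (real m * \<tau>))\<^sup>2)" for M
        by (rule sum_le_suminf[OF sum]) (simp_all add: nonneg)
      ultimately have "(\<Sum>m<M. w m * (sin (real m * \<tau>))\<^sup>2) \<le> real n" for M
        by (rule order_trans[rotated])
      then show ?thesis unfolding E_def by blast
    qed
    then show ?thesis by auto
  qed
  ultimately obtain n c d where cd: "c < d" "{c..d} \<subseteq> E n"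
    using closed_cover_contains_interval by metis
  \<comment> \<open>For m >= m0 one has 2 / m <= d - c, so the oscillating part of the integral is
    at most (d - c) / 4 and at least half of the main part (d - c) / 2 remains. The added 1 excludes
    m = 0.\<close>
  define m0 where "m0 = nat \<lceil>2 / (d - c)\<rceil> + 1"
  have m0: "(d - c) / 2 - (sin (2 * real m * d) - sin (2 * real m * c)) / (4 * real m) \<ge> (d - c) / 4" if "m \<ge> m0" for m :: nat
  proof -
    have "real m \<ge> 2 / (d - c)" "m > 0" using that unfolding m0_def by linarith+
    then have "2 / m \<le> d - c" using cd by (simp add: field_simps)
    moreover define Q where "Q = (sin (2 * real m * d) - sin (2 * real m * c)) / (4 * real m)"
    have "Q \<le> 2 / (4 * real m)" unfolding Q_def
      using sin_le_one[of "2 * real m * d"] sin_ge_minus_one[of "2 * real m * c"]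
      by (intro divide_right_mono, linarith, simp)
    moreover define r where "r = 2 / real m"
    ultimately have "Q \<le> r / 4" "r \<le> d - c" by simp_all
    then show ?thesis unfolding Q_def[symmetric] by (simp add: field_simps)
  qed
  have bound: "(\<Sum>m\<in>{m0..<M}. w m) \<le> 4 * real n" for M
  proof -
    let ?I = "\<lambda>m::nat. (d - c) / 2 - (sin (2 * real m * d) - sin (2 * real m * c)) / (4 * real m)"
    have "((\<lambda>x. \<Sum>m\<in>{m0..<M}. w m * (sin (m * x))\<^sup>2) has_integral (\<Sum>m\<in>{m0..<M}. w m * ?I m)) {c..d}"
      by (intro has_integral_sum has_integral_mult_right has_integral_sin_square)
        (use cd in \<open>auto simp: m0_def\<close>)
    moreover have "((\<lambda>x. real n) has_integral (real n * (d - c))) {c..d}"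
      using has_integral_const_real[of "real n" c d] cd by (simp add: mult.commute)
    ultimately have "(\<Sum>m\<in>{m0..<M}. w m * ?I m) \<le> real n * (d - c)"
    proof (rule has_integral_le)
      fix x assume "x \<in> {c..d}"
      then have "(\<Sum>m<M. w m * (sin (real m * x))\<^sup>2) \<le> real n" using cd by (auto simp: E_def)
      moreover have "(\<Sum>m\<in>{m0..<M}. w m * (sin (m * x))\<^sup>2) \<le> (\<Sum>m<M. w m * (sin (real m * x))\<^sup>2)"
        by (rule sum_mono2) (auto simp: nonneg)
      ultimately show "(\<Sum>m\<in>{m0..<M}. w m * (sin (m * x))\<^sup>2) \<le> real n" by linarith
    qed
    moreover have "(\<Sum>m\<in>{m0..<M}. w m * ((d - c) / 4)) \<le> (\<Sum>m\<in>{m0..<M}. w m * ?I m)"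
      by (intro sum_mono mult_left_mono m0 nonneg) auto
    ultimately have "(\<Sum>m\<in>{m0..<M}. w m * ((d - c) / 4)) \<le> real n * (d - c)" by (rule order_trans[rotated])
    then have "(\<Sum>m\<in>{m0..<M}. w m) * ((d - c) / 4) \<le> (4 * real n) * ((d - c) / 4)"
      unfolding sum_distrib_right[symmetric] by simp
    then show ?thesis using cd by (subst (asm) mult_le_cancel_right) auto
  qed
  have "summable (\<lambda>m. w (m + m0))"
  proof (rule summableI_nonneg_bounded)
    show "(\<Sum>m<M. w (m + m0)) \<le> 4 * real n" for M
      using bound[of "M + m0"] sum.shift_bounds_nat_ivl[of w 0 m0 M] by (simp add: atLeast0LessThan)
  qed (rule nonneg)
  then show ?thesis using summable_iff_shift[of w m0] by blast
qed

section \<open>Orthonormal bases and Hilbert-Schmidt operators\<close>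

lemma orthonormal_basis_inner:
  assumes "orthonormal_basis E" "e \<in> E" "f \<in> E"
  shows "e \<bullet> f = (if e = f then 1 else 0)"
  using assms unfolding orthonormal_basis_def
  by (auto simp: pairwise_def orthogonal_def norm_eq_1)

text \<open>The partial sum over F is the orthogonal projection onto the span of F, hence at least
  as close to v as any approximant u supported in F. Every F that contains the support of u
  works.\<close>

lemma orthonormal_basis_expansion:
  assumes E: "orthonormal_basis E"
  shows "((\<lambda>e. (v \<bullet> e) *\<^sub>R e) has_sum v) E"
  unfolding has_sum_def
proof (rule tendstoI)
  fix \<epsilon> :: real assume "\<epsilon> > 0"
  have "v \<in> closure (span E)" using E by (simp add: orthonormal_basis_def)
  then obtain u where u: "u \<in> span E" "dist u v < \<epsilon>"
    using \<open>\<epsilon> > 0\<close> by (auto simp: closure_approachable)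
  then obtain t r where t: "finite t" "t \<subseteq> E" and u_eq: "u = (\<Sum>a\<in>t. r a *\<^sub>R a)"
    unfolding span_explicit by auto
  have "dist (\<Sum>e\<in>F. (v \<bullet> e) *\<^sub>R e) v < \<epsilon>" if F: "finite F" "t \<subseteq> F" "F \<subseteq> E" for F
  proof -
    define r' where "r' a = (if a \<in> t then r a else 0)" for a
    have u_F: "u = (\<Sum>a\<in>F. r' a *\<^sub>R a)"
      unfolding u_eq using F by (intro sum.mono_neutral_cong_left) (auto simp: r'_def)
    define w where "w = v - (\<Sum>e\<in>F. (v \<bullet> e) *\<^sub>R e)"
    define p where "p = (\<Sum>e\<in>F. (v \<bullet> e - r' e) *\<^sub>R e)"
    have "w \<bullet> e = 0" if "e \<in> F" for e
    proof -
      have "(\<Sum>f\<in>F. (v \<bullet> f) * (f \<bullet> e)) = (\<Sum>f\<in>F. if f = e then v \<bullet> f else 0)"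
        using that F by (intro sum.cong refl) (simp add: orthonormal_basis_inner[OF E] subset_iff)
      then show ?thesis using that F by (simp add: w_def inner_diff_left inner_sum_left)
    qed
    then have "w \<bullet> p = 0" by (simp add: p_def inner_sum_right)
    moreover have "v - u = w + p"
      by (simp add: w_def p_def u_F scaleR_diff_left sum_subtractf)
    ultimately have "(norm (v - u))\<^sup>2 = (norm w)\<^sup>2 + (norm p)\<^sup>2"
      by (simp add: power2_norm_eq_inner inner_add_left inner_add_right inner_commute)
    then have "(norm w)\<^sup>2 \<le> (norm (v - u))\<^sup>2" by simp
    then have "norm w \<le> norm (v - u)" by (rule power2_le_imp_le[OF _ norm_ge_zero])
    then show ?thesis using u(2) by (simp add: w_def dist_norm norm_minus_commute)
  qed
  then show "\<forall>\<^sub>F F in finite_subsets_at_top E. dist (\<Sum>e\<in>F. (v \<bullet> e) *\<^sub>R e) v < \<epsilon>"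
    unfolding eventually_finite_subsets_at_top using t by blast
qed

lemma orthonormal_basis_parseval:
  assumes "orthonormal_basis E"
  shows "((\<lambda>e. (u \<bullet> e) * (v \<bullet> e)) has_sum (u \<bullet> v)) E"
  using has_sum_bounded_linear[OF bounded_linear_inner_right[of u] orthonormal_basis_expansion[OF assms, of v]]
  by (simp add: mult.commute)

lemma has_sum_finite_sum:
  fixes f :: "'i \<Rightarrow> 'a \<Rightarrow> 'b::topological_comm_monoid_add"
  assumes "finite F" "\<And>j. j \<in> F \<Longrightarrow> (f j has_sum s j) A"
  shows "((\<lambda>x. \<Sum>j\<in>F. f j x) has_sum (\<Sum>j\<in>F. s j)) A"
  using assms by (induction F rule: finite_induct) (auto intro: has_sum_add)

lemma inner_sum_orthonormal:
  fixes g :: "'i \<Rightarrow> 'h::real_inner"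
  assumes g: "\<And>i j. i \<in> F \<Longrightarrow> j \<in> F \<Longrightarrow> g i \<bullet> g j = (if i = j then 1 else 0)" and "finite F"
  shows "(\<Sum>j\<in>F. c j *\<^sub>R g j) \<bullet> (\<Sum>j\<in>F. c j *\<^sub>R g j) = (\<Sum>j\<in>F. c j * c j)"
proof -
  have "(\<Sum>j\<in>F. c j *\<^sub>R g j) \<bullet> (\<Sum>j\<in>F. c j *\<^sub>R g j) = (\<Sum>i\<in>F. \<Sum>j\<in>F. c i * c j * (g i \<bullet> g j))"
    unfolding inner_sum_left unfolding inner_sum_right by (simp add: mult_ac)
  also have "\<dots> = (\<Sum>i\<in>F. \<Sum>j\<in>F. if i = j then c i * c j else 0)"
    by (intro sum.cong refl) (simp add: g)
  also have "\<dots> = (\<Sum>j\<in>F. c j * c j)" using \<open>finite F\<close> by simp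
  finally show ?thesis .
qed

text \<open>The families may be incomplete and unrelated to the basis E that witnesses the
  Hilbert-Schmidt property. Pairing S with the finite-rank operator formed from the coefficients
  themselves bounds their sum of squares by the Hilbert-Schmidt norm of S.\<close>

lemma hilbert_schmidt_orthonormal_coeffs_summable:
  fixes f g :: "'i \<Rightarrow> 'h::{real_inner,complete_space}"
  assumes S: "hilbert_schmidt S"
    and f: "\<And>i j. i \<in> I \<Longrightarrow> j \<in> I \<Longrightarrow> f i \<bullet> f j = (if i = j then 1 else 0)"
    and g: "\<And>i j. i \<in> I \<Longrightarrow> j \<in> I \<Longrightarrow> g i \<bullet> g j = (if i = j then 1 else 0)"
  shows "(\<lambda>j. (S (f j) \<bullet> g j)\<^sup>2) summable_on I"
proof -
  from S obtain E where lin: "bounded_linear S" and E: "orthonormal_basis E"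
    and sumE: "(\<lambda>e. (norm (S e))\<^sup>2) summable_on E" unfolding hilbert_schmidt_def by blast
  define M where "M = infsum (\<lambda>e. (norm (S e))\<^sup>2) E"
  have M: "((\<lambda>e. (norm (S e))\<^sup>2) has_sum M) E" using sumE by (simp add: M_def)
  have "(\<Sum>j\<in>F. (S (f j) \<bullet> g j)\<^sup>2) \<le> M" if F: "finite F" "F \<subseteq> I" for F
  proof -
    define a where "a j = S (f j) \<bullet> g j" for j
    \<comment> \<open>\<open>v e\<close> is the value at e of the finite-rank operator sending each
      f j to a j times g j. Its Hilbert-Schmidt pairing with S and its own squared norm both equal
      the sum of the squares of the a j.\<close>
    define v where "v e = (\<Sum>j\<in>F. (a j * (f j \<bullet> e)) *\<^sub>R g j)" for e
    have c1: "((\<lambda>e. a j * ((f j \<bullet> e) * (S e \<bullet> g j))) has_sum (a j * a j)) E" for j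
    proof -
      have "((\<lambda>e. S ((f j \<bullet> e) *\<^sub>R e) \<bullet> g j) has_sum (S (f j) \<bullet> g j)) E"
        using has_sum_bounded_linear[OF bounded_linear_inner_left
            has_sum_bounded_linear[OF lin orthonormal_basis_expansion[OF E, of "f j"]]] .
      then have "((\<lambda>e. (f j \<bullet> e) * (S e \<bullet> g j)) has_sum a j) E"
        by (simp add: a_def linear_scale[OF bounded_linear.linear[OF lin]])
      then show ?thesis by (rule has_sum_cmult_right)
    qed
    have "((\<lambda>e. \<Sum>j\<in>F. a j * ((f j \<bullet> e) * (S e \<bullet> g j))) has_sum (\<Sum>j\<in>F. a j * a j)) E"
      by (rule has_sum_finite_sum[OF F(1) c1])
    moreover have "(\<Sum>j\<in>F. a j * ((f j \<bullet> e) * (S e \<bullet> g j))) = S e \<bullet> v e" for e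
      by (simp add: v_def inner_sum_right mult_ac)
    ultimately have s1: "((\<lambda>e. S e \<bullet> v e) has_sum (\<Sum>j\<in>F. a j * a j)) E" by simp
    have c2: "((\<lambda>e. (a j * a j) * ((f j \<bullet> e) * (f j \<bullet> e))) has_sum (a j * a j * 1)) E" if "j \<in> F" for j
      using orthonormal_basis_parseval[OF E, of "f j" "f j"] f[of j j] that F
      by (intro has_sum_cmult_right) auto
    have "((\<lambda>e. \<Sum>j\<in>F. (a j * a j) * ((f j \<bullet> e) * (f j \<bullet> e))) has_sum (\<Sum>j\<in>F. a j * a j * 1)) E"
      by (rule has_sum_finite_sum[OF F(1) c2])
    moreover have "(\<Sum>j\<in>F. (a j * a j) * ((f j \<bullet> e) * (f j \<bullet> e))) = v e \<bullet> v e" for e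
    proof -
      have "v e \<bullet> v e = (\<Sum>j\<in>F. (a j * (f j \<bullet> e)) * (a j * (f j \<bullet> e)))"
        unfolding v_def by (rule inner_sum_orthonormal) (use F g in \<open>auto simp: subset_iff\<close>)
      then show ?thesis by (simp only: mult_ac)
    qed
    ultimately have s2: "((\<lambda>e. v e \<bullet> v e) has_sum (\<Sum>j\<in>F. a j * a j)) E" by simp
    \<comment> \<open>The sum of squares occurs on both sides; moving half of it to the left gives
      the bound M.\<close>
    have "(\<Sum>j\<in>F. a j * a j) \<le> 1 / 2 * (M + (\<Sum>j\<in>F. a j * a j))"
    proof (rule has_sum_mono[OF s1 has_sum_cmult_right[OF has_sum_add[OF M s2]]])
      fix e
      have "0 \<le> (S e - v e) \<bullet> (S e - v e)" by simp
      then show "S e \<bullet> v e \<le> 1 / 2 * ((norm (S e))\<^sup>2 + v e \<bullet> v e)"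
        by (simp add: inner_diff_left inner_diff_right inner_commute power2_norm_eq_inner)
    qed
    then show ?thesis by (simp add: a_def power2_eq_square)
  qed
  then show ?thesis 
    by (intro nonneg_bounded_partial_sums_imp_summable_on[where C = M] eventually_finite_subsets_at_top_weakI) simp_all
qed

text \<open>The library version \<open>abs_summable_summable\<close> needs the class \<open>banach\<close>, which the sort
  \<open>{real_inner, complete_space}\<close> does not entail.\<close>

lemma abs_summable_summable_complete:
  fixes f :: "'a \<Rightarrow> 'b::{real_normed_vector,complete_space}"
  assumes abs: "(\<lambda>x. norm (f x)) summable_on A"
  shows "f summable_on A"
proof -
  have "\<exists>P. eventually P (finite_subsets_at_top A) \<and>
          (\<forall>F G. P F \<and> P G \<longrightarrow> dist (sum f F) (sum f G) < e)" if e: "e > 0" for e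
  proof -
    define L where "L = infsum (\<lambda>x. norm (f x)) A"
    obtain H where H: "finite H" "H \<subseteq> A" "dist (\<Sum>x\<in>H. norm (f x)) L \<le> e / 3"
      unfolding L_def using infsum_finite_approximation[OF abs divide_pos_pos[OF e, of 3]] by auto
    have near: "dist (sum f F) (sum f H) \<le> e / 3" if F: "finite F" "H \<subseteq> F" "F \<subseteq> A" for F
    proof -
      have "sum f F - sum f H = sum f (F - H)" using F H by (simp add: sum_diff)
      then have "dist (sum f F) (sum f H) \<le> (\<Sum>x\<in>F - H. norm (f x))"
        by (simp add: dist_norm norm_sum)
      also have "\<dots> = (\<Sum>x\<in>F. norm (f x)) - (\<Sum>x\<in>H. norm (f x))" using F H by (simp add: sum_diff)
      also have "(\<Sum>x\<in>F. norm (f x)) \<le> L"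
        unfolding L_def by (rule finite_sum_le_infsum[OF abs]) (use F in auto)
      also have "L - (\<Sum>x\<in>H. norm (f x)) \<le> e / 3"
        using H(3) abs_ge_minus_self[of "(\<Sum>x\<in>H. norm (f x)) - L"] by (simp add: dist_real_def)
      finally show ?thesis by simp
    qed
    show ?thesis
    proof (intro exI conjI allI impI)
      show "eventually (\<lambda>F. finite F \<and> H \<subseteq> F \<and> F \<subseteq> A) (finite_subsets_at_top A)"
        unfolding eventually_finite_subsets_at_top using H by blast
      fix F G assume FG: "(finite F \<and> H \<subseteq> F \<and> F \<subseteq> A) \<and> (finite G \<and> H \<subseteq> G \<and> G \<subseteq> A)"
      have "dist (sum f F) (sum f G) \<le> dist (sum f F) (sum f H) + dist (sum f G) (sum f H)"
        by (rule dist_triangle2)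
      then show "dist (sum f F) (sum f G) < e" using near[of F] near[of G] FG e by linarith
    qed
  qed
  then have "cauchy_filter (filtermap (sum f) (finite_subsets_at_top A))"
    by (simp add: cauchy_filter_metric_filtermap)
  moreover have "complete (UNIV :: 'b set)"
    by (meson Cauchy_convergent UNIV_I complete_def convergent_def)
  ultimately have "\<exists>l\<in>UNIV. filtermap (sum f) (finite_subsets_at_top A) \<le> nhds l"
    unfolding complete_uniform[of "UNIV :: 'b set"] by (simp add: filtermap_bot_iff)
  then show ?thesis unfolding summable_on_def has_sum_def filterlim_def by blast
qed

text \<open>The inequality 2 x y <= x^2 + y^2 dominates each term by a summable one, so the series
  defining S h converges absolutely.\<close>

lemma hilbert_schmidt_of_columns:
  fixes E :: "'h::{real_inner,complete_space} set" and w :: "'h \<Rightarrow> 'h"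
  assumes E: "orthonormal_basis E" and w: "(\<lambda>e. (norm (w e))\<^sup>2) summable_on E"
  obtains S where "hilbert_schmidt S" "\<And>h. ((\<lambda>e. (h \<bullet> e) *\<^sub>R w e) has_sum S h) E"
proof -
  define S where "S h = infsum (\<lambda>e. (h \<bullet> e) *\<^sub>R w e) E" for h
  define M where "M = infsum (\<lambda>e. (norm (w e))\<^sup>2) E"
  have M: "((\<lambda>e. (norm (w e))\<^sup>2) has_sum M) E" using w by (simp add: M_def)
  have le: "norm ((h \<bullet> e) *\<^sub>R w e) \<le> 1 / 2 * ((h \<bullet> e) * (h \<bullet> e) + (norm (w e))\<^sup>2)" for h e
    using sum_squares_bound[of "\<bar>h \<bullet> e\<bar>" "norm (w e)"] by (simp add: power2_eq_square)
  have B: "((\<lambda>e. 1 / 2 * ((h \<bullet> e) * (h \<bullet> e) + (norm (w e))\<^sup>2)) has_sum (1 / 2 * (h \<bullet> h + M))) E" for h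
    by (intro has_sum_cmult_right has_sum_add orthonormal_basis_parseval E M)
  have abs: "(\<lambda>e. norm ((h \<bullet> e) *\<^sub>R w e)) summable_on E" for h
    by (rule summable_on_comparison_test[OF has_sum_imp_summable[OF B[of h]]]) (use le in auto)
  have summable: "(\<lambda>e. (h \<bullet> e) *\<^sub>R w e) summable_on E" for h
    by (rule abs_summable_summable_complete[OF abs])
  have S: "((\<lambda>e. (h \<bullet> e) *\<^sub>R w e) has_sum S h) E" for h
    unfolding S_def by (intro has_sum_infsum summable)
  have bound: "norm (S h) \<le> 1 / 2 * (h \<bullet> h + M)" for h
  proof -
    have "norm (S h) \<le> infsum (\<lambda>e. norm ((h \<bullet> e) *\<^sub>R w e)) E"
      unfolding S_def by (rule norm_infsum_bound[OF abs])
    also have "\<dots> \<le> 1 / 2 * (h \<bullet> h + M)"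
      by (rule has_sum_mono[OF has_sum_infsum[OF abs] B]) (rule le)
    finally show ?thesis .
  qed
  have add: "S (x + y) = S x + S y" for x y
    using has_sum_unique[OF S[of "x + y"], of "S x + S y"] has_sum_add[OF S[of x] S[of y]]
    by (simp add: inner_add_left scaleR_add_left)
  have scale: "S (c *\<^sub>R x) = c *\<^sub>R S x" for c x
    using has_sum_unique[OF S[of "c *\<^sub>R x"], of "c *\<^sub>R S x"] has_sum_scaleR[OF S[of x], of c]
    by simp
  \<comment> \<open>The bound obtained so far is not homogeneous in h; applying it to unit vectors
    and rescaling yields boundedness.\<close>
  have "norm (S x) \<le> norm x * (1 / 2 * (1 + M))" for x
  proof (cases "x = 0")
    case True then show ?thesis using scale[of 0 0] by simp
  next
    case False
    have "S x = norm x *\<^sub>R S (x /\<^sub>R norm x)" using False scale[of "norm x"] by (simp add: scale)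
    moreover have "(x /\<^sub>R norm x) \<bullet> (x /\<^sub>R norm x) = 1"
      using False by (simp flip: power2_norm_eq_inner)
    then have "norm (S (x /\<^sub>R norm x)) \<le> 1 / 2 * (1 + M)" using bound[of "x /\<^sub>R norm x"] by simp
    ultimately show ?thesis by (metis mult_left_mono norm_ge_zero norm_scaleR abs_norm_cancel)
  qed
  then have "bounded_linear S" using add scale by (intro bounded_linear_intro)
  moreover have "S e = w e" if "e \<in> E" for e
  proof -
    have "((\<lambda>f. (e \<bullet> f) *\<^sub>R w f) has_sum w e) E"
      by (rule has_sum_finite_neutralI[where B = "{e}"]) (use that E in \<open>auto simp: orthonormal_basis_inner\<close>)
    then show ?thesis using S has_sum_unique by blast
  qed
  then have "(\<lambda>e. (norm (S e))\<^sup>2) summable_on E" using w by (simp cong: summable_on_cong)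
  ultimately have "hilbert_schmidt S" unfolding hilbert_schmidt_def using E by blast
  then show ?thesis using that S by blast
qed

text \<open>The operator with the prescribed columns agrees with A on X, but A is not known to be
  continuous, so agreement elsewhere cannot be had by density. Instead the formal adjoint A' on X
  determines the coefficients of A x along the basis, and Parseval gives the same coefficients for
  S.\<close>

lemma extends_to_hilbert_schmidt_if_adjoint:
  assumes E: "orthonormal_basis (\<iota> ` X)" and inj: "inj_on \<iota> X"
    and adj: "\<And>x y. y \<in> X \<Longrightarrow> \<iota> (A x) \<bullet> \<iota> y = \<iota> x \<bullet> \<iota> (A' y)"
    and sum: "(\<lambda>x. (norm (\<iota> (A x)))\<^sup>2) summable_on X"
  shows "extends_to_hilbert_schmidt \<iota> A"
proof -
  define w where "w e = \<iota> (A (inv_into X \<iota> e))" for e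
  have w: "w (\<iota> x) = \<iota> (A x)" if "x \<in> X" for x using inj that by (simp add: w_def)
  have "(\<lambda>e. (norm (w e))\<^sup>2) summable_on (\<iota> ` X)"
    unfolding summable_on_reindex[OF inj] using sum by (simp add: o_def w cong: summable_on_cong)
  from hilbert_schmidt_of_columns[OF E this] obtain S where
    HS: "hilbert_schmidt S" and S: "\<And>h. ((\<lambda>e. (h \<bullet> e) *\<^sub>R w e) has_sum S h) (\<iota> ` X)" by metis
  have "S (\<iota> x) = \<iota> (A x)" for x
  proof -
    have "S (\<iota> x) \<bullet> e = \<iota> (A x) \<bullet> e" if "e \<in> \<iota> ` X" for e
    proof -
      from that obtain y where y: "y \<in> X" "e = \<iota> y" by blast
      have "((\<lambda>f. ((\<iota> x \<bullet> f) *\<^sub>R w f) \<bullet> e) has_sum (S (\<iota> x) \<bullet> e)) (\<iota> ` X)"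
        by (rule has_sum_bounded_linear[OF bounded_linear_inner_left S])
      moreover have "((\<iota> x \<bullet> f) *\<^sub>R w f) \<bullet> e = (\<iota> x \<bullet> f) * (\<iota> (A' y) \<bullet> f)" if "f \<in> \<iota> ` X" for f
      proof -
        from that obtain z where "z \<in> X" "f = \<iota> z" by blast
        then show ?thesis using adj[of y z] y by (simp add: w inner_commute)
      qed
      ultimately have "((\<lambda>f. (\<iota> x \<bullet> f) * (\<iota> (A' y) \<bullet> f)) has_sum (S (\<iota> x) \<bullet> e)) (\<iota> ` X)"
        by (rule has_sum_cong[THEN iffD1, rotated])
      then have "S (\<iota> x) \<bullet> e = \<iota> x \<bullet> \<iota> (A' y)"
        using orthonormal_basis_parseval[OF E] has_sum_unique by blast
      then show ?thesis using adj y by simp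
    qed
    then have "((\<lambda>e. (\<iota> (A x) \<bullet> e) *\<^sub>R e) has_sum S (\<iota> x)) (\<iota> ` X)"
      by (intro has_sum_cong[THEN iffD1, OF _ orthonormal_basis_expansion[OF E, of "S (\<iota> x)"]]) simp
    then show ?thesis using orthonormal_basis_expansion[OF E] has_sum_unique by blast
  qed
  then show ?thesis unfolding extends_to_hilbert_schmidt_def using HS by blast
qed

section \<open>Fourier series\<close>

text \<open>The coefficients are kept unnormalised and defined for arbitrary functions, because they
  are also taken of derivatives and of complex-valued difference quotients.\<close>

definition fourier_int :: "(real \<Rightarrow> complex) \<Rightarrow> int \<Rightarrow> complex" where
  "fourier_int f n = integral {0..2 * pi} (\<lambda>\<theta>. f \<theta> * cis (- of_int n * \<theta>))"

lemma cis_int_2pi [simp]: "cis (of_int n * (2 * pi)) = 1"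
  using cis_multiple_2pi[of "of_int n"] by (simp add: mult_ac)

lemma has_integral_cis_int:
  "((\<lambda>\<theta>. cis (of_int n * \<theta>)) has_integral (if n = 0 then of_real (2 * pi) else 0)) {0..2 * pi}"
proof (cases "n = 0")
  case True
  then show ?thesis using has_integral_const_real[of "1::complex" 0 "2 * pi"]
    by (simp add: scaleR_conv_of_real)
next
  case False
  have "((\<lambda>\<theta>. cis (of_int n * \<theta>)) has_integral
     (cis (of_int n * (2 * pi)) / (\<i> * of_int n) - cis (of_int n * 0) / (\<i> * of_int n))) {0..2 * pi}"
  proof (rule fundamental_theorem_of_calculus)
    fix x :: real
    have "((\<lambda>\<theta>. cis (of_int n * \<theta>)) has_vector_derivative \<i> * of_int n * cis (of_int n * x)) (at x within {0..2 * pi})"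
      unfolding has_vector_derivative_def
      by (auto intro!: derivative_eq_intros simp: scaleR_conv_of_real mult_ac)
    then have "((\<lambda>\<theta>. 1 / (\<i> * of_int n) * cis (of_int n * \<theta>)) has_vector_derivative
        1 / (\<i> * of_int n) * (\<i> * of_int n * cis (of_int n * x))) (at x within {0..2 * pi})"
      by (rule has_vector_derivative_mult_right)
    then show "((\<lambda>\<theta>. cis (of_int n * \<theta>) / (\<i> * of_int n)) has_vector_derivative cis (of_int n * x)) (at x within {0..2 * pi})"
      using False by simp
  qed simp
  then show ?thesis using False by simp
qed

lemma continuous_on_cis_int: "continuous_on S (\<lambda>\<theta>. cis (c * \<theta>))"
  by (intro continuous_intros)

lemma fourier_int_has_integral:
  assumes "continuous_on {0..2 * pi} f"
  shows "((\<lambda>\<theta>. f \<theta> * cis (- of_int n * \<theta>)) has_integral fourier_int f n) {0..2 * pi}"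
  unfolding fourier_int_def
  by (intro integrable_integral integrable_continuous_real continuous_intros assms)

text \<open>The integral of |f - P|^2 is nonnegative for the Fourier polynomial P over F. The two
  cross terms and the integral of |P|^2 all have the same real value \<open>A\<close>.\<close>

lemma fourier_int_bessel:
  assumes f: "continuous_on {0..2 * pi} f" and F: "finite F"
  shows "(\<Sum>n\<in>F. (norm (fourier_int f n))\<^sup>2) \<le> 2 * pi * integral {0..2 * pi} (\<lambda>\<theta>. (norm (f \<theta>))\<^sup>2)"
proof -
  define a where "a n = fourier_int f n / of_real (2 * pi)" for n
  define P where "P \<theta> = (\<Sum>n\<in>F. a n * cis (of_int n * \<theta>))" for \<theta>
  define A where "A = (\<Sum>n\<in>F. a n * cnj (a n) * of_real (2 * pi))"
  have cnjP: "cnj (P \<theta>) = (\<Sum>n\<in>F. cnj (a n) * cis (- of_int n * \<theta>))" for \<theta>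
    by (simp add: P_def cis_cnj)
  have "((\<lambda>\<theta>. \<Sum>n\<in>F. cnj (a n) * (f \<theta> * cis (- of_int n * \<theta>))) has_integral (\<Sum>n\<in>F. cnj (a n) * fourier_int f n)) {0..2 * pi}"
    by (intro has_integral_sum F has_integral_mult_right fourier_int_has_integral f)
  moreover have "(\<Sum>n\<in>F. cnj (a n) * fourier_int f n) = A"
    unfolding A_def by (intro sum.cong refl) (simp add: a_def)
  ultimately have fP: "((\<lambda>\<theta>. f \<theta> * cnj (P \<theta>)) has_integral A) {0..2 * pi}"
    by (simp add: cnjP sum_distrib_left mult_ac)
  have A_real: "cnj A = A" by (simp add: A_def mult_ac)
  have Pf: "((\<lambda>\<theta>. P \<theta> * cnj (f \<theta>)) has_integral A) {0..2 * pi}"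
    using has_integral_linear[OF fP bounded_linear_cnj] by (simp add: o_def A_real mult.commute)
  have "((\<lambda>\<theta>. \<Sum>n\<in>F. \<Sum>k\<in>F. a n * cnj (a k) * cis (of_int (n - k) * \<theta>)) has_integral
      (\<Sum>n\<in>F. \<Sum>k\<in>F. a n * cnj (a k) * (if n - k = 0 then of_real (2 * pi) else 0))) {0..2 * pi}"
    by (intro has_integral_sum F has_integral_mult_right has_integral_cis_int)
  moreover have "(\<Sum>n\<in>F. \<Sum>k\<in>F. a n * cnj (a k) * (if n - k = 0 then of_real (2 * pi) else 0)) = A"
    unfolding A_def
  proof (intro sum.cong refl)
    fix n assume n: "n \<in> F"
    have "(\<Sum>k\<in>F. a n * cnj (a k) * (if n - k = 0 then complex_of_real (2 * pi) else 0))
      = (\<Sum>k\<in>F. if k = n then a n * cnj (a n) * of_real (2 * pi) else 0)"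
      by (intro sum.cong) auto
    then show "(\<Sum>k\<in>F. a n * cnj (a k) * (if n - k = 0 then complex_of_real (2 * pi) else 0))
      = a n * cnj (a n) * of_real (2 * pi)"
      using n F by simp
  qed
  moreover have "(\<Sum>n\<in>F. \<Sum>k\<in>F. a n * cnj (a k) * cis (of_int (n - k) * \<theta>)) = P \<theta> * cnj (P \<theta>)" for \<theta>
  proof -
    have "a n * cnj (a k) * cis (of_int (n - k) * \<theta>) = (a n * cis (of_int n * \<theta>)) * (cnj (a k) * cis (- of_int k * \<theta>))" for n k
      using cis_mult[of "of_int n * \<theta>" "- of_int k * \<theta>"] by (simp add: left_diff_distrib right_diff_distrib mult_ac)
    then show ?thesis by (simp only: cnjP) (simp only: P_def sum_product)
  qed
  ultimately have PP: "((\<lambda>\<theta>. P \<theta> * cnj (P \<theta>)) has_integral A) {0..2 * pi}" by simp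
  have ff: "((\<lambda>\<theta>. (norm (f \<theta>))\<^sup>2) has_integral integral {0..2 * pi} (\<lambda>\<theta>. (norm (f \<theta>))\<^sup>2)) {0..2 * pi}"
    by (intro integrable_integral integrable_continuous_real continuous_intros f)
  have "((\<lambda>\<theta>. (norm (f \<theta>))\<^sup>2 - Re (f \<theta> * cnj (P \<theta>)) - Re (P \<theta> * cnj (f \<theta>)) + Re (P \<theta> * cnj (P \<theta>))) has_integral
     (integral {0..2 * pi} (\<lambda>\<theta>. (norm (f \<theta>))\<^sup>2) - Re A - Re A + Re A)) {0..2 * pi}"
    by (intro has_integral_add has_integral_diff ff has_integral_linear[OF _ bounded_linear_Re, unfolded o_def] fP Pf PP)
  moreover have "(norm (f \<theta>))\<^sup>2 - Re (f \<theta> * cnj (P \<theta>)) - Re (P \<theta> * cnj (f \<theta>)) + Re (P \<theta> * cnj (P \<theta>)) = (norm (f \<theta> - P \<theta>))\<^sup>2" for \<theta>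
    unfolding cmod_power2 by (simp add: power2_eq_square algebra_simps)
  ultimately have "((\<lambda>\<theta>. (norm (f \<theta> - P \<theta>))\<^sup>2) has_integral
     (integral {0..2 * pi} (\<lambda>\<theta>. (norm (f \<theta>))\<^sup>2) - Re A)) {0..2 * pi}" by simp
  then have "0 \<le> integral {0..2 * pi} (\<lambda>\<theta>. (norm (f \<theta>))\<^sup>2) - Re A"
    by (rule has_integral_nonneg) simp
  then have le: "Re A \<le> integral {0..2 * pi} (\<lambda>\<theta>. (norm (f \<theta>))\<^sup>2)" by simp
  have "Re (a n * cnj (a n) * of_real (2 * pi)) = (norm (fourier_int f n))\<^sup>2 / (2 * pi)" for n
    unfolding complex_norm_square[symmetric]
    by (simp add: a_def norm_divide power2_eq_square field_simps)
  then have "Re A = (\<Sum>n\<in>F. (norm (fourier_int f n))\<^sup>2) / (2 * pi)"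
    by (simp add: A_def sum_divide_distrib)
  with le show ?thesis by (simp add: field_simps)
qed

text \<open>Bessel's inequality makes the squares summable along any injective sequence of
  frequencies, in particular towards plus and minus infinity.\<close>

lemma fourier_int_tendsto_0:
  fixes k :: "nat \<Rightarrow> int"
  assumes f: "continuous_on {0..2 * pi} f" and k: "inj k"
  shows "(\<lambda>N. fourier_int f (k N)) \<longlonglongrightarrow> 0"
proof -
  have "summable (\<lambda>N. (norm (fourier_int f (k N)))\<^sup>2)"
  proof (rule summableI_nonneg_bounded)
    show "(\<Sum>i<n. (norm (fourier_int f (k i)))\<^sup>2) \<le> 2 * pi * integral {0..2 * pi} (\<lambda>\<theta>. (norm (f \<theta>))\<^sup>2)" for n
      using fourier_int_bessel[OF f, of "k ` {..<n}"] k
      by (simp add: sum.reindex inj_on_subset[OF k] o_def)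
  qed simp
  then have "(\<lambda>N. (norm (fourier_int f (k N)))\<^sup>2) \<longlonglongrightarrow> 0" by (rule summable_LIMSEQ_zero)
  then show ?thesis by (simp add: tendsto_norm_zero_iff)
qed

lemma cis_eq_cisD:
  assumes "cis x = cis y" "\<bar>x - y\<bar> < 2 * pi"
  shows "x = y"
proof -
  have "cis (x - y) = 1" using assms(1) by (simp flip: cis_divide)
  then have "cos (x - y) = 1" by (metis cis.simps(1) one_complex.simps(1))
  then obtain n :: int where n: "x - y = of_int n * 2 * pi" by (auto simp: cos_one_2pi_int)
  then have "\<bar>of_int n\<bar> < (1::real)" using assms(2) by (simp add: abs_mult)
  then have "n = 0" by simp
  with n show ?thesis by simp
qed

lemma cis_difference_quotient:
  "((\<lambda>x. (cis x - cis y) / of_real (x - y)) \<longlongrightarrow> \<i> * cis y) (at y)"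
proof -
  have "((\<lambda>x. (cos x - cos y) / (x - y)) \<longlongrightarrow> - sin y) (at y)"
    "((\<lambda>x. (sin x - sin y) / (x - y)) \<longlongrightarrow> cos y) (at y)"
    using DERIV_cos[of y] DERIV_sin[of y] unfolding has_field_derivative_iff by simp_all
  then have "((\<lambda>x. Complex ((cos x - cos y) / (x - y)) ((sin x - sin y) / (x - y))) \<longlongrightarrow> Complex (- sin y) (cos y)) (at y)"
    by (rule tendsto_Complex)
  moreover have "Complex ((cos x - cos y) / (x - y)) ((sin x - sin y) / (x - y)) = (cis x - cis y) / of_real (x - y)" for x
    by (simp add: complex_eq_iff)
  moreover have "Complex (- sin y) (cos y) = \<i> * cis y" by (simp add: complex_eq_iff)
  ultimately show ?thesis by simp
qed

text \<open>Chernoff's proof of pointwise convergence: dividing \<open>f - f \<theta>0\<close> by \<open>cis - cis \<theta>0\<close> turns the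
  partial sums at \<open>\<theta>0\<close> into a telescoping sum, whose end terms vanish by Bessel's inequality.\<close>

lemma fourier_series_tendsto:
  fixes f :: "real \<Rightarrow> real"
  assumes f: "continuous_on {0..2 * pi} f" and t: "0 < t" "t < 2 * pi"
    and D: "(f has_real_derivative D) (at t)"
  defines "a \<equiv> fourier_int (\<lambda>\<theta>. of_real (f \<theta>))"
  shows "(\<lambda>N. a 0 + (\<Sum>m=1..N. cis (real m * t) * a (int m) + cis (- real m * t) * a (- int m)))
    \<longlonglongrightarrow> of_real (2 * pi * f t)"
proof -
  define g where "g \<theta> = (if \<theta> = t then of_real D / (\<i> * cis t)
      else of_real (f \<theta> - f t) / (cis \<theta> - cis t))" for \<theta>
  \<comment> \<open>As t is an interior point, every other point of the closed interval lies at
    distance less than 2 pi from it, so the denominator vanishes at t only, where g takes the limit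
    value.\<close>
  have ne: "cis \<theta> \<noteq> cis t" if "\<theta> \<in> {0..2 * pi}" "\<theta> \<noteq> t" for \<theta>
  proof -
    have "\<bar>\<theta> - t\<bar> < 2 * pi" using that t by (auto simp: abs_less_iff)
    then show ?thesis using cis_eq_cisD[of \<theta> t] that by blast
  qed
  have "continuous (at \<theta> within {0..2 * pi}) g" if \<theta>: "\<theta> \<in> {0..2 * pi}" for \<theta>
  proof (cases "\<theta> = t")
    case True
    have "((\<lambda>x. of_real ((f x - f t) / (x - t)) / ((cis x - cis t) / of_real (x - t))) \<longlongrightarrow> of_real D / (\<i> * cis t)) (at t)"
      using D unfolding has_field_derivative_iff
      by (intro tendsto_divide tendsto_of_real cis_difference_quotient) auto
    moreover have "eventually (\<lambda>x. of_real ((f x - f t) / (x - t)) / ((cis x - cis t) / of_real (x - t)) = g x) (at t)"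
      by (auto simp: eventually_at_filter g_def)
    ultimately have "(g \<longlongrightarrow> g t) (at t)" unfolding g_def by (simp add: Lim_transform_eventually)
    then show ?thesis using True tendsto_within_subset[OF _ subset_UNIV] by (auto simp: continuous_within)
  next
    case False
    have "continuous (at \<theta> within {0..2 * pi}) (\<lambda>\<theta>. of_real (f \<theta> - f t) / (cis \<theta> - cis t))"
      using f \<theta> ne[OF \<theta> False] continuous_on_cis_int[of "{0..2 * pi}" 1]
      by (intro continuous_intros) (auto simp: continuous_on_eq_continuous_within)
    moreover have "eventually (\<lambda>x. of_real (f x - f t) / (cis x - cis t) = g x) (at \<theta> within {0..2 * pi})"
      unfolding eventually_at_filter
      by (rule eventually_mono[OF t1_space_nhds[OF False]]) (simp add: g_def)
    ultimately show ?thesis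
      using False unfolding continuous_within by (simp add: g_def Lim_transform_eventually)
  qed
  then have g: "continuous_on {0..2 * pi} g" by (simp add: continuous_on_eq_continuous_within)
  define h where "h n = cis (of_int n * t) * fourier_int g (n - 1)" for n
  \<comment> \<open>Multiplication by cis shifts frequencies by one, so f - f t = g (cis - cis t)
    becomes a difference of neighbouring coefficients of g; the factor cis (n t) makes these
    differences telescope.\<close>
  have step: "cis (of_int n * t) * a n - (if n = 0 then of_real (2 * pi * f t) else 0) = h n - h (n + 1)" for n
  proof -
    have I1: "((\<lambda>\<theta>. of_real (f \<theta>) * cis (- of_int n * \<theta>) - of_real (f t) * cis (of_int (- n) * \<theta>)) has_integral
       (a n - of_real (f t) * (if - n = 0 then of_real (2 * pi) else 0))) {0..2 * pi}"
      unfolding a_def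
      by (intro has_integral_diff has_integral_mult_right has_integral_cis_int fourier_int_has_integral continuous_intros f)
    have I2: "((\<lambda>\<theta>. g \<theta> * cis (- of_int (n - 1) * \<theta>) - cis t * (g \<theta> * cis (- of_int n * \<theta>))) has_integral
       (fourier_int g (n - 1) - cis t * fourier_int g n)) {0..2 * pi}"
      by (intro has_integral_diff has_integral_mult_right fourier_int_has_integral g)
    have eq: "of_real (f \<theta>) * cis (- of_int n * \<theta>) - of_real (f t) * cis (of_int (- n) * \<theta>)
      = g \<theta> * cis (- of_int (n - 1) * \<theta>) - cis t * (g \<theta> * cis (- of_int n * \<theta>))" if "\<theta> \<in> {0..2 * pi}" for \<theta>
    proof -
      have "of_real (f \<theta>) * cis (- of_int n * \<theta>) - of_real (f t) * cis (of_int (- n) * \<theta>)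
        = of_real (f \<theta> - f t) * cis (- of_int n * \<theta>)" by (simp add: left_diff_distrib)
      also have "of_real (f \<theta> - f t) = g \<theta> * (cis \<theta> - cis t)" using ne[OF that] by (auto simp: g_def)
      also have "g \<theta> * (cis \<theta> - cis t) * cis (- of_int n * \<theta>)
        = g \<theta> * (cis \<theta> * cis (- of_int n * \<theta>)) - cis t * (g \<theta> * cis (- of_int n * \<theta>))"
        by (simp only: right_diff_distrib left_diff_distrib mult_ac)
      also have "cis \<theta> * cis (- of_int n * \<theta>) = cis (- of_int (n - 1) * \<theta>)"
        unfolding cis_mult by (simp add: left_diff_distrib)
      finally show ?thesis .
    qed
    have e: "a n - of_real (f t) * (if - n = 0 then of_real (2 * pi) else 0) = fourier_int g (n - 1) - cis t * fourier_int g n"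
      by (rule has_integral_unique[OF has_integral_eq[OF eq I1] I2])
    have "h (n + 1) = cis (of_int n * t) * (cis t * fourier_int g n)"
      by (simp add: h_def cis_mult distrib_right flip: mult.assoc)
    then have "h n - h (n + 1) = cis (of_int n * t) * (a n - of_real (f t) * (if - n = 0 then of_real (2 * pi) else 0))"
      unfolding e by (simp add: h_def right_diff_distrib)
    then show ?thesis by (auto simp: right_diff_distrib)
  qed
  have telescope: "(K + x - y) + ((y - z) + (w - x)) = K + w - z" for K x y z w :: complex by simp
  have S: "a 0 + (\<Sum>m=1..N. cis (real m * t) * a (int m) + cis (- real m * t) * a (- int m))
      = of_real (2 * pi * f t) + h (- int N) - h (int N + 1)" for N
  proof (induction N)
    case 0
    show ?case using step[of 0] by (simp add: algebra_simps)
  next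
    case (Suc N)
    let ?F = "\<lambda>m. cis (real m * t) * a (int m) + cis (- real m * t) * a (- int m)"
    have A: "cis (real (Suc N) * t) * a (int (Suc N)) = h (int N + 1) - h (int (Suc N) + 1)"
      using step[of "int (Suc N)"] by (simp add: add_ac)
    have B: "cis (- real (Suc N) * t) * a (- int (Suc N)) = h (- int (Suc N)) - h (- int N)"
      using step[of "- int (Suc N)"] by (simp add: add_ac)
    have "a 0 + (\<Sum>m=1..Suc N. ?F m) = (a 0 + (\<Sum>m=1..N. ?F m)) + ?F (Suc N)"
      using sum.cl_ivl_Suc[of ?F 1 N] by (simp only: add.assoc) simp
    also have "\<dots> = (of_real (2 * pi * f t) + h (- int N) - h (int N + 1))
        + ((h (int N + 1) - h (int (Suc N) + 1)) + (h (- int (Suc N)) - h (- int N)))"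
      unfolding Suc.IH A B ..
    also have "\<dots> = of_real (2 * pi * f t) + h (- int (Suc N)) - h (int (Suc N) + 1)"
      by (rule telescope)
    finally show ?case .
  qed
  have "(\<lambda>N. norm (h (- int N))) \<longlonglongrightarrow> 0" "(\<lambda>N. norm (h (int N + 1))) \<longlonglongrightarrow> 0"
    unfolding h_def norm_mult norm_cis mult_1
    by (intro tendsto_norm_zero fourier_int_tendsto_0[OF g]; simp add: inj_def)+
  then have "(\<lambda>N. of_real (2 * pi * f t) + h (- int N) - h (int N + 1)) \<longlonglongrightarrow> of_real (2 * pi * f t) + 0 - 0"
    by (intro tendsto_intros) (simp_all add: tendsto_norm_zero_iff)
  then show ?thesis unfolding S by simp
qed

section \<open>Fourier series of smooth zero-mean functions\<close>

lemma funpow_deriv_trig: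
  "(deriv ^^ k) (\<lambda>\<theta>. Re (z * cis (c * \<theta>))) = (\<lambda>\<theta>. Re ((\<i> * of_real c) ^ k * z * cis (c * \<theta>)))"
proof (induction k)
  case (Suc k)
  have d: "deriv (\<lambda>\<theta>. Re (w * cis (c * \<theta>))) = (\<lambda>\<theta>. Re (\<i> * of_real c * w * cis (c * \<theta>)))" for w
    by (rule ext) (rule DERIV_imp_deriv, auto intro!: derivative_eq_intros simp: algebra_simps)
  have "(deriv ^^ Suc k) (\<lambda>\<theta>. Re (z * cis (c * \<theta>))) = deriv (\<lambda>\<theta>. Re ((\<i> * of_real c) ^ k * z * cis (c * \<theta>)))"
    by (simp only: funpow.simps o_def Suc)
  also have "\<dots> = (\<lambda>\<theta>. Re ((\<i> * of_real c) ^ Suc k * z * cis (c * \<theta>)))"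
    unfolding d by (simp only: power_Suc mult.assoc)
  finally show ?case .
qed simp

lemma smooth_trig: "smooth (\<lambda>\<theta>. Re (z * cis (c * \<theta>)))"
proof -
  have "(\<lambda>\<theta>. Re (w * cis (c * \<theta>))) field_differentiable at x" for w x
  proof -
    have "((\<lambda>\<theta>. Re (w * cis (c * \<theta>))) has_real_derivative (- Re w * sin (c * x) * c - Im w * (cos (c * x) * c))) (at x)"
      by (auto intro!: derivative_eq_intros simp: algebra_simps)
    then show ?thesis by (auto simp: field_differentiable_def)
  qed
  then show ?thesis unfolding smooth_def funpow_deriv_trig by blast
qed

lemma has_integral_trig_int:
  assumes "n \<noteq> 0"
  shows "((\<lambda>\<theta>. Re (z * cis (of_int n * \<theta>))) has_integral 0) {0..2 * pi}"
  using has_integral_linear[OF has_integral_mult_right[OF has_integral_cis_int[of n], of z] bounded_linear_Re] assms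
  by (simp add: o_def)

text \<open>The real function whose Fourier coefficients are \<open>z\<close> at \<open>m\<close>, \<open>cnj z\<close> at \<open>- m\<close> and \<open>0\<close>
  elsewhere; \<open>m = 0\<close> is excluded because of the zero mean.\<close>

lift_definition trig :: "nat \<Rightarrow> complex \<Rightarrow> zero_mean_fun" is
  "\<lambda>m z \<theta>. if m = 0 then 0 else 2 / sqrt (2 * pi) * Re (z * cis (real m * \<theta>))"
proof (intro conjI allI)
  fix m :: nat and z :: complex
  show "smooth (\<lambda>\<theta>. if m = 0 then 0 else 2 / sqrt (2 * pi) * Re (z * cis (real m * \<theta>)))"
    using smooth_cmult[OF smooth_trig] smooth_zero by (cases "m = 0") (simp_all only: if_True if_False simp_thms)
  have "cis (real m * (\<theta> + 2 * pi)) = cis (real m * \<theta>)" for \<theta>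
    using cis_int_2pi[of "int m"] by (simp add: distrib_left flip: cis_mult)
  then show "(if m = 0 then 0 else 2 / sqrt (2 * pi) * Re (z * cis (real m * (\<theta> + 2 * pi))))
      = (if m = 0 then 0 else 2 / sqrt (2 * pi) * Re (z * cis (real m * \<theta>)))" for \<theta> by presburger
  show "integral {0..2 * pi} (\<lambda>\<theta>. if m = 0 then 0 else 2 / sqrt (2 * pi) * Re (z * cis (real m * \<theta>))) = 0"
    using has_integral_mult_right[OF has_integral_trig_int[of "int m" z], of "2 / sqrt (2 * pi)"]
    by (cases "m = 0") (auto dest: integral_unique)
qed

lemma apply_fun_smooth: "smooth (apply_fun f)"
  and apply_fun_periodic: "apply_fun f (\<theta> + 2 * pi) = apply_fun f \<theta>"
  and apply_fun_mean: "integral {0..2 * pi} (apply_fun f) = 0"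
  using apply_fun[of f] by auto

lemma apply_fun_continuous: "continuous_on S (apply_fun f)"
  by (rule smooth_imp_continuous[OF apply_fun_smooth])

lemma smooth_has_derivative: "smooth f \<Longrightarrow> (f has_real_derivative deriv f x) (at x)"
  by (metis DERIV_deriv_iff_field_differentiable funpow_0 smooth_def)

lemma fourier_coeff_fourier_int:
  "fourier_coeff f n = fourier_int (\<lambda>\<theta>. of_real (apply_fun f \<theta>)) n / of_real (sqrt (2 * pi))"
  by (simp add: fourier_coeff_def fourier_int_def)

lemma has_integral_fourier_coeff:
  "((\<lambda>\<theta>. of_real (apply_fun f \<theta>) * cis (- of_int n * \<theta>)) has_integral (of_real (sqrt (2 * pi)) * fourier_coeff f n)) {0..2 * pi}"
proof -
  have "((\<lambda>\<theta>. complex_of_real (apply_fun f \<theta>) * cis (- of_int n * \<theta>)) has_integral fourier_int (\<lambda>\<theta>. of_real (apply_fun f \<theta>)) n) {0..2 * pi}"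
    by (intro fourier_int_has_integral continuous_intros apply_fun_continuous)
  then show ?thesis by (simp add: fourier_coeff_fourier_int)
qed

lemma fourier_coeff_minus: "fourier_coeff f (- n) = cnj (fourier_coeff f n)"
proof -
  have "((\<lambda>\<theta>. of_real (apply_fun f \<theta>) * cis (- of_int (- n) * \<theta>)) has_integral cnj (of_real (sqrt (2 * pi)) * fourier_coeff f n)) {0..2 * pi}"
    using has_integral_linear[OF has_integral_fourier_coeff[of f n] bounded_linear_cnj]
    by (simp add: o_def cis_cnj)
  then have "of_real (sqrt (2 * pi)) * fourier_coeff f (- n) = cnj (of_real (sqrt (2 * pi)) * fourier_coeff f n)"
    using has_integral_fourier_coeff has_integral_unique by blast
  then show ?thesis by simp
qed

lemma fourier_coeff_0: "fourier_coeff f 0 = 0"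
proof -
  have "(apply_fun f has_integral 0) {0..2 * pi}"
    using integrable_integral[OF smooth_imp_integrable[OF apply_fun_smooth]] apply_fun_mean by metis
  from has_integral_linear[OF this bounded_linear_of_real[where 'a = complex]]
  have "((\<lambda>\<theta>. complex_of_real (apply_fun f \<theta>)) has_integral 0) {0..2 * pi}" by (simp add: o_def)
  moreover have "((\<lambda>\<theta>. complex_of_real (apply_fun f \<theta>)) has_integral (of_real (sqrt (2 * pi)) * fourier_coeff f 0)) {0..2 * pi}"
    using has_integral_fourier_coeff[of f 0] by simp
  ultimately have "of_real (sqrt (2 * pi)) * fourier_coeff f 0 = 0" by (rule has_integral_unique[symmetric])
  then show ?thesis by simp
qed

lemma has_integral_mult_trig:
  assumes "m \<ge> 1"
  shows "((\<lambda>\<theta>. apply_fun f \<theta> * apply_fun (trig m z) \<theta>) has_integral 2 * Re (cnj (fourier_coeff f (int m)) * z)) {0..2 * pi}"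
proof -
  have "((\<lambda>\<theta>. 2 / sqrt (2 * pi) * Re (z * (of_real (apply_fun f \<theta>) * cis (- of_int (- int m) * \<theta>)))) has_integral
      2 / sqrt (2 * pi) * Re (z * (of_real (sqrt (2 * pi)) * fourier_coeff f (- int m)))) {0..2 * pi}"
    by (intro has_integral_mult_right has_integral_linear[OF _ bounded_linear_Re, unfolded o_def] has_integral_fourier_coeff)
  moreover have "2 / sqrt (2 * pi) * Re (z * (of_real (apply_fun f \<theta>) * cis (- of_int (- int m) * \<theta>))) = apply_fun f \<theta> * apply_fun (trig m z) \<theta>" for \<theta>
    using assms by (simp add: trig.rep_eq algebra_simps)
  moreover have "2 / sqrt (2 * pi) * Re (z * (of_real (sqrt (2 * pi)) * fourier_coeff f (- int m))) = 2 * Re (cnj (fourier_coeff f (int m)) * z)"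
    by (simp add: fourier_coeff_minus algebra_simps)
  ultimately show ?thesis by simp
qed

lemma fourier_coeff_trig:
  assumes "m \<ge> 1" "n \<ge> 1"
  shows "fourier_coeff (trig m z) (int n) = (if n = m then z else 0)"
proof -
  let ?s = "complex_of_real (sqrt (2 * pi))"
  have s: "?s * ?s = of_real (2 * pi)" by (simp flip: of_real_mult)
  have "((\<lambda>\<theta>. 1 / ?s * (z * cis (of_int (int m - int n) * \<theta>) + cnj z * cis (of_int (- int m - int n) * \<theta>))) has_integral
      1 / ?s * (z * (if int m - int n = 0 then of_real (2 * pi) else 0) + cnj z * (if - int m - int n = 0 then of_real (2 * pi) else 0))) {0..2 * pi}"
    by (intro has_integral_mult_right has_integral_add has_integral_cis_int)
  moreover have "1 / ?s * (z * cis (of_int (int m - int n) * \<theta>) + cnj z * cis (of_int (- int m - int n) * \<theta>))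
     = of_real (apply_fun (trig m z) \<theta>) * cis (- of_int (int n) * \<theta>)" for \<theta>
  proof -
    have "z * cis (of_int (int m - int n) * \<theta>) + cnj z * cis (of_int (- int m - int n) * \<theta>)
      = (z * cis (real m * \<theta>) + cnj (z * cis (real m * \<theta>))) * cis (- of_int (int n) * \<theta>)"
      by (simp add: cis_cnj algebra_simps cis_mult)
    also have "z * cis (real m * \<theta>) + cnj (z * cis (real m * \<theta>)) = of_real (2 * Re (z * cis (real m * \<theta>)))"
      by (rule complex_add_cnj)
    finally show ?thesis using assms by (simp add: trig.rep_eq)
  qed
  ultimately have H: "((\<lambda>\<theta>. of_real (apply_fun (trig m z) \<theta>) * cis (- of_int (int n) * \<theta>)) has_integral
      1 / ?s * (z * (if int m - int n = 0 then of_real (2 * pi) else 0) + cnj z * (if - int m - int n = 0 then of_real (2 * pi) else 0))) {0..2 * pi}"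
    by (simp only:)
  have "?s * fourier_coeff (trig m z) (int n) =
     1 / ?s * (z * (if int m - int n = 0 then of_real (2 * pi) else 0) + cnj z * (if - int m - int n = 0 then of_real (2 * pi) else 0))"
    by (rule has_integral_unique[OF has_integral_fourier_coeff H])
  also have "\<dots> = (if n = m then ?s * z else 0)"
    using assms s by (auto simp: field_simps)
  finally show ?thesis by (simp split: if_splits)
qed

lemma periodic_deriv:
  assumes "smooth f" "\<And>\<theta>. f (\<theta> + 2 * pi) = f \<theta>"
  shows "deriv f (\<theta> + 2 * pi) = deriv f \<theta>"
proof -
  have "((\<lambda>x. f (x + 2 * pi)) has_real_derivative deriv f (\<theta> + 2 * pi)) (at \<theta>)"
    using smooth_has_derivative[OF assms(1), of "\<theta> + 2 * pi"] by (simp add: DERIV_shift)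
  moreover have "(\<lambda>x. f (x + 2 * pi)) = f" using assms(2) by (rule ext)
  ultimately show ?thesis using DERIV_imp_deriv by metis
qed

text \<open>Integration by parts; the boundary terms cancel because f and the exponential are
  periodic.\<close>

lemma fourier_int_deriv:
  fixes f :: "real \<Rightarrow> real"
  assumes f: "smooth f" "\<And>\<theta>. f (\<theta> + 2 * pi) = f \<theta>"
  shows "fourier_int (\<lambda>\<theta>. of_real (deriv f \<theta>)) n = \<i> * of_int n * fourier_int (\<lambda>\<theta>. of_real (f \<theta>)) n"
proof -
  have I: "((\<lambda>\<theta>. of_real (f \<theta>) * (- \<i> * of_int n * cis (- of_int n * \<theta>)) + of_real (deriv f \<theta>) * cis (- of_int n * \<theta>)) has_integral
      of_real (f (2 * pi)) * cis (- of_int n * (2 * pi)) - of_real (f 0) * cis (- of_int n * 0)) {0..2 * pi}"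
  proof (rule fundamental_theorem_of_calculus)
    fix x :: real
    have c: "((\<lambda>\<theta>. cis (- of_int n * \<theta>)) has_vector_derivative - \<i> * of_int n * cis (- of_int n * x)) (at x within {0..2 * pi})"
    proof -
      have "((\<lambda>\<theta>. cis (- of_int n * \<theta>)) has_derivative (\<lambda>t. (- of_int n * t) *\<^sub>R (\<i> * cis (- of_int n * x)))) (at x within {0..2 * pi})"
        by (rule has_derivative_cis) (intro has_derivative_mult_right has_derivative_ident)
      then show ?thesis unfolding has_vector_derivative_def by (simp add: scaleR_conv_of_real mult_ac)
    qed
    have d: "((\<lambda>\<theta>. complex_of_real (f \<theta>)) has_vector_derivative of_real (deriv f x)) (at x within {0..2 * pi})"
      by (rule has_vector_derivative_of_real[OF has_field_derivative_at_within[OF smooth_has_derivative[OF f(1)]]])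
    show "((\<lambda>\<theta>. of_real (f \<theta>) * cis (- of_int n * \<theta>)) has_vector_derivative
        of_real (f x) * (- \<i> * of_int n * cis (- of_int n * x)) + of_real (deriv f x) * cis (- of_int n * x)) (at x within {0..2 * pi})"
      by (rule has_vector_derivative_mult[OF d c])
  qed simp
  have c1: "cis (- of_int n * (2 * pi)) = 1" using cis_int_2pi[of "- n"] by (simp only: of_int_minus)
  have f1: "f (2 * pi) = f 0" using f(2)[of 0] by (simp only: add_0)
  have z: "complex_of_real (f (2 * pi)) * cis (- of_int n * (2 * pi)) - of_real (f 0) * cis (- of_int n * 0) = 0"
    unfolding c1 f1 by simp
  note H1 = I[unfolded z]
  have H2: "((\<lambda>\<theta>. (- \<i> * of_int n) * (of_real (f \<theta>) * cis (- of_int n * \<theta>)) + of_real (deriv f \<theta>) * cis (- of_int n * \<theta>)) has_integral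
     (- \<i> * of_int n) * fourier_int (\<lambda>\<theta>. of_real (f \<theta>)) n + fourier_int (\<lambda>\<theta>. of_real (deriv f \<theta>)) n) {0..2 * pi}"
    by (intro has_integral_add has_integral_mult_right fourier_int_has_integral continuous_intros
        smooth_imp_continuous smooth_deriv f(1))
  have "(- \<i> * of_int n) * (of_real (f \<theta>) * cis (- of_int n * \<theta>)) + of_real (deriv f \<theta>) * cis (- of_int n * \<theta>)
      = of_real (f \<theta>) * (- \<i> * of_int n * cis (- of_int n * \<theta>)) + of_real (deriv f \<theta>) * cis (- of_int n * \<theta>)" for \<theta>
    by (intro arg_cong2[where f = "(+)"] refl mult.left_commute)
  from has_integral_unique[OF has_integral_eq[OF this H2] H1]
  have "(- \<i> * of_int n) * fourier_int (\<lambda>\<theta>. of_real (f \<theta>)) n + fourier_int (\<lambda>\<theta>. of_real (deriv f \<theta>)) n = 0" .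
  from minus_unique[OF this, symmetric] show ?thesis by simp
qed

text \<open>Two integrations by parts. The power 2 is what makes the Fourier series uniformly
  convergent by comparison with the sum of 1 / m^2.\<close>

lemma fourier_coeff_decay:
  obtains C where "C \<ge> 0" "\<And>m::nat. m \<ge> 1 \<Longrightarrow> norm (fourier_coeff f (int m)) \<le> C / (real m)\<^sup>2"
proof -
  let ?f = "apply_fun f"
  let ?f2 = "deriv (deriv ?f)"
  have sm: "smooth ?f" "smooth (deriv ?f)" "smooth ?f2"
    using apply_fun_smooth smooth_deriv by blast+
  have "compact (?f2 ` {0..2 * pi})" by (intro compact_continuous_image smooth_imp_continuous sm) simp
  from compact_imp_bounded[OF this] obtain B where "\<forall>y\<in>?f2 ` {0..2 * pi}. norm y \<le> B"
    unfolding bounded_iff by blast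
  then have B: "\<bar>?f2 \<theta>\<bar> \<le> B" if "\<theta> \<in> {0..2 * pi}" for \<theta> using that by simp
  have "B \<ge> 0" using B[of 0] by auto
  have f2: "norm (fourier_int (\<lambda>\<theta>. of_real (?f2 \<theta>)) n) \<le> B * (2 * pi)" for n
  proof -
    have "((\<lambda>\<theta>. complex_of_real (?f2 \<theta>) * cis (- of_int n * \<theta>)) has_integral fourier_int (\<lambda>\<theta>. of_real (?f2 \<theta>)) n) {0..2 * pi}"
      by (intro fourier_int_has_integral continuous_intros smooth_imp_continuous sm)
    from has_integral_bound_real[OF \<open>B \<ge> 0\<close> finite.emptyI this] B show ?thesis by (simp add: norm_mult)
  qed
  define C where "C = B * (2 * pi) / sqrt (2 * pi)"
  show ?thesis
  proof (rule that[of C])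
    show "C \<ge> 0" using \<open>B \<ge> 0\<close> by (simp add: C_def)
    fix m :: nat assume m: "m \<ge> 1"
    have "fourier_int (\<lambda>\<theta>. of_real (?f2 \<theta>)) (int m) = - (of_nat m)\<^sup>2 * fourier_int (\<lambda>\<theta>. of_real (?f \<theta>)) (int m)"
    proof -
      have "\<i> * x * (\<i> * x * F) = (\<i> * \<i>) * x\<^sup>2 * F" for x F by (simp only: power2_eq_square mult_ac)
      then show ?thesis by (simp add: fourier_int_deriv sm periodic_deriv apply_fun_periodic)
    qed
    then have "(real m)\<^sup>2 * norm (fourier_int (\<lambda>\<theta>. of_real (?f \<theta>)) (int m)) \<le> B * (2 * pi)"
      using f2[of "int m"] by (simp add: norm_mult norm_power)
    then have "norm (fourier_int (\<lambda>\<theta>. of_real (?f \<theta>)) (int m)) \<le> B * (2 * pi) / (real m)\<^sup>2"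
      using m by (simp add: pos_le_divide_eq mult.commute)
    then have "norm (fourier_int (\<lambda>\<theta>. of_real (?f \<theta>)) (int m)) / sqrt (2 * pi) \<le> B * (2 * pi) / (real m)\<^sup>2 / sqrt (2 * pi)"
      by (rule divide_right_mono) simp
    then show "norm (fourier_coeff f (int m)) \<le> C / (real m)\<^sup>2"
      by (simp add: fourier_coeff_fourier_int norm_divide C_def mult_ac)
  qed
qed

section \<open>Convergence of Fourier series and injectivity of the coefficients\<close>

lemma apply_fun_sum: "apply_fun (\<Sum>i\<in>I. g i) \<theta> = (\<Sum>i\<in>I. apply_fun (g i) \<theta>)"
  by (induction I rule: infinite_finite_induct) (auto simp: zero_zero_mean_fun.rep_eq plus_zero_mean_fun.rep_eq)

text \<open>This is the symmetric partial Fourier sum: \<open>trig m\<close> carries the frequencies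
  m and - m, and the zero frequency is absent by zero mean.\<close>

definition trunc_fun :: "nat \<Rightarrow> zero_mean_fun \<Rightarrow> zero_mean_fun" where
  "trunc_fun N f = (\<Sum>m=1..N. trig m (fourier_coeff f (int m)))"

lemma trunc_fun_tendsto:
  assumes "0 < \<theta>" "\<theta> < 2 * pi"
  shows "(\<lambda>N. apply_fun (trunc_fun N f) \<theta>) \<longlonglongrightarrow> apply_fun f \<theta>"
proof -
  let ?s = "complex_of_real (sqrt (2 * pi))"
  let ?a = "fourier_int (\<lambda>\<theta>. of_real (apply_fun f \<theta>))"
  have a: "?a n = ?s * fourier_coeff f n" for n by (simp add: fourier_coeff_fourier_int)
  have s: "?s * ?s = of_real (2 * pi)" by (simp flip: of_real_mult)
  have *: "(\<lambda>N. ?a 0 + (\<Sum>m=1..N. cis (real m * \<theta>) * ?a (int m) + cis (- real m * \<theta>) * ?a (- int m)))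
    \<longlonglongrightarrow> of_real (2 * pi * apply_fun f \<theta>)"
    by (rule fourier_series_tendsto[OF apply_fun_continuous assms smooth_has_derivative[OF apply_fun_smooth]])
  have e: "cis (real m * \<theta>) * ?a (int m) + cis (- real m * \<theta>) * ?a (- int m)
      = of_real (2 * pi * apply_fun (trig m (fourier_coeff f (int m))) \<theta>)" if "m \<ge> 1" for m
  proof -
    let ?w = "fourier_coeff f (int m) * cis (real m * \<theta>)"
    have "cis (real m * \<theta>) * ?a (int m) + cis (- real m * \<theta>) * ?a (- int m) = ?s * (?w + cnj ?w)"
      unfolding a fourier_coeff_minus by (simp add: cis_cnj algebra_simps)
    also have "?w + cnj ?w = of_real (2 * Re ?w)" by (rule complex_add_cnj)
    also have "?s * of_real (2 * Re ?w) = of_real (2 * pi * (2 / sqrt (2 * pi) * Re ?w))"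
    proof -
      have "q * (2 * R) = q * q * (2 / q * R)" if "q > 0" for q R :: real using that by simp
      from this[of "sqrt (2 * pi)" "Re ?w"] show ?thesis
        unfolding of_real_mult[symmetric] of_real_eq_iff by simp
    qed
    finally show ?thesis using that by (simp add: trig.rep_eq)
  qed
  have "(\<lambda>N. complex_of_real (2 * pi * apply_fun (trunc_fun N f) \<theta>)) \<longlonglongrightarrow> of_real (2 * pi * apply_fun f \<theta>)"
  proof (rule Lim_transform_eventually[OF *], intro always_eventually allI)
    fix N
    show "?a 0 + (\<Sum>m=1..N. cis (real m * \<theta>) * ?a (int m) + cis (- real m * \<theta>) * ?a (- int m))
      = complex_of_real (2 * pi * apply_fun (trunc_fun N f) \<theta>)"
    proof -
      have "(\<Sum>m=1..N. cis (real m * \<theta>) * ?a (int m) + cis (- real m * \<theta>) * ?a (- int m))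
        = (\<Sum>m=1..N. complex_of_real (2 * pi * apply_fun (trig m (fourier_coeff f (int m))) \<theta>))"
        by (intro sum.cong refl e) auto
      moreover have "?a 0 = 0" by (simp add: a[of 0] fourier_coeff_0)
      ultimately show ?thesis
        by (simp only: trunc_fun_def apply_fun_sum sum_distrib_left of_real_sum add_0)
    qed
  qed
  then have "(\<lambda>N. 2 * pi * apply_fun (trunc_fun N f) \<theta>) \<longlonglongrightarrow> 2 * pi * apply_fun f \<theta>"
    by (simp only: tendsto_of_real_iff)
  from tendsto_mult[OF tendsto_const[of "1 / (2 * pi)"] this] show ?thesis by simp
qed

text \<open>The decay of the coefficients gives uniform convergence to some limit, and pointwise
  convergence identifies it. The latter is available at interior points, which is enough for
  integrals over a period.\<close>

lemma trunc_fun_uniform_limit: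
  "uniform_limit {0<..<2 * pi} (\<lambda>N \<theta>. apply_fun (trunc_fun N f) \<theta>) (apply_fun f) sequentially"
proof -
  obtain C where C: "C \<ge> 0" "\<And>m::nat. m \<ge> 1 \<Longrightarrow> norm (fourier_coeff f (int m)) \<le> C / (real m)\<^sup>2"
    using fourier_coeff_decay by blast
  define K where "K m = 2 / sqrt (2 * pi) * (C * (1 / (real (Suc m))\<^sup>2))" for m
  define u where "u m = apply_fun (trig (Suc m) (fourier_coeff f (int (Suc m))))" for m
  have "summable (\<lambda>m. 1 / (real (Suc m))\<^sup>2)"
    using inverse_power_summable[of 2, where 'a = real] by (subst summable_Suc_iff) (simp add: inverse_eq_divide)
  then have K: "summable K" unfolding K_def by (intro summable_mult)
  have u: "norm (u m \<theta>) \<le> K m" for m \<theta>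
  proof -
    have "\<bar>Re (fourier_coeff f (int (Suc m)) * cis (real (Suc m) * \<theta>))\<bar> \<le> C * (1 / (real (Suc m))\<^sup>2)"
      using abs_Re_le_cmod[of "fourier_coeff f (int (Suc m)) * cis (real (Suc m) * \<theta>)"] C(2)[of "Suc m"]
      by (simp add: norm_mult)
    then show ?thesis
      unfolding u_def K_def trig.rep_eq by (simp only: nat.distinct if_False real_norm_def abs_mult) (intro mult_mono; simp)
  qed
  have part: "(\<Sum>m<N. u m \<theta>) = apply_fun (trunc_fun N f) \<theta>" for N \<theta>
    unfolding trunc_fun_def apply_fun_sum u_def
    by (rule sum.reindex_bij_witness[where i = "\<lambda>m. m - 1" and j = Suc]) auto
  have "uniform_limit {0<..<2 * pi} (\<lambda>N \<theta>. \<Sum>m<N. u m \<theta>) (\<lambda>\<theta>. suminf (\<lambda>m. u m \<theta>)) sequentially"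
    by (rule Weierstrass_m_test[OF u K])
  moreover have "suminf (\<lambda>m. u m \<theta>) = apply_fun f \<theta>" if "\<theta> \<in> {0<..<2 * pi}" for \<theta>
    using trunc_fun_tendsto[of \<theta> f] that unfolding part[symmetric]
    by (intro sums_unique[symmetric]) (simp add: sums_def)
  ultimately show ?thesis unfolding part uniform_limit_iff by simp
qed

text \<open>Continuity adds the endpoints of the period, and periodicity the rest of the
  line.\<close>

lemma zero_mean_fun_eqI:
  assumes "\<And>\<theta>. 0 < \<theta> \<Longrightarrow> \<theta> < 2 * pi \<Longrightarrow> apply_fun f \<theta> = apply_fun g \<theta>"
  shows "f = g"
proof -
  interpret f: periodic_fun_simple "apply_fun f" "2 * pi" by unfold_locales (rule apply_fun_periodic)
  interpret g: periodic_fun_simple "apply_fun g" "2 * pi" by unfold_locales (rule apply_fun_periodic)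
  have "apply_fun f x = apply_fun g x" if "x \<in> {0..2 * pi}" for x
  proof -
    have "apply_fun f x - apply_fun g x = 0"
      by (rule continuous_constant_on_closure[of "{0<..<2 * pi}" "\<lambda>x. apply_fun f x - apply_fun g x"])
        (use assms that in \<open>auto intro!: continuous_intros apply_fun_continuous\<close>)
    then show ?thesis by simp
  qed
  moreover have "\<exists>k::int. x - of_int k * (2 * pi) \<in> {0..2 * pi}" for x :: real
  proof (rule exI[of _ "\<lfloor>x / (2 * pi)\<rfloor>"])
    show "x - of_int \<lfloor>x / (2 * pi)\<rfloor> * (2 * pi) \<in> {0..2 * pi}"
      using floor_divide_lower[of "2 * pi" x] floor_divide_upper[of "2 * pi" x] by (simp add: algebra_simps)
  qed
  ultimately have eq: "\<exists>k::int. apply_fun f (x - of_int k * (2 * pi)) = apply_fun g (x - of_int k * (2 * pi))" for x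
    by blast
  have "apply_fun f x = apply_fun g x" for x
    using eq[of x] by (simp add: f.minus_of_int g.minus_of_int)
  then show ?thesis by (simp add: apply_fun_inject[symmetric] fun_eq_iff)
qed

lemma fourier_coeff_inject:
  assumes "\<And>m::nat. m \<ge> 1 \<Longrightarrow> fourier_coeff f (int m) = fourier_coeff g (int m)"
  shows "f = g"
proof (rule zero_mean_fun_eqI)
  fix \<theta> :: real assume \<theta>: "0 < \<theta>" "\<theta> < 2 * pi"
  have "trunc_fun N f = trunc_fun N g" for N
    unfolding trunc_fun_def using assms by simp
  then have "(\<lambda>N. apply_fun (trunc_fun N f) \<theta>) \<longlonglongrightarrow> apply_fun g \<theta>"
    using trunc_fun_tendsto[OF \<theta>, of g] by simp
  then show "apply_fun f \<theta> = apply_fun g \<theta>"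
    by (rule LIMSEQ_unique[OF trunc_fun_tendsto[OF \<theta>]])
qed

section \<open>Modes\<close>

lemma fourier_coeff_add: "fourier_coeff (f + g) n = fourier_coeff f n + fourier_coeff g n"
proof -
  have "((\<lambda>\<theta>. of_real (apply_fun f \<theta>) * cis (- of_int n * \<theta>) + of_real (apply_fun g \<theta>) * cis (- of_int n * \<theta>)) has_integral
      (of_real (sqrt (2 * pi)) * fourier_coeff f n + of_real (sqrt (2 * pi)) * fourier_coeff g n)) {0..2 * pi}"
    by (intro has_integral_add has_integral_fourier_coeff)
  moreover have "complex_of_real (apply_fun (f + g) \<theta>) * cis (- of_int n * \<theta>)
      = of_real (apply_fun f \<theta>) * cis (- of_int n * \<theta>) + of_real (apply_fun g \<theta>) * cis (- of_int n * \<theta>)" for \<theta>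
    by (simp add: plus_zero_mean_fun.rep_eq distrib_right)
  ultimately have "of_real (sqrt (2 * pi)) * fourier_coeff (f + g) n
      = of_real (sqrt (2 * pi)) * fourier_coeff f n + of_real (sqrt (2 * pi)) * fourier_coeff g n"
    by (intro has_integral_unique[OF has_integral_fourier_coeff]) simp
  then show ?thesis by (simp flip: distrib_left)
qed

lemma fourier_coeff_scaleR: "fourier_coeff (r *\<^sub>R f) n = of_real r * fourier_coeff f n"
proof -
  have "((\<lambda>\<theta>. of_real r * (of_real (apply_fun f \<theta>) * cis (- of_int n * \<theta>))) has_integral
      (of_real r * (of_real (sqrt (2 * pi)) * fourier_coeff f n))) {0..2 * pi}"
    by (intro has_integral_mult_right has_integral_fourier_coeff)
  moreover have "complex_of_real (apply_fun (r *\<^sub>R f) \<theta>) * cis (- of_int n * \<theta>)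
      = of_real r * (of_real (apply_fun f \<theta>) * cis (- of_int n * \<theta>))" for \<theta>
    by (simp add: scaleR_zero_mean_fun.rep_eq)
  ultimately have "of_real (sqrt (2 * pi)) * fourier_coeff (r *\<^sub>R f) n
      = of_real r * (of_real (sqrt (2 * pi)) * fourier_coeff f n)"
    by (intro has_integral_unique[OF has_integral_fourier_coeff]) (simp add: mult.assoc)
  then show ?thesis by simp
qed

abbreviation mode_c :: "nat \<Rightarrow> phase \<Rightarrow> complex" where
  "mode_c \<equiv> mode_b_neg_star"

lemma mode_add:
  "mode_b m (x + y) = mode_b m x + mode_b m y" "mode_c m (x + y) = mode_c m x + mode_c m y"
  unfolding mode_b_def mode_b_neg_star_def fst_add snd_add fourier_coeff_add
  by (simp_all add: distrib_left add_divide_distrib diff_divide_distrib)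

lemma mode_scaleR:
  "mode_b m (r *\<^sub>R x) = of_real r * mode_b m x" "mode_c m (r *\<^sub>R x) = of_real r * mode_c m x"
  unfolding mode_b_def mode_b_neg_star_def fst_scaleR snd_scaleR fourier_coeff_scaleR
  by (simp_all add: distrib_left right_diff_distrib mult_ac)

lemma mode_0: "mode_b m 0 = 0" "mode_c m 0 = 0"
  using mode_scaleR[of m 0 0] by simp_all

lemma mode_minus: "mode_b m (- x) = - mode_b m x" "mode_c m (- x) = - mode_c m x"
  using mode_scaleR[of m "-1" x] by simp_all

lemma mode_diff: "mode_b m (x - y) = mode_b m x - mode_b m y" "mode_c m (x - y) = mode_c m x - mode_c m y"
  using mode_add[of m x "- y"] by (simp_all add: mode_minus)

lemma of_real_sqrt_square: "complex_of_real (sqrt (2 * real m)) * of_real (sqrt (2 * real m)) = 2 * of_nat m"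
  unfolding of_real_mult[symmetric] by simp

lemma fourier_coeff_eq_modes:
  assumes "m \<ge> 1"
  shows "fourier_coeff (fst x) (int m) = (mode_b m x + mode_c m x) / of_real (sqrt (2 * real m))"
    and "fourier_coeff (snd x) (int m) = - \<i> * (mode_b m x - mode_c m x) * of_real (sqrt (2 * real m) / 2)"
proof -
  let ?s = "complex_of_real (sqrt (2 * real m))"
  have s: "?s \<noteq> 0" "?s * ?s = 2 * of_nat m" using assms of_real_sqrt_square[of m] by auto
  let ?u = "fourier_coeff (fst x) (int m)" and ?v = "fourier_coeff (snd x) (int m)"
  have "mode_b m x + mode_c m x = 2 * of_nat m * ?u / ?s"
    unfolding mode_b_def mode_b_neg_star_def by (simp add: add_divide_distrib diff_divide_distrib)
  also have "\<dots> = ?s * ?u" unfolding s(2)[symmetric] using s(1) by simp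
  finally show "?u = (mode_b m x + mode_c m x) / of_real (sqrt (2 * real m))" using s(1) by simp
  have "mode_b m x - mode_c m x = 2 * \<i> * ?v / ?s"
    unfolding mode_b_def mode_b_neg_star_def by (simp add: add_divide_distrib diff_divide_distrib)
  then show "?v = - \<i> * (mode_b m x - mode_c m x) * of_real (sqrt (2 * real m) / 2)" using s(1) by simp
qed

lemma phase_eqI:
  assumes "\<And>m. m \<ge> 1 \<Longrightarrow> mode_b m x = mode_b m y" "\<And>m. m \<ge> 1 \<Longrightarrow> mode_c m x = mode_c m y"
  shows "x = y"
  by (intro prod_eqI fourier_coeff_inject) (simp_all add: fourier_coeff_eq_modes assms)

text \<open>This inverts the passage to mode variables for a single m. The arguments b and c are
  arbitrary complex numbers, as the other two entries of \<open>modes\<close> are their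
  conjugates.\<close>

definition mode_vec :: "nat \<Rightarrow> complex \<Rightarrow> complex \<Rightarrow> phase" where
  "mode_vec m b c = (trig m ((b + c) / of_real (sqrt (2 * real m))),
                     trig m (- \<i> * (b - c) * of_real (sqrt (2 * real m) / 2)))"

lemma mode_mode_vec:
  assumes "m \<ge> 1" "n \<ge> 1"
  shows "mode_b n (mode_vec m b c) = (if n = m then b else 0)"
    and "mode_c n (mode_vec m b c) = (if n = m then c else 0)"
proof -
  let ?s = "complex_of_real (sqrt (2 * real m))"
  have s: "?s \<noteq> 0" "of_nat m = ?s * ?s / 2" using assms of_real_sqrt_square[of m] by auto
  have "(of_nat m * ((b + c) / ?s) + \<i> * (- \<i> * (b - c) * of_real (sqrt (2 * real m) / 2))) / ?s = b"
    "(of_nat m * ((b + c) / ?s) - \<i> * (- \<i> * (b - c) * of_real (sqrt (2 * real m) / 2))) / ?s = c"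
    unfolding s(2) using s(1) by (simp_all add: field_simps)
  then show "mode_b n (mode_vec m b c) = (if n = m then b else 0)"
    "mode_c n (mode_vec m b c) = (if n = m then c else 0)"
    unfolding mode_b_def mode_b_neg_star_def mode_vec_def fst_conv snd_conv fourier_coeff_trig[OF assms]
    by simp_all
qed

lemma mode_vec_add:
  "m \<ge> 1 \<Longrightarrow> mode_vec m b c + mode_vec m b' c' = mode_vec m (b + b') (c + c')"
  by (rule phase_eqI) (simp_all add: mode_add mode_mode_vec)

lemma mode_vec_scaleR:
  "m \<ge> 1 \<Longrightarrow> r *\<^sub>R mode_vec m b c = mode_vec m (of_real r * b) (of_real r * c)"
  by (rule phase_eqI) (simp_all add: mode_scaleR mode_mode_vec)

lemma mode_vec_minus: "m \<ge> 1 \<Longrightarrow> - mode_vec m b c = mode_vec m (- b) (- c)"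
  using mode_vec_scaleR[of m "-1" b c] by simp

lemma mode_vec_diff:
  "m \<ge> 1 \<Longrightarrow> mode_vec m b c - mode_vec m b' c' = mode_vec m (b - b') (c - c')"
  by (rule phase_eqI) (simp_all add: mode_diff mode_mode_vec)

lemma mode_vec_inject: "m \<ge> 1 \<Longrightarrow> mode_vec m b c = mode_vec m b' c' \<longleftrightarrow> b = b' \<and> c = c'"
  using mode_mode_vec[of m m] by metis

section \<open>The symplectic form in mode variables\<close>

lemma has_integral_Omega:
  "((\<lambda>\<theta>. apply_fun (fst y) \<theta> * apply_fun (snd x) \<theta> - apply_fun (fst x) \<theta> * apply_fun (snd y) \<theta>)
     has_integral Omega x y) {0..2 * pi}"
  unfolding Omega_def
  by (intro integrable_integral integrable_continuous_real continuous_intros apply_fun_continuous)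

lemma linear_Omega_left: "linear (\<lambda>x. Omega x z)"
proof (rule linearI)
  show "Omega (x + y) z = Omega x z + Omega y z" for x y
    using has_integral_add[OF has_integral_Omega[of z x] has_integral_Omega[of z y]]
    by (intro has_integral_unique[OF has_integral_Omega]) (simp add: plus_zero_mean_fun.rep_eq algebra_simps)
  show "Omega (r *\<^sub>R x) z = r *\<^sub>R Omega x z" for r x
    using has_integral_mult_right[OF has_integral_Omega[of z x], of r]
    by (intro has_integral_unique[OF has_integral_Omega]) (simp add: scaleR_zero_mean_fun.rep_eq algebra_simps)
qed

lemma linear_Omega_right: "linear (Omega z)"
proof (rule linearI)
  show "Omega z (x + y) = Omega z x + Omega z y" for x y
    using has_integral_add[OF has_integral_Omega[of x z] has_integral_Omega[of y z]]
    by (intro has_integral_unique[OF has_integral_Omega]) (simp add: plus_zero_mean_fun.rep_eq algebra_simps)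
  show "Omega z (r *\<^sub>R x) = r *\<^sub>R Omega z x" for r x
    using has_integral_mult_right[OF has_integral_Omega[of x z], of r]
    by (intro has_integral_unique[OF has_integral_Omega]) (simp add: scaleR_zero_mean_fun.rep_eq algebra_simps)
qed

lemmas Omega_minus_left = linear_neg[OF linear_Omega_left]
lemmas Omega_minus_right = linear_neg[OF linear_Omega_right]
lemmas Omega_diff_left = linear_diff[OF linear_Omega_left]
lemmas Omega_add_right = linear_add[OF linear_Omega_right]

text \<open>In mode variables the form is, up to a factor, the imaginary part of the indefinite
  Hermitian form |b|^2 - |c|^2. The vector x is arbitrary: integrating against a trigonometric
  function of frequency m picks out its m-th coefficients exactly.\<close>

lemma Omega_mode_vec:
  assumes m: "m \<ge> 1"
  shows "Omega x (mode_vec m b c) = - 2 * Im (cnj (mode_b m x) * b - cnj (mode_c m x) * c)"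
proof -
  let ?s = "complex_of_real (sqrt (2 * real m))"
  have s: "?s \<noteq> 0" "of_nat m = ?s * ?s / 2" using assms of_real_sqrt_square[of m] by auto
  define w where "w = ?s"
  have w: "w \<noteq> 0" "cnj w = w" using s by (simp_all add: w_def)
  let ?u = "fourier_coeff (fst x) (int m)" and ?v = "fourier_coeff (snd x) (int m)"
  let ?z1 = "(b + c) / ?s" and ?z2 = "- \<i> * (b - c) * of_real (sqrt (2 * real m) / 2)"
  have "((\<lambda>\<theta>. apply_fun (snd x) \<theta> * apply_fun (trig m ?z1) \<theta> - apply_fun (fst x) \<theta> * apply_fun (trig m ?z2) \<theta>)
     has_integral (2 * Re (cnj ?v * ?z1) - 2 * Re (cnj ?u * ?z2))) {0..2 * pi}"
    by (intro has_integral_diff has_integral_mult_trig m)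
  then have "Omega x (mode_vec m b c) = 2 * Re (cnj ?v * ?z1) - 2 * Re (cnj ?u * ?z2)"
    by (intro has_integral_unique[OF has_integral_Omega]) (simp add: mode_vec_def mult.commute)
  also have "\<dots> = - 2 * Im (\<i> * (cnj ?v * ?z1 - cnj ?u * ?z2) * -1)" by simp
  also have "\<i> * (cnj ?v * ?z1 - cnj ?u * ?z2) * -1
     = cnj (mode_b m x) * b - cnj (mode_c m x) * c"
  proof -
    have "of_real (sqrt (2 * real m) / 2) = w / 2" by (simp add: w_def)
    moreover have "cnj (mode_b m x) = (w * w / 2 * cnj ?u - \<i> * cnj ?v) / w"
      "cnj (mode_c m x) = (w * w / 2 * cnj ?u + \<i> * cnj ?v) / w"
      unfolding mode_b_def mode_b_neg_star_def w_def s(2) by simp_all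
    moreover have "\<i> * (v * ((b + c) / w) - u * (- \<i> * (b - c) * (w / 2))) * -1
      = (w * w / 2 * u - \<i> * v) / w * b - (w * w / 2 * u + \<i> * v) / w * c" for u v
      using w(1) by (simp add: field_simps)
    ultimately show ?thesis unfolding w_def[symmetric] by metis
  qed
  finally show ?thesis .
qed

lemma Omega_mode_vec_mode_vec:
  assumes "m \<ge> 1" "n \<ge> 1"
  shows "Omega (mode_vec m b c) (mode_vec n b' c') = (if m = n then - 2 * Im (cnj b * b' - cnj c * c') else 0)"
  using assms by (auto simp: Omega_mode_vec mode_mode_vec)

section \<open>Truncation to finitely many modes\<close>

definition trunc :: "nat \<Rightarrow> phase \<Rightarrow> phase" where
  "trunc N x = (\<Sum>m=1..N. mode_vec m (mode_b m x) (mode_c m x))"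

lemma trunc_eq: "trunc N x = (trunc_fun N (fst x), trunc_fun N (snd x))"
proof -
  have "mode_vec m (mode_b m x) (mode_c m x)
      = (trig m (fourier_coeff (fst x) (int m)), trig m (fourier_coeff (snd x) (int m)))" if "m \<ge> 1" for m
    using that by (simp add: mode_vec_def fourier_coeff_eq_modes)
  then have "trunc N x = (\<Sum>m=1..N. (trig m (fourier_coeff (fst x) (int m)), trig m (fourier_coeff (snd x) (int m))))"
    unfolding trunc_def by (intro sum.cong) auto
  then show ?thesis by (simp add: trunc_fun_def sum_prod)
qed

text \<open>With y = J0 x this is twice the squared norm of the remainder in the completion for
  \<open>J0\<close>, so it yields density of finite mode sums.\<close>

lemma Omega_trunc_tendsto_0:
  "(\<lambda>N. Omega (y - trunc N y) (x - trunc N x)) \<longlonglongrightarrow> 0"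
proof (rule LIMSEQ_I)
  fix r :: real assume r: "r > 0"
  \<comment> \<open>The integrand is at most 1 * e + e * 1, so the integral is at most 4 pi e, which
    is at most r / 2. The cap at 1 allows one factor in each product to be bounded by 1.\<close>
  define e where "e = min 1 (r / (8 * pi))"
  have e: "e > 0" "e \<le> 1" "4 * pi * e < r" using r by (auto simp: e_def min_def field_simps)
  have ev: "\<forall>\<^sub>F N in sequentially. \<forall>\<theta>\<in>{0<..<2 * pi}. \<bar>apply_fun (f - trunc_fun N f) \<theta>\<bar> < e" for f
    using uniform_limitD[OF trunc_fun_uniform_limit e(1), of f]
    by (simp add: minus_zero_mean_fun.rep_eq dist_real_def abs_minus_commute)
  have "\<forall>\<^sub>F N in sequentially. norm (Omega (y - trunc N y) (x - trunc N x) - 0) < r"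
    using ev[of "fst x"] ev[of "snd x"] ev[of "fst y"] ev[of "snd y"]
  proof eventually_elim
    case (elim N)
    let ?x = "x - trunc N x" and ?y = "y - trunc N y"
    have *: "fst ?x = fst x - trunc_fun N (fst x)" "snd ?x = snd x - trunc_fun N (snd x)"
      "fst ?y = fst y - trunc_fun N (fst y)" "snd ?y = snd y - trunc_fun N (snd y)"
      by (simp_all add: trunc_eq)
    have "norm (Omega ?y ?x) \<le> (2 * e) * Henstock_Kurzweil_Integration.content {0..2 * pi}"
    proof (rule has_integral_bound_real[OF _ _ has_integral_Omega, of _ "{0, 2 * pi}"])
      fix \<theta> assume "\<theta> \<in> {0..2 * pi} - {0, 2 * pi}"
      then have t: "\<theta> \<in> {0<..<2 * pi}" by auto
      have "\<bar>apply_fun (fst ?x) \<theta>\<bar> \<le> 1" "\<bar>apply_fun (snd ?x) \<theta>\<bar> \<le> 1"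
        "\<bar>apply_fun (fst ?y) \<theta>\<bar> \<le> e" "\<bar>apply_fun (snd ?y) \<theta>\<bar> \<le> e"
        using elim t e(2) unfolding * by (meson less_imp_le order_trans)+
      then have "\<bar>apply_fun (fst ?x) \<theta> * apply_fun (snd ?y) \<theta>\<bar> \<le> 1 * e"
        "\<bar>apply_fun (fst ?y) \<theta> * apply_fun (snd ?x) \<theta>\<bar> \<le> e * 1"
        unfolding abs_mult using e by (intro mult_mono; simp)+
      then show "norm (apply_fun (fst ?x) \<theta> * apply_fun (snd ?y) \<theta> - apply_fun (fst ?y) \<theta> * apply_fun (snd ?x) \<theta>) \<le> 2 * e"
        by simp
    qed (use e in auto)
    then show ?case using e(3) by (simp add: mult_ac)
  qed
  then show "\<exists>no. \<forall>N\<ge>no. norm (Omega (y - trunc N y) (x - trunc N x) - 0) < r"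
    by (simp add: eventually_sequentially)
qed

section \<open>Block-diagonal maps in mode variables\<close>

lemma vector_4 [simp]:
  "(vector [x, y, z, w] :: 'a::zero ^ 4) $ 1 = x" "(vector [x, y, z, w] :: 'a ^ 4) $ 2 = y"
  "(vector [x, y, z, w] :: 'a ^ 4) $ 3 = z" "(vector [x, y, z, w] :: 'a ^ 4) $ 4 = w"
  unfolding vector_def by simp_all

lemma block_diagonal_modes:
  assumes "block_diagonal A M" "m \<ge> 1"
  shows "mode_b m (A x) = M m $ 1 $ 1 * mode_b m x + M m $ 1 $ 2 * mode_c m x
      + M m $ 1 $ 3 * cnj (mode_c m x) + M m $ 1 $ 4 * cnj (mode_b m x)"
    and "mode_c m (A x) = M m $ 2 $ 1 * mode_b m x + M m $ 2 $ 2 * mode_c m x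
      + M m $ 2 $ 3 * cnj (mode_c m x) + M m $ 2 $ 4 * cnj (mode_b m x)"
proof -
  have e: "modes m (A x) = M m *v modes m x" using assms unfolding block_diagonal_def by blast
  show "mode_b m (A x) = M m $ 1 $ 1 * mode_b m x + M m $ 1 $ 2 * mode_c m x
      + M m $ 1 $ 3 * cnj (mode_c m x) + M m $ 1 $ 4 * cnj (mode_b m x)"
    using arg_cong[OF e, of "\<lambda>v. v $ 1"] by (simp add: modes_def matrix_vector_mult_def sum_4)
  show "mode_c m (A x) = M m $ 2 $ 1 * mode_b m x + M m $ 2 $ 2 * mode_c m x
      + M m $ 2 $ 3 * cnj (mode_c m x) + M m $ 2 $ 4 * cnj (mode_b m x)"
    using arg_cong[OF e, of "\<lambda>v. v $ 2"] by (simp add: modes_def matrix_vector_mult_def sum_4)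
qed

lemma translation_modes:
  assumes "block_diagonal T (translation_block \<alpha>)" "m \<ge> 1"
  shows "mode_b m (T x) = cis (m * \<alpha>) * mode_b m x" "mode_c m (T x) = cis (m * \<alpha>) * mode_c m x"
  by (simp_all add: block_diagonal_modes[OF assms] translation_block_def diag4_def)

lemma reference_modes:
  assumes "block_diagonal J0 reference_block" "m \<ge> 1"
  shows "mode_b m (J0 x) = \<i> * mode_b m x" "mode_c m (J0 x) = - \<i> * mode_c m x"
  by (simp_all add: block_diagonal_modes[OF assms] reference_block_def diag4_def)

lemma gowdy_modes:
  assumes "block_diagonal U (gowdy_block t t0)" "m \<ge> 1"
  shows "mode_b m (U x) = gowdy_alpha m t t0 * mode_b m x + gowdy_beta m t t0 * mode_c m x"
    and "mode_c m (U x) = cnj (gowdy_beta m t t0) * mode_b m x + cnj (gowdy_alpha m t t0) * mode_c m x"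
  by (simp_all add: block_diagonal_modes[OF assms] gowdy_block_def Let_def)

lemma reference_mode_vec:
  assumes "block_diagonal J0 reference_block" "m \<ge> 1"
  shows "J0 (mode_vec m b c) = mode_vec m (\<i> * b) (- \<i> * c)"
  by (rule phase_eqI) (simp_all add: reference_modes[OF assms(1)] mode_mode_vec[OF assms(2)])

lemma gowdy_mode_vec:
  assumes "block_diagonal U (gowdy_block t t0)" "m \<ge> 1"
  shows "U (mode_vec m b c) = mode_vec m (gowdy_alpha m t t0 * b + gowdy_beta m t t0 * c)
     (cnj (gowdy_beta m t t0) * b + cnj (gowdy_alpha m t t0) * c)"
  by (rule phase_eqI) (simp_all add: gowdy_modes[OF assms(1)] mode_mode_vec[OF assms(2)])

section \<open>Translation-invariant complex structures\<close>

text \<open>\<open>inv\<close> can be cancelled on the left only where T \<alpha> is surjective;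
  translation by - \<alpha> provides the preimages.\<close>

lemma translations_commute:
  assumes T: "\<And>\<alpha>. block_diagonal (T \<alpha>) (translation_block \<alpha>)"
    and invariant: "\<And>\<alpha>. inv (T \<alpha>) \<circ> J \<circ> T \<alpha> = J"
  shows "J (T \<alpha> x) = T \<alpha> (J x)"
proof -
  have "T \<alpha> (T (- \<alpha>) y) = y" for y
    by (rule phase_eqI) (simp_all add: translation_modes[OF T] cis_mult flip: mult.assoc)
  then have "surj (T \<alpha>)" by (metis surjI)
  have "inv (T \<alpha>) (J (T \<alpha> x)) = J x" using invariant[of \<alpha>] by (metis comp_apply)
  then show ?thesis using surj_f_inv_f[OF \<open>surj (T \<alpha>)\<close>] by metis
qed

lemma translation_mode_vec:
  assumes "block_diagonal T (translation_block \<alpha>)" "m \<ge> 1"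
  shows "T (mode_vec m b c) = mode_vec m (cis (m * \<alpha>) * b) (cis (m * \<alpha>) * c)"
  by (rule phase_eqI) (simp_all add: translation_modes[OF assms(1)] mode_mode_vec[OF assms(2)])

text \<open>The sum of the translations by \<alpha> and - \<alpha> acts on mode m as the real scalar
  2 cos (m \<alpha>). A real-linear \<open>J\<close> commutes with such scalars, so these cosines
  are what separates the modes.\<close>

lemma exists_cos_neq:
  assumes "m \<noteq> n" "m \<ge> 1" "n \<ge> 1"
  shows "\<exists>\<alpha>. cos (real m * \<alpha>) \<noteq> cos (real n * \<alpha>)"
  using assms
proof (induction m n rule: linorder_wlog)
  case (le m n)
  \<comment> \<open>With m < n, the angle 2 pi / n is a full turn for n but only the fraction m / n
    of a turn for m.\<close>
  have "cos (real m * (2 * pi / real n)) \<noteq> 1"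
  proof
    assume "cos (real m * (2 * pi / real n)) = 1"
    then obtain k :: int where "real m * (2 * pi / real n) = of_int k * 2 * pi"
      by (auto simp: cos_one_2pi_int)
    then have "(2 * pi) * (real m / real n) = (2 * pi) * of_int k" by (simp add: mult_ac)
    then have "real m / real n = of_int k" by (simp only: mult_cancel_left) simp
    moreover have "0 < real m / real n" "real m / real n < 1" using le by auto
    ultimately show False by (metis of_int_0_less_iff of_int_less_1_iff zless_imp_add1_zle add_0 not_less)
  qed
  moreover have "cos (real n * (2 * pi / real n)) = 1" using le by simp
  ultimately show ?case by metis
next
  case (sym m n)
  then show ?case by metis
qed

text \<open>The real eigenvalues 2 cos (m \<alpha>) keep \<open>J\<close> inside each mode. A
  translation by a quarter period then acts as multiplication by i, so \<open>J\<close> is complex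
  linear in (b, c) and no terms in their conjugates occur.\<close>

lemma translation_invariant_mode_vec:
  assumes T: "\<And>\<alpha>. block_diagonal (T \<alpha>) (translation_block \<alpha>)"
    and comm: "\<And>\<alpha> x. J (T \<alpha> x) = T \<alpha> (J x)"
    and J: "linear J" and m: "m \<ge> 1"
  obtains p q r w where "\<And>b c. J (mode_vec m b c) = mode_vec m (p * b + q * c) (r * b + w * c)"
proof -
  have off: "mode_b n (J (mode_vec m b c)) = 0 \<and> mode_c n (J (mode_vec m b c)) = 0"
    if n: "n \<ge> 1" "n \<noteq> m" for n b c
  proof -
    from exists_cos_neq[OF n(2) n(1) m] obtain \<alpha> where \<alpha>: "cos (real n * \<alpha>) \<noteq> cos (real m * \<alpha>)" by blast
    let ?v = "mode_vec m b c"
    have cc: "cis (real k * \<alpha>) + cis (real k * - \<alpha>) = of_real (2 * cos (real k * \<alpha>))" for k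
      by (simp add: complex_eq_iff)
    have "T \<alpha> ?v + T (- \<alpha>) ?v = mode_vec m ((cis (m * \<alpha>) + cis (m * - \<alpha>)) * b) ((cis (m * \<alpha>) + cis (m * - \<alpha>)) * c)"
      by (simp add: translation_mode_vec[OF T m] mode_vec_add[OF m] distrib_right)
    also have "\<dots> = (2 * cos (real m * \<alpha>)) *\<^sub>R ?v" unfolding cc mode_vec_scaleR[OF m] ..
    finally have "J (T \<alpha> ?v) + J (T (- \<alpha>) ?v) = (2 * cos (real m * \<alpha>)) *\<^sub>R J ?v"
      by (metis linear_add[OF J] linear_scale[OF J])
    then have e: "T \<alpha> (J ?v) + T (- \<alpha>) (J ?v) = (2 * cos (real m * \<alpha>)) *\<^sub>R J ?v" unfolding comm .
    have "of_real (2 * cos (real n * \<alpha>)) * mode_b n (J ?v) = of_real (2 * cos (real m * \<alpha>)) * mode_b n (J ?v)"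
      "of_real (2 * cos (real n * \<alpha>)) * mode_c n (J ?v) = of_real (2 * cos (real m * \<alpha>)) * mode_c n (J ?v)"
      using arg_cong[OF e, of "mode_b n"] arg_cong[OF e, of "mode_c n"]
      unfolding mode_add translation_modes[OF T n(1)] mode_scaleR distrib_right[symmetric] cc by simp_all
    then show ?thesis using \<alpha> by (simp only: mult_cancel_right of_real_eq_iff) simp
  qed
  define jb where "jb b c = mode_b m (J (mode_vec m b c))" for b c
  define jc where "jc b c = mode_c m (J (mode_vec m b c))" for b c
  have J_eq: "J (mode_vec m b c) = mode_vec m (jb b c) (jc b c)" for b c
    by (rule phase_eqI) (use off in \<open>auto simp: mode_mode_vec[OF m] jb_def jc_def\<close>)
  \<comment> \<open>The quarter period of mode m, pi / (2 m), realises multiplication by i as a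
    translation.\<close>
  have i: "cis (real m * (pi / (2 * real m))) = \<i>" using m by (simp add: complex_eq_iff)
  have "J (mode_vec m (\<i> * b) (\<i> * c)) = mode_vec m (\<i> * jb b c) (\<i> * jc b c)" for b c
    using comm[of "pi / (2 * real m)" "mode_vec m b c"]
    unfolding J_eq[of b c] translation_mode_vec[OF T m] i .
  then have j_i: "jb (\<i> * b) (\<i> * c) = \<i> * jb b c" "jc (\<i> * b) (\<i> * c) = \<i> * jc b c" for b c
    unfolding J_eq mode_vec_inject[OF m] by auto
  have "J (mode_vec m (b + b') (c + c')) = mode_vec m (jb b c + jb b' c') (jc b c + jc b' c')" for b c b' c'
    unfolding mode_vec_add[OF m, symmetric] linear_add[OF J] J_eq ..
  then have j_add: "jb (b + b') (c + c') = jb b c + jb b' c'" "jc (b + b') (c + c') = jc b c + jc b' c'" for b c b' c'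
    unfolding J_eq mode_vec_inject[OF m] by auto
  have "J (mode_vec m (of_real s * b) (of_real s * c)) = mode_vec m (of_real s * jb b c) (of_real s * jc b c)" for s b c
    unfolding mode_vec_scaleR[OF m, symmetric] linear_scale[OF J] J_eq ..
  then have j_scale: "jb (of_real s * b) (of_real s * c) = of_real s * jb b c"
    "jc (of_real s * b) (of_real s * c) = of_real s * jc b c" for s b c
    unfolding J_eq mode_vec_inject[OF m] by auto
  have j_mult: "jb (z * b) (z * c) = z * jb b c" "jc (z * b) (z * c) = z * jc b c" for z b c
  proof -
    have z: "z * u = of_real (Re z) * u + of_real (Im z) * (\<i> * u)" for u
      by (simp add: complex_eq_iff)
    show "jb (z * b) (z * c) = z * jb b c" "jc (z * b) (z * c) = z * jc b c"
      unfolding z[of b] z[of c] z[of "jb b c"] z[of "jc b c"] j_add j_scale j_i by simp_all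
  qed
  have "jb b c = jb 1 0 * b + jb 0 1 * c" "jc b c = jc 1 0 * b + jc 0 1 * c" for b c
    using j_add[of "b * 1" "c * 0" "b * 0" "c * 1"] j_mult[of b 1 0] j_mult[of c 0 1] by (simp_all add: mult.commute)
  then show ?thesis using that[of "jb 1 0" "jb 0 1" "jc 1 0" "jc 0 1"] J_eq by metis
qed

lemma compatible_skew:
  assumes "compatible_complex_structure J"
  shows "Omega (J x) y = - Omega x (J y)"
proof -
  have "Omega (J x) y = Omega (J (J x)) (J y)"
    using assms unfolding compatible_complex_structure_def symplectic_def by metis
  also have "\<dots> = - Omega x (J y)"
  proof -
    have "J (J x) = - x" using assms unfolding compatible_complex_structure_def by blast
    then show ?thesis by (simp only: Omega_minus_left)
  qed
  finally show ?thesis .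
qed

lemma invariant_structure_mode_vec:
  assumes T: "\<And>\<alpha>. block_diagonal (T \<alpha>) (translation_block \<alpha>)"
    and invariant: "\<And>\<alpha>. inv (T \<alpha>) \<circ> J \<circ> T \<alpha> = J"
    and J: "compatible_complex_structure J" and m: "m \<ge> 1"
  obtains a q where "a > 0" "a\<^sup>2 = 1 + (norm q)\<^sup>2"
    "\<And>b c. J (mode_vec m b c) = mode_vec m (\<i> * of_real a * b + q * c) (cnj q * b - \<i> * of_real a * c)"
proof -
  have lin: "linear J" and sq: "J (J x) = - x" and pos: "x \<noteq> 0 \<Longrightarrow> Omega (J x) x > 0" for x
    using J unfolding compatible_complex_structure_def by blast+
  obtain p q r w where J_eq: "\<And>b c. J (mode_vec m b c) = mode_vec m (p * b + q * c) (r * b + w * c)"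
    using translation_invariant_mode_vec[OF T translations_commute[OF T invariant] lin m] by metis
  have skew: "Im (cnj (p * b + q * c) * b' - cnj (r * b + w * c) * c')
      = - Im (cnj b * (p * b' + q * c') - cnj c * (r * b' + w * c'))" for b c b' c'
    using compatible_skew[OF J, of "mode_vec m b c" "mode_vec m b' c'"]
    by (simp only: J_eq Omega_mode_vec_mode_vec[OF m m] if_True refl)
  \<comment> \<open>Testing skewness on coordinate vectors multiplied by 1 or i extracts the entries
    one by one: the diagonal is imaginary and the off-diagonal entries are conjugate.\<close>
  have "Re p = 0" using skew[of 1 0 \<i> 0] by simp
  have "Re w = 0" using skew[of 0 1 0 \<i>] by simp
  have "r = cnj q" using skew[of 1 0 0 1] skew[of 1 0 0 \<i>] by (simp add: complex_eq_iff)
  define a where "a = Im p"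
  define d where "d = Im w"
  have pa: "p = \<i> * of_real a" "w = \<i> * of_real d"
    using \<open>Re p = 0\<close> \<open>Re w = 0\<close> by (simp_all add: complex_eq_iff a_def d_def)
  have sq': "p * (p * b + q * c) + q * (r * b + w * c) = - b" "r * (p * b + q * c) + w * (r * b + w * c) = - c" for b c
    using sq[of "mode_vec m b c"] unfolding J_eq mode_vec_minus[OF m] mode_vec_inject[OF m] by auto
  have "p * p + q * r = - 1" "q * r + w * w = - 1"
    using sq'(1)[of 1 0] sq'(2)[of 0 1] by (simp_all add: mult.commute)
  moreover have qr: "q * r = of_real ((norm q)\<^sup>2)" unfolding \<open>r = cnj q\<close> complex_norm_square ..
  ultimately have "of_real ((norm q)\<^sup>2 - a * a) = (- 1 :: complex)" "of_real ((norm q)\<^sup>2 - d * d) = (- 1 :: complex)"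
    by (simp_all add: pa algebra_simps)
  then have "(norm q)\<^sup>2 - a * a = - 1" "(norm q)\<^sup>2 - d * d = - 1"
    by (metis of_real_1 of_real_eq_iff of_real_minus)+
  then have a2: "a\<^sup>2 = 1 + (norm q)\<^sup>2" and ad: "a * a = d * d" by (simp_all add: power2_eq_square)
  have ne: "mode_vec m 1 0 \<noteq> 0" "mode_vec m 0 1 \<noteq> 0"
    using mode_mode_vec[OF m m, of 1 0] mode_mode_vec[OF m m, of 0 1] mode_0 by auto
  \<comment> \<open>The square of \<open>J\<close> determines the diagonal entries only up to sign.
    Positivity on (1, 0) and (0, 1) forces opposite signs, because the Hermitian form is positive in
    b and negative in c.\<close>
  have "a > 0" using pos[OF ne(1)] by (simp add: J_eq Omega_mode_vec_mode_vec[OF m m] a_def)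
  moreover have "d < 0" using pos[OF ne(2)] by (simp add: J_eq Omega_mode_vec_mode_vec[OF m m] d_def)
  ultimately have "d = - a" using ad by (metis less_asym neg_less_0_iff_less square_eq_iff minus_minus)
  with J_eq pa \<open>r = cnj q\<close> have "J (mode_vec m b c) = mode_vec m (\<i> * of_real a * b + q * c) (cnj q * b - \<i> * of_real a * c)" for b c
    by simp
  with \<open>a > 0\<close> a2 that show ?thesis by blast
qed

section \<open>Equivalence with the reference structure\<close>

lemma Re_inner_J: "Re (inner_J J x y) = Omega (J x) y / 2"
  by (simp add: inner_J_def)

text \<open>A real orthonormal basis of the pairs (b, c) for the \<open>J0\<close> inner product:
  each mode has four real dimensions.\<close>

definition unit_modes :: "(complex \<times> complex) set" where
  "unit_modes = {(1, 0), (\<i>, 0), (0, 1), (0, \<i>)}"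

definition basis_index :: "(nat \<times> complex \<times> complex) set" where
  "basis_index = {1..} \<times> unit_modes"

definition basis_vec :: "nat \<times> complex \<times> complex \<Rightarrow> phase" where
  "basis_vec = (\<lambda>(m, b, c). mode_vec m b c)"

lemma reference_inner_mode_vec:
  assumes J0: "block_diagonal J0 reference_block" and \<iota>: "is_completion J0 \<iota>" and m: "m \<ge> 1"
  shows "\<iota> x \<bullet> \<iota> (mode_vec m b c) = Re (cnj (mode_b m x) * b + cnj (mode_c m x) * c)"
proof -
  have "\<iota> x \<bullet> \<iota> (mode_vec m b c) = Omega (J0 x) (mode_vec m b c) / 2"
    using \<iota> unfolding is_completion_def by (metis Re_inner_J)
  then show ?thesis by (simp add: Omega_mode_vec[OF m] reference_modes[OF J0 m])
qed

lemma unit_modes_inner: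
  assumes "(b, c) \<in> unit_modes" "(b', c') \<in> unit_modes"
  shows "Re (cnj b * b' + cnj c * c') = (if (b, c) = (b', c') then 1 else 0)"
proof -
  have "(b = 1 \<and> c = 0) \<or> (b = \<i> \<and> c = 0) \<or> (b = 0 \<and> c = 1) \<or> (b = 0 \<and> c = \<i>)"
    "(b' = 1 \<and> c' = 0) \<or> (b' = \<i> \<and> c' = 0) \<or> (b' = 0 \<and> c' = 1) \<or> (b' = 0 \<and> c' = \<i>)"
    using assms by (simp_all add: unit_modes_def)
  then show ?thesis by (elim disjE conjE) simp_all
qed

lemma basis_vec_inner:
  assumes J0: "block_diagonal J0 reference_block" and \<iota>: "is_completion J0 \<iota>"
    and k: "k \<in> basis_index" "l \<in> basis_index"
  shows "\<iota> (basis_vec k) \<bullet> \<iota> (basis_vec l) = (if k = l then 1 else 0)"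
proof -
  obtain m b c n b' c' where kl: "k = (m, b, c)" "l = (n, b', c')" by (cases k, cases l) blast
  have m: "m \<ge> 1" "n \<ge> 1" and u: "(b, c) \<in> unit_modes" "(b', c') \<in> unit_modes"
    using k by (auto simp: kl basis_index_def)
  have "\<iota> (basis_vec k) \<bullet> \<iota> (basis_vec l) = (if n = m then Re (cnj b * b' + cnj c * c') else 0)"
    by (simp add: kl basis_vec_def reference_inner_mode_vec[OF J0 \<iota> m(2)] mode_mode_vec[OF m])
  also have "\<dots> = (if k = l then 1 else 0)"
    unfolding unit_modes_inner[OF u] by (auto simp: kl)
  finally show ?thesis .
qed

lemma mode_vec_in_span:
  assumes "m \<ge> 1"
  shows "mode_vec m b c \<in> span (basis_vec ` basis_index)"
proof -
  have in_span: "mode_vec m x y \<in> span (basis_vec ` basis_index)" if "(x, y) \<in> unit_modes" for x y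
  proof -
    have "basis_vec (m, x, y) \<in> basis_vec ` basis_index"
      using assms that by (intro imageI) (simp add: basis_index_def)
    then show ?thesis by (simp add: basis_vec_def span_base)
  qed
  have "mode_vec m b c = Re b *\<^sub>R mode_vec m 1 0 + Im b *\<^sub>R mode_vec m \<i> 0
      + Re c *\<^sub>R mode_vec m 0 1 + Im c *\<^sub>R mode_vec m 0 \<i>"
    unfolding mode_vec_scaleR[OF assms] mode_vec_add[OF assms]
    by (intro arg_cong2[where f = "mode_vec m"]) (simp_all add: complex_eq_iff)
  also have "\<dots> \<in> span (basis_vec ` basis_index)"
    by (intro span_add span_scale in_span) (simp_all add: unit_modes_def)
  finally show ?thesis .
qed

text \<open>Totality is the analytic part: the truncations of x converge to x in the completion, and
  each is a finite combination of basis vectors.\<close>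

lemma basis_orthonormal_basis:
  assumes J0: "block_diagonal J0 reference_block" and \<iota>: "is_completion J0 \<iota>"
  shows "orthonormal_basis (\<iota> ` basis_vec ` basis_index)" "inj_on (\<lambda>k. \<iota> (basis_vec k)) basis_index"
proof -
  note inner = basis_vec_inner[OF J0 \<iota>]
  have lin: "linear \<iota>" and dense: "closure (range \<iota>) = UNIV"
    and inner_\<iota>: "\<And>x y. \<iota> x \<bullet> \<iota> y = Omega (J0 x) y / 2"
    using \<iota> unfolding is_completion_def Re_inner_J by blast+
  show inj: "inj_on (\<lambda>k. \<iota> (basis_vec k)) basis_index"
    by (rule inj_onI) (metis inner zero_neq_one)
  let ?E = "\<iota> ` basis_vec ` basis_index"
  have "\<iota> x \<in> closure (span ?E)" for x
  proof -
    have "(\<lambda>N. \<iota> (x - trunc N x) \<bullet> \<iota> (x - trunc N x)) \<longlonglongrightarrow> 0 / 2"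
    proof -
      \<comment> \<open>\<open>J0\<close> commutes with truncation, so the squared norm of the
        remainder has the form treated in \<open>Omega_trunc_tendsto_0\<close>.\<close>
      have "J0 (x - trunc N x) = J0 x - trunc N (J0 x)" for N
      proof -
        have "trunc N (J0 x) = (\<Sum>m=1..N. J0 (mode_vec m (mode_b m x) (mode_c m x)))"
          unfolding trunc_def
          by (intro sum.cong refl) (simp add: reference_mode_vec[OF J0] reference_modes[OF J0])
        also have "\<dots> = J0 (trunc N x)"
          using J0 by (simp add: trunc_def block_diagonal_def linear_sum)
        finally show ?thesis using J0 by (simp add: block_diagonal_def linear_diff)
      qed
      then show ?thesis unfolding inner_\<iota> by (intro tendsto_divide) (simp_all add: Omega_trunc_tendsto_0)
    qed
    then have "(\<lambda>N. (norm (\<iota> x - \<iota> (trunc N x)))\<^sup>2) \<longlonglongrightarrow> 0"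
      by (simp add: power2_norm_eq_inner linear_diff[OF lin])
    then have "(\<lambda>N. norm (\<iota> x - \<iota> (trunc N x))) \<longlonglongrightarrow> 0" by simp
    then have "(\<lambda>N. norm (\<iota> (trunc N x) - \<iota> x)) \<longlonglongrightarrow> 0" by (simp add: norm_minus_commute)
    then have "(\<lambda>N. \<iota> (trunc N x)) \<longlonglongrightarrow> \<iota> x" by (simp add: LIM_zero_iff tendsto_norm_zero_iff)
    moreover have "\<iota> (trunc N x) \<in> span ?E" for N
    proof -
      have "trunc N x \<in> span (basis_vec ` basis_index)"
        unfolding trunc_def by (intro span_sum mode_vec_in_span) simp
      then show ?thesis by (simp add: linear_span_image[OF lin])
    qed
    ultimately show ?thesis
      unfolding closure_sequential by (intro exI[of _ "\<lambda>N. \<iota> (trunc N x)"]) simp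
  qed
  then have "closure (range \<iota>) \<subseteq> closure (span ?E)"
    by (intro closure_minimal) auto
  then have "closure (span ?E) = UNIV" using dense by auto
  moreover have "pairwise orthogonal ?E"
    unfolding pairwise_def orthogonal_def using inner by auto
  moreover have "norm e = 1" if "e \<in> ?E" for e
    using that inner by (auto simp: norm_eq_1)
  ultimately show "orthonormal_basis ?E" unfolding orthonormal_basis_def by blast
qed

text \<open>On each of the four basis vectors of mode m, the difference of the structures has
  squared norm (a - 1)^2 + |q|^2, and a^2 = 1 + |q|^2 bounds this by 2 |q|^2.\<close>

lemma fock_equivalent_if_summable:
  fixes \<iota> :: "phase \<Rightarrow> 'k::{real_inner,complete_space}"
  assumes J0: "block_diagonal J0 reference_block" and \<iota>: "is_completion J0 \<iota>"
    and J: "compatible_complex_structure J"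
    and block: "\<And>m b c. m \<ge> 1 \<Longrightarrow> J (mode_vec m b c)
       = mode_vec m (\<i> * of_real (a m) * b + q m * c) (cnj (q m) * b - \<i> * of_real (a m) * c)"
    and a: "\<And>m. m \<ge> 1 \<Longrightarrow> a m > 0" "\<And>m. m \<ge> 1 \<Longrightarrow> (a m)\<^sup>2 = 1 + (norm (q m))\<^sup>2"
    and q: "summable (\<lambda>m. (norm (q (Suc m)))\<^sup>2)"
  shows "fock_equivalent J J0 \<iota>"
  unfolding fock_equivalent_def
\<comment> \<open>For the inner product Omega (J0 x) y / 2, skewness for \<open>Omega\<close> makes
  J0 J J0 the adjoint of \<open>J\<close> and - J0 the adjoint of \<open>J0\<close>; this gives the
  witness for A'.\<close>
proof (rule extends_to_hilbert_schmidt_if_adjoint[where X = "basis_vec ` basis_index" and A' = "\<lambda>y. J0 (J (J0 y)) + J0 y"])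
  note inj = basis_orthonormal_basis(2)[OF J0 \<iota>]
  show "orthonormal_basis (\<iota> ` basis_vec ` basis_index)" by (rule basis_orthonormal_basis[OF J0 \<iota>])
  show "inj_on \<iota> (basis_vec ` basis_index)" using inj by (auto simp: inj_on_def)
  have inner_\<iota>: "\<And>x y. \<iota> x \<bullet> \<iota> y = Omega (J0 x) y / 2"
    using \<iota> unfolding is_completion_def Re_inner_J by blast
  have skew0: "Omega (J0 x) (mode_vec m b c) = - Omega x (J0 (mode_vec m b c))" if "m \<ge> 1" for x m b c
    by (simp add: Omega_mode_vec[OF that] reference_modes[OF J0 that] reference_mode_vec[OF J0 that])
  have inv0: "Omega (J0 x) (J0 (mode_vec m b c)) = Omega x (mode_vec m b c)" if "m \<ge> 1" for x m b c
    by (simp add: reference_mode_vec[OF J0 that] skew0[OF that])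
      (simp add: mode_vec_minus[OF that, symmetric] Omega_minus_right)
  have J0_lin: "linear J0" using J0 by (simp add: block_diagonal_def)
  have J0_J0: "J0 (J0 x) = - x" for x
    by (rule phase_eqI) (simp_all add: reference_modes[OF J0] mode_minus)
  show "\<iota> (J x - J0 x) \<bullet> \<iota> y = \<iota> x \<bullet> \<iota> (J0 (J (J0 y)) + J0 y)" if y_in: "y \<in> basis_vec ` basis_index" for x y
  proof -
    obtain m b c where m: "m \<ge> 1" and y: "y = mode_vec m b c"
      using y_in by (auto simp: basis_vec_def basis_index_def)
    \<comment> \<open>The vector J (J0 y) again consists of the single mode m, so
      \<open>inv0\<close> applies to it while x stays arbitrary.\<close>
    obtain b1 c1 where y1: "J (J0 y) = mode_vec m b1 c1"
      using block[OF m] by (metis y reference_mode_vec[OF J0 m])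
    have "Omega (J0 (J x - J0 x)) y = - Omega (J x) (J0 y) + Omega x y"
      by (simp add: linear_diff[OF J0_lin] J0_J0 Omega_diff_left linear_add[OF linear_Omega_left] Omega_minus_left y skew0[OF m])
    also have "- Omega (J x) (J0 y) = Omega x (J (J0 y))" using compatible_skew[OF J] by simp
    also have "Omega x (J (J0 y)) = Omega (J0 x) (J0 (J (J0 y)))"
      by (simp only: y1 inv0[OF m])
    also have "Omega x y = Omega (J0 x) (J0 y)" by (simp only: y inv0[OF m])
    finally show ?thesis by (simp add: inner_\<iota> Omega_add_right)
  qed
  define g where "g m = (a m - 1)\<^sup>2 + (norm (q m))\<^sup>2" for m
  have norm_A: "(norm (\<iota> (J x - J0 x)))\<^sup>2 = g m" if x: "x = mode_vec m b c" "(b, c) \<in> unit_modes" and m: "m \<ge> 1" for x m b c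
  proof -
    have "J x - J0 x = mode_vec m (\<i> * of_real (a m - 1) * b + q m * c) (cnj (q m) * b - \<i> * of_real (a m - 1) * c)"
      unfolding x block[OF m] reference_mode_vec[OF J0 m] mode_vec_diff[OF m]
      by (intro arg_cong2[where f = "mode_vec m"]) (simp_all add: algebra_simps)
    moreover have "\<iota> (mode_vec m u v) \<bullet> \<iota> (mode_vec m u v) = (norm u)\<^sup>2 + (norm v)\<^sup>2" for u v
      unfolding cmod_power2
      by (simp add: reference_inner_mode_vec[OF J0 \<iota> m] mode_mode_vec[OF m m] power2_eq_square)
    ultimately have "(norm (\<iota> (J x - J0 x)))\<^sup>2 = (norm (\<i> * of_real (a m - 1) * b + q m * c))\<^sup>2
       + (norm (cnj (q m) * b - \<i> * of_real (a m - 1) * c))\<^sup>2"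
      by (simp add: power2_norm_eq_inner)
    also have "\<dots> = g m" using x(2) by (auto simp: unit_modes_def g_def norm_mult simp del: of_real_diff)
    finally show ?thesis .
  qed
  have g_le: "g m \<le> 2 * (norm (q m))\<^sup>2" if "m \<ge> 1" for m
  proof -
    have "1\<^sup>2 \<le> (a m)\<^sup>2" using a(2)[OF that] by simp
    then have "1 \<le> a m" by (rule power2_le_imp_le) (use a(1)[OF that] in simp)
    \<comment> \<open>As a >= 1, (a - 1)^2 <= (a - 1) (a + 1) = a^2 - 1 = |q|^2.\<close>
    then have "(a m - 1) * (a m - 1) \<le> (a m - 1) * (a m + 1)" by (intro mult_left_mono) auto
    also have "\<dots> = (norm (q m))\<^sup>2" using a(2)[OF that] by (simp add: algebra_simps power2_eq_square)
    finally show ?thesis by (simp add: g_def power2_eq_square)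
  qed
  have "summable (\<lambda>m. g (Suc m))"
    by (rule summable_comparison_test'[OF summable_mult[OF q, of 2], of 0]) (use g_le in \<open>simp add: g_def\<close>)
  then have "(\<lambda>m. g (Suc m)) summable_on UNIV"
    by (subst summable_on_UNIV_nonneg_real_iff) (simp_all add: g_def)
  moreover have "bij_betw Suc UNIV {1..}"
    by (rule bij_betwI[where g = "\<lambda>m. m - 1"]) auto
  ultimately have g_sum: "g summable_on {1..}"
    using summable_on_reindex_bij_betw by blast
  have "(\<lambda>k. (norm (\<iota> (J (basis_vec k) - J0 (basis_vec k))))\<^sup>2) summable_on basis_index"
    unfolding basis_index_def
  proof (rule summable_on_SigmaI[where g = "\<lambda>m. of_nat (card unit_modes) * g m"])
    fix m :: nat assume m: "m \<in> {1..}"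
    have "(norm (\<iota> (J (basis_vec (m, u)) - J0 (basis_vec (m, u)))))\<^sup>2 = g m" if "u \<in> unit_modes" for u
      using that m by (cases u) (simp add: basis_vec_def norm_A)
    then show "((\<lambda>u. (norm (\<iota> (J (basis_vec (m, u)) - J0 (basis_vec (m, u)))))\<^sup>2) has_sum of_nat (card unit_modes) * g m) unit_modes"
      by (intro has_sum_finiteI) (simp_all add: unit_modes_def)
  next
    show "(\<lambda>m. of_nat (card unit_modes) * g m) summable_on {1..}"
      by (intro summable_on_cmult_right g_sum)
  qed simp
  moreover have "inj_on basis_vec basis_index" using inj by (auto simp: inj_on_def)
  ultimately show "(\<lambda>x. (norm (\<iota> (J x - J0 x)))\<^sup>2) summable_on basis_vec ` basis_index"
    by (simp add: summable_on_reindex o_def)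
qed

section \<open>Implementability of the dynamics\<close>

text \<open>\<open>J\<close> and U are complex linear in (b, c) on each mode, so on the eigenvector
  f for i the operator (U + J U J) / 2 returns the part of U f in the eigenspace for - i, spanned by
  g. The number h is the indefinite Hermitian form of U f and g, whose modulus is that of the
  component.\<close>

lemma implementable_coeffs_summable:
  fixes \<iota> :: "phase \<Rightarrow> 'h::{real_inner,complete_space}" and f1 f2 :: "nat \<Rightarrow> complex"
  assumes J: "compatible_complex_structure J" and \<iota>: "is_completion J \<iota>"
    and U: "block_diagonal U (gowdy_block t t0)"
    and impl: "unitarily_implementable J \<iota> U"
    and norm: "\<And>m. m \<ge> 1 \<Longrightarrow> (norm (f1 m))\<^sup>2 - (norm (f2 m))\<^sup>2 = 1"
    and Jf: "\<And>m. m \<ge> 1 \<Longrightarrow> J (mode_vec m (f1 m) (f2 m)) = mode_vec m (\<i> * f1 m) (\<i> * f2 m)"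
    and Jg: "\<And>m. m \<ge> 1 \<Longrightarrow> J (mode_vec m (cnj (f2 m)) (cnj (f1 m))) = mode_vec m (- \<i> * cnj (f2 m)) (- \<i> * cnj (f1 m))"
  defines "h \<equiv> \<lambda>m. cnj (gowdy_alpha m t t0 * f1 m + gowdy_beta m t t0 * f2 m) * cnj (f2 m)
      - cnj (cnj (gowdy_beta m t t0) * f1 m + cnj (gowdy_alpha m t t0) * f2 m) * cnj (f1 m)"
  shows "(\<lambda>m. (norm (h m))\<^sup>2) summable_on {1..}"
proof -
  have lin: "linear J" and sq: "\<And>x. J (J x) = - x" and symp: "\<And>x y. Omega (J x) (J y) = Omega x y"
    using J unfolding compatible_complex_structure_def symplectic_def by blast+
  have inner_\<iota>: "\<iota> x \<bullet> \<iota> y = Omega (J x) y / 2" for x y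
    using \<iota> unfolding is_completion_def Re_inner_J by blast
  define f where "f m = mode_vec m (f1 m) (f2 m)" for m
  define g where "g m = mode_vec m (cnj (f2 m)) (cnj (f1 m))" for m
  \<comment> \<open>The inner product of the completion is real and g alone detects only the real
    part of h; its partner g' = - J g detects the imaginary part.\<close>
  define g' where "g' m = mode_vec m (\<i> * cnj (f2 m)) (\<i> * cnj (f1 m))" for m
  have Jg': "J (g' m) = g m" if "m \<ge> 1" for m
  proof -
    have "g' m = - J (g m)" by (simp add: g_def g'_def Jg[OF that] mode_vec_minus[OF that])
    then show ?thesis by (simp add: linear_neg[OF lin] sq)
  qed
  have norm': "f1 m * cnj (f1 m) - f2 m * cnj (f2 m) = 1" if "m \<ge> 1" for m
  proof -
    have "complex_of_real ((norm (f1 m))\<^sup>2 - (norm (f2 m))\<^sup>2) = 1" using norm[OF that] by simp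
    then show ?thesis by (simp only: of_real_diff complex_norm_square)
  qed
  have ortho: "\<iota> (f m) \<bullet> \<iota> (f n) = (if m = n then 1 else 0)" "\<iota> (g m) \<bullet> \<iota> (g n) = (if m = n then 1 else 0)"
    "\<iota> (g' m) \<bullet> \<iota> (g' n) = (if m = n then 1 else 0)" if m: "m \<in> {1..}" and n: "n \<in> {1..}" for m n :: nat
  proof -
    have mn: "m \<ge> 1" "n \<ge> 1" using m n by auto
    have e: "cnj (\<i> * f1 m) * f1 m - cnj (\<i> * f2 m) * f2 m = - \<i> * (f1 m * cnj (f1 m) - f2 m * cnj (f2 m))"
      "cnj (- \<i> * cnj (f2 m)) * cnj (f2 m) - cnj (- \<i> * cnj (f1 m)) * cnj (f1 m) = - \<i> * (f1 m * cnj (f1 m) - f2 m * cnj (f2 m))"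
      "cnj (cnj (f2 m)) * (\<i> * cnj (f2 m)) - cnj (cnj (f1 m)) * (\<i> * cnj (f1 m)) = - \<i> * (f1 m * cnj (f1 m) - f2 m * cnj (f2 m))"
      by (simp_all add: algebra_simps)
    show "\<iota> (f m) \<bullet> \<iota> (f n) = (if m = n then 1 else 0)"
      unfolding inner_\<iota> f_def Jf[OF mn(1)] Omega_mode_vec_mode_vec[OF mn] using e(1) norm'[OF mn(1)]
      by (cases "m = n") (simp_all only: if_True if_False, simp_all)
    show "\<iota> (g m) \<bullet> \<iota> (g n) = (if m = n then 1 else 0)"
      unfolding inner_\<iota> g_def Jg[OF mn(1)] Omega_mode_vec_mode_vec[OF mn] using e(2) norm'[OF mn(1)]
      by (cases "m = n") (simp_all only: if_True if_False, simp_all)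
    show "\<iota> (g' m) \<bullet> \<iota> (g' n) = (if m = n then 1 else 0)"
      unfolding inner_\<iota> Jg'[OF mn(1)] unfolding g'_def g_def Omega_mode_vec_mode_vec[OF mn] using e(3) norm'[OF mn(1)]
      by (cases "m = n") (simp_all only: if_True if_False, simp_all)
  qed
  obtain S where S: "hilbert_schmidt S" "\<And>x. S (\<iota> x) = \<iota> (antilinear_part J U x)"
    using impl unfolding unitarily_implementable_def extends_to_hilbert_schmidt_def by blast
  have halves: "- ((A + B) / 2) / 2 = - (A + B) / 4" for A B :: real by (simp add: field_simps)
  have coeff: "S (\<iota> x) \<bullet> \<iota> y = - (Omega (U x) (J y) + Omega (U (J x)) y) / 4" for x y
  proof -
    have "S (\<iota> x) \<bullet> \<iota> y = Omega (J ((1 / 2) *\<^sub>R (U x + J (U (J x))))) y / 2"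
      by (simp only: S(2) inner_\<iota> antilinear_part_def)
    also have "\<dots> = - Omega ((1 / 2) *\<^sub>R (U x + J (U (J x)))) (J y) / 2"
      by (simp only: compatible_skew[OF J])
    also have "Omega ((1 / 2) *\<^sub>R (U x + J (U (J x)))) (J y) = (Omega (U x) (J y) + Omega (U (J x)) y) / 2"
      using linear_scale[OF linear_Omega_left] linear_add[OF linear_Omega_left] symp by simp
    finally show ?thesis by (simp only: halves)
  qed
  have U_f: "U (f m) = mode_vec m (gowdy_alpha m t t0 * f1 m + gowdy_beta m t t0 * f2 m)
      (cnj (gowdy_beta m t t0) * f1 m + cnj (gowdy_alpha m t t0) * f2 m)" if "m \<ge> 1" for m
    unfolding f_def by (rule gowdy_mode_vec[OF U that])
  have U_Jf: "U (J (f m)) = mode_vec m (\<i> * (gowdy_alpha m t t0 * f1 m + gowdy_beta m t t0 * f2 m))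
      (\<i> * (cnj (gowdy_beta m t t0) * f1 m + cnj (gowdy_alpha m t t0) * f2 m))" if "m \<ge> 1" for m
    unfolding f_def Jf[OF that] gowdy_mode_vec[OF U that]
    by (intro arg_cong2[where f = "mode_vec m"]) (simp_all add: algebra_simps)
  have alg: "cnj u1 * (- \<i> * x1) - cnj u2 * (- \<i> * x2) = - \<i> * (cnj u1 * x1 - cnj u2 * x2)"
    "cnj (\<i> * u1) * x1 - cnj (\<i> * u2) * x2 = - \<i> * (cnj u1 * x1 - cnj u2 * x2)"
    "cnj (\<i> * u1) * (\<i> * x1) - cnj (\<i> * u2) * (\<i> * x2) = cnj u1 * x1 - cnj u2 * x2" for u1 u2 x1 x2 :: complex
    by (simp_all add: algebra_simps)
  have vals: "S (\<iota> (f m)) \<bullet> \<iota> (g m) = - Re (h m)" "S (\<iota> (f m)) \<bullet> \<iota> (g' m) = Im (h m)" if "m \<in> {1..}" for m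
  proof -
    have m: "m \<ge> 1" using that by simp
    show "S (\<iota> (f m)) \<bullet> \<iota> (g m) = - Re (h m)"
      unfolding coeff U_f[OF m] U_Jf[OF m] unfolding g_def Jg[OF m] Omega_mode_vec_mode_vec[OF m m] alg h_def by simp
    show "S (\<iota> (f m)) \<bullet> \<iota> (g' m) = Im (h m)"
      unfolding coeff U_f[OF m] U_Jf[OF m] Jg'[OF m] unfolding g_def g'_def Omega_mode_vec_mode_vec[OF m m] alg h_def by simp
  qed
  have sums: "(\<lambda>m. (S (\<iota> (f m)) \<bullet> \<iota> (g m))\<^sup>2) summable_on {1..}" "(\<lambda>m. (S (\<iota> (f m)) \<bullet> \<iota> (g' m))\<^sup>2) summable_on {1..}"
    using hilbert_schmidt_orthonormal_coeffs_summable[OF S(1), of "{1..}" "\<lambda>m. \<iota> (f m)" "\<lambda>m. \<iota> (g m)"]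
      hilbert_schmidt_orthonormal_coeffs_summable[OF S(1), of "{1..}" "\<lambda>m. \<iota> (f m)" "\<lambda>m. \<iota> (g' m)"] ortho by blast+
  have "(\<lambda>m. (Re (h m))\<^sup>2) summable_on {1..}"
    using sums(1) by (rule summable_on_cong[THEN iffD1, rotated]) (simp add: vals)
  moreover have "(\<lambda>m. (Im (h m))\<^sup>2) summable_on {1..}"
    using sums(2) by (rule summable_on_cong[THEN iffD1, rotated]) (simp add: vals)
  ultimately have "(\<lambda>m. (Re (h m))\<^sup>2 + (Im (h m))\<^sup>2) summable_on {1..}" by (rule summable_on_add)
  then show ?thesis by (simp add: cmod_power2)
qed

lemma invariant_structure_coeffs_summable:
  fixes \<iota> :: "phase \<Rightarrow> 'h::{real_inner,complete_space}" and a :: "nat \<Rightarrow> real" and q :: "nat \<Rightarrow> complex"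
  assumes J: "compatible_complex_structure J" and \<iota>: "is_completion J \<iota>"
    and U: "\<And>t t0. t > 0 \<Longrightarrow> t0 > 0 \<Longrightarrow> block_diagonal (U t t0) (gowdy_block t t0)"
    and impl: "\<And>t t0. t > 0 \<Longrightarrow> t0 > 0 \<Longrightarrow> unitarily_implementable J \<iota> (U t t0)"
    and block: "\<And>m b c. m \<ge> 1 \<Longrightarrow> J (mode_vec m b c)
       = mode_vec m (\<i> * of_real (a m) * b + q m * c) (cnj (q m) * b - \<i> * of_real (a m) * c)"
    and a: "\<And>m. m \<ge> 1 \<Longrightarrow> a m > 0" "\<And>m. m \<ge> 1 \<Longrightarrow> (a m)\<^sup>2 = 1 + (norm (q m))\<^sup>2"
  shows "summable (\<lambda>m. (norm (q (Suc m)))\<^sup>2)"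
proof -
  \<comment> \<open>The condition J (1, s) = i (1, s) requires q s = i (1 - a). By |q|^2 = (a - 1)
    (a + 1) this formula solves it, without division by q, which may vanish.\<close>
  define s where "s m = - \<i> * cnj (q m) / of_real (1 + a m)" for m
  have s_q: "cnj (q m) = \<i> * of_real (1 + a m) * s m" if "m \<ge> 1" for m
  proof -
    have "complex_of_real (1 + a m) \<noteq> 0" using a(1)[OF that] by (simp only: of_real_eq_0_iff)
    then show ?thesis by (simp add: s_def)
  qed
  have q_s: "q m = - \<i> * of_real (1 + a m) * cnj (s m)" if "m \<ge> 1" for m
    using arg_cong[OF s_q[OF that], of cnj] by simp
  have norm_q: "norm (q m) = (1 + a m) * norm (s m)" if "m \<ge> 1" for m
    using a(1)[OF that] unfolding q_s[OF that] by (simp add: norm_mult del: of_real_add)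
  have s2: "(1 + a m) * (norm (s m))\<^sup>2 = a m - 1" if "m \<ge> 1" for m
  proof -
    have "(1 + a m) * ((1 + a m) * (norm (s m))\<^sup>2) = (1 + a m) * (a m - 1)"
      using a(2)[OF that] unfolding norm_q[OF that] by (simp add: power2_eq_square algebra_simps)
    then show ?thesis using a(1)[OF that] by simp
  qed
  have s_lt: "(norm (s m))\<^sup>2 < 1" if "m \<ge> 1" for m
  proof (rule ccontr)
    assume "\<not> ?thesis"
    then have "(1 + a m) * 1 \<le> (1 + a m) * (norm (s m))\<^sup>2" using a(1)[OF that] by (intro mult_left_mono) auto
    then show False using s2[OF that] by simp
  qed
  have s_le: "norm (s m) \<le> 1" if "m \<ge> 1" for m
    using abs_square_le_1[of "norm (s m)"] s_lt[OF that] by simp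
  \<comment> \<open>Normalises (1, s) to |f1|^2 - |f2|^2 = 1. That k^2 >= 1 is the factor discarded
    later on.\<close>
  define k where "k m = 1 / sqrt (1 - (norm (s m))\<^sup>2)" for m
  have k: "(k m)\<^sup>2 * (1 - (norm (s m))\<^sup>2) = 1" "(k m)\<^sup>2 \<ge> 1" if "m \<ge> 1" for m
    using s_lt[OF that] by (simp_all add: k_def power_divide)
  define f1 f2 where "f1 m = complex_of_real (k m)" and "f2 m = of_real (k m) * s m" for m
  have qs: "q m * s m = \<i> * (1 - of_real (a m))" if "m \<ge> 1" for m
  proof -
    have "q m * s m = - \<i> * of_real (1 + a m) * (s m * cnj (s m))"
      unfolding q_s[OF that] by simp
    also have "\<dots> = - \<i> * of_real ((1 + a m) * (norm (s m))\<^sup>2)"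
      unfolding complex_norm_square[symmetric] by simp
    finally show ?thesis unfolding s2[OF that] by (simp add: algebra_simps)
  qed
  have cqs: "cnj (q m) * cnj (s m) = - \<i> * (1 - of_real (a m))" if "m \<ge> 1" for m
    using arg_cong[OF qs[OF that], of cnj] by simp
  have Jf: "J (mode_vec m (f1 m) (f2 m)) = mode_vec m (\<i> * f1 m) (\<i> * f2 m)" if m: "m \<ge> 1" for m
  proof -
    have "\<i> * of_real (a m) * f1 m + q m * f2 m = of_real (k m) * (\<i> * of_real (a m) + q m * s m)"
      by (simp add: f1_def f2_def algebra_simps)
    moreover have "cnj (q m) * f1 m - \<i> * of_real (a m) * f2 m = of_real (k m) * (cnj (q m) - \<i> * of_real (a m) * s m)"
      by (simp add: f1_def f2_def algebra_simps)
    ultimately show ?thesis unfolding block[OF m]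
      by (simp add: qs[OF m] s_q[OF m] f1_def f2_def algebra_simps)
  qed
  have Jg: "J (mode_vec m (cnj (f2 m)) (cnj (f1 m))) = mode_vec m (- \<i> * cnj (f2 m)) (- \<i> * cnj (f1 m))" if m: "m \<ge> 1" for m
  proof -
    have B: "\<i> * of_real (a m) * cnj (s m) + q m = - \<i> * cnj (s m)"
      unfolding q_s[OF m] by (simp add: algebra_simps)
    have C: "cnj (q m) * cnj (s m) - \<i> * of_real (a m) = - \<i>"
      unfolding cqs[OF m] by (simp add: algebra_simps)
    have "\<i> * of_real (a m) * cnj (f2 m) + q m * cnj (f1 m) = of_real (k m) * (\<i> * of_real (a m) * cnj (s m) + q m)"
      by (simp add: f1_def f2_def algebra_simps)
    moreover have "cnj (q m) * cnj (f2 m) - \<i> * of_real (a m) * cnj (f1 m) = of_real (k m) * (cnj (q m) * cnj (s m) - \<i> * of_real (a m))"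
      by (simp add: f1_def f2_def algebra_simps)
    ultimately show ?thesis unfolding block[OF m]
      by (simp only: B C) (simp add: f1_def f2_def mult_ac)
  qed
  have norm: "(norm (f1 m))\<^sup>2 - (norm (f2 m))\<^sup>2 = 1" if "m \<ge> 1" for m
    using k(1)[OF that] by (simp add: f1_def f2_def norm_mult power_mult_distrib algebra_simps)
  \<comment> \<open>Modes start at 1; index 0 gets a harmless value so that the series may run over
    all naturals.\<close>
  define w where "w m = (if m = 0 then 0 else (norm (s m))\<^sup>2)" for m
  have "summable (\<lambda>m. w m * (sin (real m * \<tau>))\<^sup>2)" for \<tau>
  proof -
    \<comment> \<open>The initial time is 1 and the final time 1 + |\<tau>|: both are positive, and
      since the squared sine is even this covers negative \<tau> as well.\<close>
    let ?t = "1 + \<bar>\<tau>\<bar>"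
    have t: "?t > 0" "(1::real) > 0" by simp_all
    let ?\<alpha> = "\<lambda>m. gowdy_alpha m ?t 1" and ?\<beta> = "\<lambda>m. gowdy_beta m ?t 1"
    define h where "h m = cnj (?\<alpha> m * f1 m + ?\<beta> m * f2 m) * cnj (f2 m)
      - cnj (cnj (?\<beta> m) * f1 m + cnj (?\<alpha> m) * f2 m) * cnj (f1 m)" for m
    have "(\<lambda>m. (norm (h m))\<^sup>2) summable_on {1..}"
      unfolding h_def by (rule implementable_coeffs_summable[OF J \<iota> U[OF t] impl[OF t] norm Jf Jg])
    moreover have "bij_betw Suc UNIV {1..}"
      by (rule bij_betwI[where g = "\<lambda>m. m - 1"]) auto
    ultimately have "(\<lambda>m. (norm (h (Suc m)))\<^sup>2) summable_on UNIV"
      using summable_on_reindex_bij_betw[of Suc UNIV "{1..}" "\<lambda>m. (norm (h m))\<^sup>2"] by blast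
    then have h_sum: "summable (\<lambda>m. (norm (h (Suc m)))\<^sup>2)" by (rule summable_on_imp_summable)
    obtain C where C: "\<And>m::nat. m \<ge> 1 \<Longrightarrow> norm (?\<beta> m) \<le> C / m"
      "\<And>m::nat. m \<ge> 1 \<Longrightarrow> \<bar>Im (?\<alpha> m) + sin (m * (?t - 1))\<bar> \<le> C / m"
      using gowdy_alpha_beta_asymptotics[OF t] by metis
    have bound: "w m * (sin (real m * \<tau>))\<^sup>2 \<le> 2 * (norm (h m))\<^sup>2 + 8 * C\<^sup>2 * (1 / (real m)\<^sup>2)" if m: "m \<ge> 1" for m
    proof -
      \<comment> \<open>After conjugation \<alpha> enters only through its difference with its
        conjugate, that is, through its imaginary part.\<close>
      have h_eq: "cnj (h m) = of_real ((k m)\<^sup>2) * (\<i> * of_real (2 * Im (?\<alpha> m)) * s m + (?\<beta> m * (s m)\<^sup>2 - cnj (?\<beta> m)))"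
      proof -
        have e: "\<i> * of_real (2 * Im (?\<alpha> m)) = ?\<alpha> m - cnj (?\<alpha> m)" by (simp add: complex_eq_iff)
        show ?thesis unfolding h_def f1_def f2_def e
          by (simp add: power2_eq_square algebra_simps)
      qed
      have "norm (\<i> * of_real (2 * Im (?\<alpha> m)) * s m + (?\<beta> m * (s m)\<^sup>2 - cnj (?\<beta> m))) * 1
        \<le> norm (\<i> * of_real (2 * Im (?\<alpha> m)) * s m + (?\<beta> m * (s m)\<^sup>2 - cnj (?\<beta> m))) * (k m)\<^sup>2"
        using k(2)[OF m] by (intro mult_left_mono) auto
      also have "\<dots> = norm (cnj (h m))"
        unfolding h_eq norm_mult[of "of_real ((k m)\<^sup>2)"] norm_of_real by (simp only: abs_power2 mult.commute)
      also have "\<dots> = norm (h m)" by simp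
      finally have 1: "norm (\<i> * of_real (2 * Im (?\<alpha> m)) * s m + (?\<beta> m * (s m)\<^sup>2 - cnj (?\<beta> m))) \<le> norm (h m)" by simp
      have 2: "norm (?\<beta> m * (s m)\<^sup>2 - cnj (?\<beta> m)) \<le> 2 * norm (?\<beta> m)"
      proof -
        have "norm (?\<beta> m * (s m)\<^sup>2) \<le> norm (?\<beta> m) * 1"
          unfolding norm_mult norm_power using s_lt[OF m] by (intro mult_left_mono) auto
        then show ?thesis using norm_triangle_ineq4[of "?\<beta> m * (s m)\<^sup>2" "cnj (?\<beta> m)"] by simp
      qed
      have tri: "norm X \<le> norm (X + Y) + norm Y" for X Y :: complex
        using norm_triangle_ineq4[of "X + Y" Y] by simp
      have "norm (\<i> * of_real (2 * Im (?\<alpha> m)) * s m) = 2 * (norm (s m) * \<bar>Im (?\<alpha> m)\<bar>)"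
        by (simp add: norm_mult)
      then have 3: "2 * (norm (s m) * \<bar>Im (?\<alpha> m)\<bar>) \<le> norm (h m) + 2 * norm (?\<beta> m)"
        using order_trans[OF tri add_mono[OF 1 2]] by simp
      define e where "e = C / m"
      have e: "norm (?\<beta> m) \<le> e" "\<bar>Im (?\<alpha> m) + sin (m * (?t - 1))\<bar> \<le> e"
        using C[OF m] by (simp_all only: e_def)
      then have "e \<ge> 0" using norm_ge_zero order_trans by blast
      have "\<bar>sin (m * (?t - 1))\<bar> \<le> \<bar>Im (?\<alpha> m)\<bar> + e" using e(2) by linarith
      then have "norm (s m) * \<bar>sin (m * (?t - 1))\<bar> \<le> norm (s m) * \<bar>Im (?\<alpha> m)\<bar> + norm (s m) * e"
        unfolding distrib_left[symmetric] by (rule mult_left_mono) simp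
      moreover have "norm (s m) * e \<le> 1 * e" using s_le[OF m] \<open>e \<ge> 0\<close> by (rule mult_right_mono)
      ultimately have "norm (s m) * \<bar>sin (m * (?t - 1))\<bar> \<le> norm (h m) + 2 * e"
        using 3 e(1) norm_ge_zero[of "h m"] by linarith
      then have "(norm (s m) * \<bar>sin (m * (?t - 1))\<bar>)\<^sup>2 \<le> (norm (h m) + 2 * e)\<^sup>2"
        by (rule power_mono) simp
      also have "\<dots> \<le> 2 * (norm (h m))\<^sup>2 + 2 * (2 * e)\<^sup>2"
        using sum_squares_bound[of "norm (h m)" "2 * e"] unfolding power2_sum by linarith
      also have "2 * (2 * e)\<^sup>2 = 8 * C\<^sup>2 * (1 / (real m)\<^sup>2)"
        by (simp add: e_def power_divide power_mult_distrib)
      also have "(norm (s m) * \<bar>sin (m * (?t - 1))\<bar>)\<^sup>2 = (norm (s m))\<^sup>2 * (sin (m * (?t - 1)))\<^sup>2"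
        by (simp add: power_mult_distrib)
      also have "(sin (m * (?t - 1)))\<^sup>2 = (sin (real m * \<tau>))\<^sup>2"
        by (cases "\<tau> \<ge> 0") simp_all
      finally show ?thesis using m by (simp add: w_def)
    qed
    have "summable (\<lambda>m. 1 / (real (Suc m))\<^sup>2)"
      using inverse_power_summable[of 2, where 'a = real] by (subst summable_Suc_iff) (simp add: inverse_eq_divide)
    then have "summable (\<lambda>m. 2 * (norm (h (Suc m)))\<^sup>2 + 8 * C\<^sup>2 * (1 / (real (Suc m))\<^sup>2))"
      by (intro summable_add summable_mult h_sum)
    then have "summable (\<lambda>m. w (Suc m) * (sin (real (Suc m) * \<tau>))\<^sup>2)"
    proof (rule summable_comparison_test')
      fix m
      have "0 \<le> w (Suc m) * (sin (real (Suc m) * \<tau>))\<^sup>2" by (simp add: w_def)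
      then show "norm (w (Suc m) * (sin (real (Suc m) * \<tau>))\<^sup>2) \<le> 2 * (norm (h (Suc m)))\<^sup>2 + 8 * C\<^sup>2 * (1 / (real (Suc m))\<^sup>2)"
        using bound[of "Suc m"] by simp
    qed
    then show ?thesis using summable_Suc_iff[of "\<lambda>m. w m * (sin (real m * \<tau>))\<^sup>2"] by blast
  qed
  moreover have "w m \<ge> 0" for m by (simp add: w_def)
  ultimately have w: "summable w" by (rule summable_if_summable_sin_square[rotated])
  \<comment> \<open>Here a finally becomes bounded: |s|^2 < 1/2 in (1 + a) |s|^2 = a - 1 gives a <=
    3, hence |q|^2 = (1 + a)^2 |s|^2 <= 16 |s|^2.\<close>
  have "eventually (\<lambda>m. w m < 1 / 2) sequentially"
    using order_tendstoD(2)[OF summable_LIMSEQ_zero[OF w], of "1 / 2"] by simp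
  then obtain M where M: "\<And>m. m \<ge> M \<Longrightarrow> w m < 1 / 2" by (auto simp: eventually_sequentially)
  have "norm ((norm (q (Suc m)))\<^sup>2) \<le> 16 * w (Suc m)" if "m \<ge> M" for m
  proof -
    let ?n = "Suc m"
    have n: "?n \<ge> 1" by simp
    have s: "w ?n = (norm (s ?n))\<^sup>2" "(norm (s ?n))\<^sup>2 < 1 / 2" using M[of ?n] that by (simp_all add: w_def)
    have "(1 + a ?n) * (norm (s ?n))\<^sup>2 \<le> (1 + a ?n) * (1 / 2)"
      using s(2) a(1)[OF n] by (intro mult_left_mono) auto
    then have "1 + a ?n \<le> 4" using s2[OF n] by simp
    then have "(1 + a ?n)\<^sup>2 \<le> 4\<^sup>2" using a(1)[OF n] by (intro power_mono) auto
    then have "(1 + a ?n)\<^sup>2 * (norm (s ?n))\<^sup>2 \<le> 4\<^sup>2 * (norm (s ?n))\<^sup>2" by (rule mult_right_mono) simp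
    then show ?thesis unfolding norm_q[OF n] s(1) by (simp add: power_mult_distrib)
  qed
  moreover have "summable (\<lambda>m. 16 * w (Suc m))"
    by (rule summable_mult) (simp add: summable_Suc_iff w)
  ultimately show ?thesis by (rule summable_comparison_test'[rotated])
qed

theorem mainTheorem1:
  fixes T :: "real \<Rightarrow> phase \<Rightarrow> phase"
    and U :: "real \<Rightarrow> real \<Rightarrow> phase \<Rightarrow> phase"
    and J0 J :: "phase \<Rightarrow> phase"
    and \<iota> :: "phase \<Rightarrow> 'h::{real_inner,complete_space}"
    and \<iota>0 :: "phase \<Rightarrow> 'k::{real_inner,complete_space}"
  assumes T: "\<And>\<alpha>. block_diagonal (T \<alpha>) (translation_block \<alpha>)"
    and U: "\<And>t t0. t > 0 \<Longrightarrow> t0 > 0 \<Longrightarrow> block_diagonal (U t t0) (gowdy_block t t0)"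
    and J0: "block_diagonal J0 reference_block"
    and completion_J0: "is_completion J0 \<iota>0"
    and J: "compatible_complex_structure J"
    and completion_J: "is_completion J \<iota>"
    and invariant: "\<And>\<alpha>. inv (T \<alpha>) \<circ> J \<circ> T \<alpha> = J"
    and implementable: "\<And>t t0. t > 0 \<Longrightarrow> t0 > 0 \<Longrightarrow> unitarily_implementable J \<iota> (U t t0)"
  shows "fock_equivalent J J0 \<iota>0"
proof -
  have "\<forall>m\<in>{1..}. \<exists>a q. a > 0 \<and> a\<^sup>2 = 1 + (norm q)\<^sup>2 \<and> (\<forall>b c. J (mode_vec m b c)
      = mode_vec m (\<i> * of_real a * b + q * c) (cnj q * b - \<i> * of_real a * c))"
  proof
    fix m :: nat assume "m \<in> {1..}"
    then have "m \<ge> 1" by simp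
    from invariant_structure_mode_vec[OF T invariant J this] show "\<exists>a q. a > 0 \<and> a\<^sup>2 = 1 + (norm q)\<^sup>2 \<and> (\<forall>b c. J (mode_vec m b c)
      = mode_vec m (\<i> * of_real a * b + q * c) (cnj q * b - \<i> * of_real a * c))" by metis
  qed
  then obtain a q where aq: "\<forall>m\<in>{1..}. a m > 0 \<and> (a m)\<^sup>2 = 1 + (norm (q m))\<^sup>2 \<and> (\<forall>b c. J (mode_vec m b c)
      = mode_vec m (\<i> * of_real (a m) * b + q m * c) (cnj (q m) * b - \<i> * of_real (a m) * c))"
    by metis
  then have block: "\<And>m b c. m \<ge> 1 \<Longrightarrow> J (mode_vec m b c)
      = mode_vec m (\<i> * of_real (a m) * b + q m * c) (cnj (q m) * b - \<i> * of_real (a m) * c)"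
    and a: "\<And>m. m \<ge> 1 \<Longrightarrow> a m > 0" "\<And>m. m \<ge> 1 \<Longrightarrow> (a m)\<^sup>2 = 1 + (norm (q m))\<^sup>2" by simp_all
  show ?thesis
    by (rule fock_equivalent_if_summable[OF J0 completion_J0 J block a
          invariant_structure_coeffs_summable[OF J completion_J U implementable block a]])
qed

end
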